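(* Let $\beta>0$, let $L_\beta:=\mathbb{Z}\times 2\beta\mathbb{Z}\subseteq\mathbb{R}^2$, and let $$\omega^*_\beta:=\{(0,0),\,(0,\beta),\,(1/2,\beta/2),\,(1/2,3\beta/2)\}\subseteq\mathbb{R}^2 .$$ Then the $4$-point configuration $\omega^*_\beta$ is $L_\beta$-universally optimal if and only if $\beta\ge 1/\sqrt{3}$.
   Context: For a lattice $\Lambda\subseteq\mathbb{R}^d$ and $a>0$, define the $\Lambda$-periodic potential $F_{a,\Lambda}(x):=\sum_{v\in\Lambda}e^{-a|x+v|^2}$ for $x\in\mathbb{R}^d$. For a potential $F:\mathbb{R}^d\to(-\infty,\infty]$ and a finite multiset $\omega_n=\{x_1,\dots,x_n\}\subseteq\mathbb{R}^d$ of cardinality $n$, the $F$-energy is $E_F(\omega_n):=\sum_{i=1}^n\sum_{j\ne i}F(x_i-x_j)$. An $n$-point configuration (multiset) $\omega_n$ is called $F$-optimal if $E_F(\omega_n)=\inf\{E_F(\omega'_n) : \omega'_n\subseteq\mathbb{R}^d \text{ a multiset},\ |\omega'_n|=n\}$. An $n$-point configuration $\omega_n\subseteq\mathbb{R}^d$ is called $\Lambda$-universally optimal if it is $F_{a,\Lambda}$-optimal for every $a>0$. *)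

theory Defs
  imports "HOL-Analysis.Analysis" "HOL-Library.Multiset"
begin

text \<open>
  For a lattice \<open>\<Lambda>\<close> and \<open>a > 0\<close> the family below is absolutely summable, so \<open>infsum\<close> is the
  actual value of the series (and not the default value 0 of a divergent sum).
\<close>

definition periodic_gaussian :: "real \<Rightarrow> (real ^ 'd) set \<Rightarrow> real ^ 'd \<Rightarrow> real"
  where "periodic_gaussian a \<Lambda> x = (\<Sum>\<^sub>\<infinity>v\<in>\<Lambda>. exp (- a * (norm (x + v))\<^sup>2))"

text \<open>
  Removing one copy of \<open>x\<close> from the multiset corresponds to omitting the diagonal \<open>j = i\<close> in the
  double sum over indices; repeated points still contribute \<open>F 0\<close> for each ordered pair.
  Potentials are meant to take values in \<open>(-\<infinity>, \<infinity>]\<close>.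
\<close>

definition energy :: "(real ^ 'd \<Rightarrow> ereal) \<Rightarrow> (real ^ 'd) multiset \<Rightarrow> ereal"
  where "energy F \<omega> = (\<Sum>x\<in>#\<omega>. \<Sum>y\<in>#\<omega> - {#x#}. F (x - y))"

definition optimal :: "(real ^ 'd \<Rightarrow> ereal) \<Rightarrow> (real ^ 'd) multiset \<Rightarrow> bool"
  where "optimal F \<omega> \<longleftrightarrow> energy F \<omega> = (INF \<omega>'\<in>{\<omega>'. size \<omega>' = size \<omega>}. energy F \<omega>')"

definition universally_optimal :: "(real ^ 'd) set \<Rightarrow> (real ^ 'd) multiset \<Rightarrow> bool"
  where "universally_optimal \<Lambda> \<omega> \<longleftrightarrow>
    (\<forall>a>0. optimal (\<lambda>x. ereal (periodic_gaussian a \<Lambda> x)) \<omega>)"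

definition rect_lattice :: "real \<Rightarrow> (real ^ 2) set"
  where "rect_lattice \<beta> = {vector [of_int j, 2 * \<beta> * of_int k] | j k :: int. True}"

definition four_points :: "real \<Rightarrow> (real ^ 2) multiset"
  where "four_points \<beta> =
    {# vector [0, 0], vector [0, \<beta>], vector [1/2, \<beta>/2], vector [1/2, 3*\<beta>/2] #}"

end

theory Submission
  imports Defs "HOL-Probability.Probability" "HOL-Real_Asymp.Real_Asymp"
begin

text \<open>
  The potential factors as \<open>theta a u * theta b v\<close> with $u = x_1$, $v = x_2 / (2\beta)$ and
  $b = 4 a \beta^2$, so that $\beta \ge 1/\sqrt 3$ means $b \ge 4a/3$. By Poisson summation and the Jacobi
  triple product, \<open>theta a u\<close> is a constant times $\prod_n (1 + r_n s)$ with $s = \cos 2\pi u$ and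
  $r_n = 1 / \cosh ((2n+1) \pi^2 / a)$, and similarly \<open>theta b v\<close> in $t = \cos 2\pi v$.

  Optimality is a linear programming bound. The minorant is
  $g = a_0 + a_1 s + b_1 t + b_2 (2t^2-1)$ with nonnegative $a_1, b_1, b_2$; it agrees with the potential at
  the differences $(s,t) = (1,-1), (-1,0)$ of the configuration, and the sums of its nonconstant terms
  over the configuration vanish. It exists for the finite partial products as soon as
  \[ \prod (1-\rho_n) \, (1 - \sum w_n) \ge \prod (1-w_n) \, (1 - \sum \rho_n), \qquad w_n = 2r_n/(1+r_n), \]
  where the $\rho_n$ are the coefficients for $b$. This inequality is monotone in the $\rho_n$, so $b = 4a/3$ is
  the critical case. For $a \le 21/4$ it follows from $w_n \le \rho_n$, for larger $a$ from
  estimates of the Gaussian series.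

  If $\beta < 1/\sqrt 3$, then shifting the second and the fourth point horizontally by the same small
  amount increases the minimal distance, hence decreases the energy for large \<open>a\<close>.
\<close>

subsection \<open>Products of linear factors\<close>

text \<open>The threshold is geometric: at \<beta> = 1 / sqrt 3 the configuration repeated along the
  lattice is the triangular lattice, and below it vertical neighbours are closer than diagonal ones.
  The four coefficients of the minorant are fixed by its two prescribed values, the
  \<open>t\<close>-derivative at \<open>(-1, 0)\<close> and the \<open>s\<close>-derivative at
  \<open>(1, -1)\<close>. Only the sign of \<open>b2\<close> is then in doubt. Partial products keep
  all derivatives elementary. The limit is taken in the energy inequality, so the minorants
  themselves need not converge. The split at 21/4 has two reasons. With b = 4a/3 the comparison of
  w_0 with \<rho>_0 breaks down near a = 5.38. For large \<open>a\<close>, after division by the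
  leading Gaussians, the two sides differ by about a (1/pi) (1/3 - 1/pi). This is positive because
  pi > 3, but so small that pi is used to four digits, and the estimates take effect only near a =
  5.07.\<close>

definition lin_prod :: "(nat \<Rightarrow> real) \<Rightarrow> nat \<Rightarrow> real \<Rightarrow> real"
  where "lin_prod r N s = (\<Prod>n<N. 1 + r n * s)"

lemma lin_factor_pos:
  fixes r s :: real
  assumes "0 < r" "r < 1" "-1 \<le> s"
  shows "0 < 1 + r * s"
proof -
  have "r * (-1) \<le> r * s" using assms by (intro mult_left_mono) auto
  thus ?thesis using assms by linarith
qed

lemma lin_prod_pos:
  assumes "\<And>n. 0 < r n" "\<And>n. r n < 1" "-1 \<le> s"
  shows "0 < lin_prod r N s"
  unfolding lin_prod_def by (intro prod_pos ballI lin_factor_pos assms)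

lemma lin_prod_strict_mono:
  assumes "\<And>n. 0 < r n" "\<And>n. r n < 1" "-1 \<le> s" "s < s'" "0 < N"
  shows "lin_prod r N s < lin_prod r N s'"
  unfolding lin_prod_def
proof (rule prod_mono_strict[of 0])
  fix n
  show "0 \<le> 1 + r n * s \<and> 1 + r n * s \<le> 1 + r n * s'"
    using lin_factor_pos[OF assms(1)[of n] assms(2)[of n] assms(3)] assms(1)[of n] assms(4)
    by (simp add: mult_left_mono)
next
  fix n
  show "0 < 1 + r n * s'" using lin_factor_pos[OF assms(1)[of n] assms(2)[of n], of s'] assms by simp
next
  show "finite {..<N}" by simp
next
  show "1 + r 0 * s < 1 + r 0 * s'" using assms(1)[of 0] assms(4) by simp
  show "0 \<in> {..<N}" using assms(5) by simp
qed

lemma continuous_on_lin_prod [continuous_intros]: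
  "continuous_on S g \<Longrightarrow> continuous_on S (\<lambda>x. lin_prod r N (g x))"
  unfolding lin_prod_def by (intro continuous_intros)

text \<open>The right-hand side is the exponential of the tangent to the concave function \<open>ln \<circ> lin_prod r N\<close>.\<close>

lemma lin_prod_le_exp:
  assumes "\<And>n. 0 < r n" "\<And>n. r n < 1" "-1 \<le> s" "-1 \<le> s + z"
  shows "lin_prod r N (s + z) \<le> lin_prod r N s * exp (z * (\<Sum>n<N. r n / (1 + r n * s)))"
proof -
  have "lin_prod r N (s + z) \<le> (\<Prod>n<N. (1 + r n * s) * exp (z * (r n / (1 + r n * s))))"
    unfolding lin_prod_def
  proof (intro prod_mono conjI)
    fix n
    have p: "0 < 1 + r n * s" by (intro lin_factor_pos assms)
    show "0 \<le> 1 + r n * (s + z)" by (intro less_imp_le lin_factor_pos assms)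
    have "1 + r n * (s + z) = (1 + r n * s) * (1 + z * (r n / (1 + r n * s)))"
      using p by (simp add: field_simps)
    also have "\<dots> \<le> (1 + r n * s) * exp (z * (r n / (1 + r n * s)))"
      using p by (intro mult_left_mono exp_ge_add_one_self) auto
    finally show "1 + r n * (s + z) \<le> \<dots>" .
  qed
  also have "\<dots> = lin_prod r N s * exp (z * (\<Sum>n<N. r n / (1 + r n * s)))"
    by (simp add: prod.distrib lin_prod_def sum_distrib_left exp_sum)
  finally show ?thesis .
qed

lemma exp_gt_add_one:
  fixes x :: real assumes "x \<noteq> 0" shows "1 + x < exp x"
  using assms ln_eq_minus_one[of "exp x"] ln_le_minus_one[of "exp x"] by fastforce

lemma lin_prod_less_exp:
  assumes "\<And>n. 0 < r n" "\<And>n. r n < 1" "-1 \<le> s" "-1 \<le> s + z" "z \<noteq> 0" "0 < N"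
  shows "lin_prod r N (s + z) < lin_prod r N s * exp (z * (\<Sum>n<N. r n / (1 + r n * s)))"
proof -
  have "lin_prod r N (s + z) < (\<Prod>n<N. (1 + r n * s) * exp (z * (r n / (1 + r n * s))))"
    unfolding lin_prod_def
  proof (rule prod_mono_strict[of 0])
    fix n
    have p: "0 < 1 + r n * s" by (intro lin_factor_pos assms)
    have eq: "1 + r n * (s + z) = (1 + r n * s) * (1 + z * (r n / (1 + r n * s)))"
      using p by (simp add: field_simps)
    also have "\<dots> \<le> (1 + r n * s) * exp (z * (r n / (1 + r n * s)))"
      using p by (intro mult_left_mono exp_ge_add_one_self) auto
    finally show "0 \<le> 1 + r n * (s + z) \<and> 1 + r n * (s + z) \<le> (1 + r n * s) * exp (z * (r n / (1 + r n * s)))"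
      using lin_factor_pos[OF assms(1)[of n] assms(2)[of n] assms(4)] by simp
    show "0 < (1 + r n * s) * exp (z * (r n / (1 + r n * s)))" using p by simp
  next
    show "finite {..<N}" by simp
  next
    have p: "0 < 1 + r 0 * s" by (intro lin_factor_pos assms)
    have "1 + r 0 * (s + z) = (1 + r 0 * s) * (1 + z * (r 0 / (1 + r 0 * s)))"
      using p by (simp add: field_simps)
    also have "\<dots> < (1 + r 0 * s) * exp (z * (r 0 / (1 + r 0 * s)))"
      using p assms(1)[of 0] assms(5) by (intro mult_strict_left_mono exp_gt_add_one) auto
    finally show "1 + r 0 * (s + z) < (1 + r 0 * s) * exp (z * (r 0 / (1 + r 0 * s)))" .
    show "0 \<in> {..<N}" using assms(6) by simp
  qed
  also have "\<dots> = lin_prod r N s * exp (z * (\<Sum>n<N. r n / (1 + r n * s)))"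
    by (simp add: prod.distrib lin_prod_def sum_distrib_left exp_sum)
  finally show ?thesis .
qed

text \<open>Dividing by the value at 1 turns each factor into \<open>1 - x n\<close> with
  \<open>x n\<close> in the unit interval, and Weierstrass' inequality bounds such a product below
  by one minus the sum.\<close>

lemma lin_prod_tangent_1:
  assumes "\<And>n. 0 < r n" "\<And>n. r n < 1" "-1 \<le> s" "s \<le> 1"
  shows "lin_prod r N 1 * (1 - (1 - s) * (\<Sum>n<N. r n / (1 + r n))) \<le> lin_prod r N s"
proof -
  define x where "x n = (1 - s) * (r n / (1 + r n))" for n
  have x: "0 \<le> x n" "x n \<le> 1" for n
  proof -
    show "0 \<le> x n" using assms(1)[of n] assms(4) by (simp add: x_def)
    have "x n \<le> 2 * (r n / (1 + r n))" unfolding x_def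
      using assms(1)[of n] assms(3) by (intro mult_right_mono) auto
    also have "\<dots> \<le> 1" using assms(1,2)[of n] by (simp add: field_simps)
    finally show "x n \<le> 1" .
  qed
  have "lin_prod r N 1 * (1 - (\<Sum>n<N. x n)) \<le> lin_prod r N 1 * (\<Prod>n<N. 1 - x n)"
    using x lin_prod_pos[of r 1 N, OF assms(1,2)]
    by (intro mult_left_mono Weierstrass_prod_ineq) auto
  also have "\<dots> = (\<Prod>n<N. (1 + r n) * (1 - x n))" by (simp add: lin_prod_def prod.distrib)
  also have "\<dots> = lin_prod r N s" unfolding lin_prod_def
  proof (intro prod.cong refl)
    fix n show "(1 + r n) * (1 - x n) = 1 + r n * s"
      using assms(1)[of n] by (simp add: x_def field_simps)
  qed
  finally show ?thesis by (simp add: x_def sum_distrib_left)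
qed

text \<open>\<open>D t\<close> is the divided difference of \<open>lin_prod r N\<close> at the nodes \<open>0, 0, t\<close>.\<close>

lemma lin_prod_hermite:
  assumes "\<And>n. 0 < r n" "\<And>n. r n < 1"
  shows "\<exists>D. 0 \<le> D (-1) \<and> (\<forall>t\<in>{-1..1}. D (-1) \<le> D t \<and>
           lin_prod r N t = 1 + (\<Sum>n<N. r n) * t + t\<^sup>2 * D t)"
proof (induction N)
  case 0
  show ?case by (intro exI[of _ "\<lambda>_. 0"]) (simp add: lin_prod_def)
next
  case (Suc N)
  then obtain D where D: "0 \<le> D (-1)" "\<And>t. t \<in> {-1..1} \<Longrightarrow> D (-1) \<le> D t"
    "\<And>t. t \<in> {-1..1} \<Longrightarrow> lin_prod r N t = 1 + (\<Sum>n<N. r n) * t + t\<^sup>2 * D t" by blast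
  \<comment> \<open>Coefficient of \<open>t\<^sup>2\<close> after multiplying
    \<open>1 + S t + t\<^sup>2 D\<close> by the new linear factor.\<close>
  define E where "E t = r N * (\<Sum>n<N. r n) + (1 + r N * t) * D t" for t
  have S: "0 \<le> (\<Sum>n<N. r n)" using assms(1) by (intro sum_nonneg) (simp add: less_imp_le)
  show ?case
  proof (intro exI[of _ E] conjI ballI)
    show "0 \<le> E (-1)" using S D(1) assms(1,2)[of N] by (simp add: E_def)
    fix t :: real assume t: "t \<in> {-1..1}"
    have "(1 + r N * (-1)) * D (-1) \<le> (1 + r N * t) * D t"
      using D(1) D(2)[OF t] t assms(1,2)[of N] lin_factor_pos[OF assms(1)[of N] assms(2)[of N], of t]
      by (intro mult_mono add_left_mono mult_left_mono) auto
    thus "E (-1) \<le> E t" by (simp add: E_def)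
    have "lin_prod r (Suc N) t = lin_prod r N t * (1 + r N * t)" by (simp add: lin_prod_def)
    also have "\<dots> = 1 + (\<Sum>n<Suc N. r n) * t + t\<^sup>2 * E t"
      using D(3)[OF t] by (simp add: E_def algebra_simps power2_eq_square)
    finally show "lin_prod r (Suc N) t = 1 + (\<Sum>n<Suc N. r n) * t + t\<^sup>2 * E t" .
  qed
qed

text \<open>At an interior minimum of the difference \<open>G\<close> between the product and the minorant, move in the
  direction in which the logarithmic derivatives of the two factors cancel. By strict logarithmic
  concavity the product decreases in both directions, whereas the minorant is convex in \<open>t\<close> and
  linear in \<open>s\<close>: so there is none. The condition \<open>cond\<close> says \<open>0 \<le> b2\<close>.\<close>

lemma lin_prod_minorant:
  fixes r \<rho> :: "nat \<Rightarrow> real"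
  assumes r: "\<And>n. 0 < r n" "\<And>n. r n < 1" and \<rho>: "\<And>n. 0 < \<rho> n" "\<And>n. \<rho> n < 1"
  assumes N: "0 < N"
  assumes cond: "lin_prod r N (-1) * (1 - (\<Sum>n<N. \<rho> n))
    \<le> lin_prod \<rho> N (-1) * (lin_prod r N 1 * (1 - 2 * (\<Sum>n<N. r n / (1 + r n))))"
  shows "\<exists>a0 a1 b1 b2. 0 \<le> a1 \<and> 0 \<le> b1 \<and> 0 \<le> b2 \<and>
    (\<forall>s\<in>{-1..1}. \<forall>t\<in>{-1..1}.
       a0 + a1 * s + b1 * t + b2 * (2 * t\<^sup>2 - 1) \<le> lin_prod r N s * lin_prod \<rho> N t) \<and>
    a0 + a1 - b1 + b2 = lin_prod r N 1 * lin_prod \<rho> N (-1) \<and>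
    a0 - a1 - b2 = lin_prod r N (-1)"
proof -
  define A where "A = lin_prod r N"
  define B where "B = lin_prod \<rho> N"
  define S where "S = (\<Sum>n<N. \<rho> n)"
  define p where "p = (\<Sum>n<N. r n / (1 + r n))"
  \<comment> \<open>\<open>R\<close> is the \<open>t\<close>-derivative of the product at
    \<open>(-1, 0)\<close> and \<open>\<sigma>\<close> its \<open>s\<close>-derivative at
    \<open>(1, -1)\<close>; \<open>c\<close> is then forced by the value at
    \<open>(1, -1)\<close>.\<close>
  define R where "R = A (-1) * S"
  define \<sigma> where "\<sigma> = A 1 * p * B (-1)"
  define c where "c = (B (-1) * (A 1 * (1 - 2 * p)) - A (-1) * (1 - S)) / 2"
  define G where "G x = A (fst x) * B (snd x) -
     (A (-1) + R * snd x + 2 * c * (snd x)\<^sup>2 + \<sigma> * (1 + fst x))" for x :: "real \<times> real"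
  have Apos: "0 < A s" if "-1 \<le> s" for s unfolding A_def by (intro lin_prod_pos r that)
  have Bpos: "0 < B s" if "-1 \<le> s" for s unfolding B_def by (intro lin_prod_pos \<rho> that)
  have Spos: "0 < S" unfolding S_def using N \<rho> by (intro sum_pos) auto
  have ppos: "0 < p" unfolding p_def using N
    by (intro sum_pos divide_pos_pos add_pos_pos r) auto
  have c0: "0 \<le> c" using cond by (simp add: c_def A_def B_def S_def p_def)
  have R0: "0 \<le> R" using Spos Apos[of "-1"] by (simp add: R_def)
  have \<sigma>0: "0 \<le> \<sigma>" using ppos Apos[of 1] Bpos[of "-1"] by (simp add: \<sigma>_def)
  have tang: "A 1 * (1 - (1 - s) * p) \<le> A s" if "s \<in> {-1..1}" for s
    unfolding A_def p_def using that by (intro lin_prod_tangent_1 r) auto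
  obtain D where D: "0 \<le> D (-1)" "\<And>t. t \<in> {-1..1} \<Longrightarrow> D (-1) \<le> D t"
    "\<And>t. t \<in> {-1..1} \<Longrightarrow> B t = 1 + S * t + t\<^sup>2 * D t"
    using lin_prod_hermite[of \<rho> N, OF \<rho>] unfolding B_def S_def by blast
  \<comment> \<open>This says that \<open>G\<close> is nonnegative at the corner
    \<open>(-1, -1)\<close>; it comes from the tangent inequality at \<open>s = -1\<close>.\<close>
  have cD: "2 * c \<le> A (-1) * D (-1)"
  proof -
    have "A 1 * (1 - 2 * p) * B (-1) \<le> A (-1) * B (-1)"
      using tang[of "-1"] Bpos[of "-1"] by (intro mult_right_mono) auto
    moreover have "A (-1) * B (-1) = A (-1) * (1 - S + D (-1))" using D(3)[of "-1"] by simp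
    ultimately show ?thesis by (simp add: c_def algebra_simps)
  qed
  have B0: "B 0 = 1" by (simp add: B_def lin_prod_def)
  have "compact ({-1..1} \<times> {-1..1} :: (real \<times> real) set)"
    by (intro compact_Times compact_Icc)
  moreover have "continuous_on ({-1..1} \<times> {-1..1}) G"
    unfolding G_def A_def B_def by (intro continuous_intros)
  ultimately obtain x where x: "x \<in> {-1..1} \<times> {-1..1}"
    and xmin: "\<And>y. y \<in> {-1..1} \<times> {-1..1} \<Longrightarrow> G x \<le> G y"
    using continuous_attains_inf[of "{-1..1} \<times> {-1..1}" G] by fastforce
  obtain s t where st: "x = (s, t)" by (cases x)
  have s: "-1 \<le> s" "s \<le> 1" and t: "-1 \<le> t" "t \<le> 1" using x st by auto
  have "0 \<le> G (s, t)"
  proof (rule ccontr)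
    assume neg: "\<not> 0 \<le> G (s, t)"
    \<comment> \<open>The edges \<open>s = -1\<close> and \<open>t = -1\<close> carry the zeros of
      \<open>G\<close>, so there negativity is refuted. On the other edges and inside, minimality
      alone is refuted.\<close>
    have "s \<noteq> -1"
    proof
      assume "s = -1"
      hence "G (s, t) = t\<^sup>2 * (A (-1) * D t - 2 * c)"
        using D(3)[of t] t by (simp add: G_def R_def algebra_simps)
      moreover have "A (-1) * D (-1) \<le> A (-1) * D t"
        using D(2)[of t] t Apos[of "-1"] by (intro mult_left_mono) auto
      ultimately show False using neg cD by simp
    qed
    hence s1: "-1 < s" using s by simp
    have "t \<noteq> -1"
    proof
      assume t1: "t = -1"
      have "A 1 * (1 - (1 - s) * p) * B (-1) \<le> A s * B (-1)"
        using tang[of s] s Bpos[of "-1"] by (intro mult_right_mono) auto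
      moreover have "2 * c = B (-1) * (A 1 * (1 - 2 * p)) - A (-1) * (1 - S)" by (simp add: c_def)
      ultimately have "0 \<le> G (s, t)" unfolding t1
        by (simp add: G_def R_def \<sigma>_def algebra_simps)
      thus False using neg by simp
    qed
    hence t1: "-1 < t" using t by simp
    have Aless: "A (-1) < A s" unfolding A_def using s1 N
      by (intro lin_prod_strict_mono r) auto
    have Bless: "B (-1) < B t" unfolding B_def using t1 N
      by (intro lin_prod_strict_mono \<rho>) auto
    have t2: "t < 1"
    proof (rule ccontr)
      assume "\<not> t < 1"
      hence t3: "t = 1" using t by simp
      have "G (s, 1) - G (s, 0) = A s * (S + D 1) - R - 2 * c"
        using D(3)[of 1] B0 by (simp add: G_def algebra_simps)
      moreover have "A s * (S + D 1) \<ge> A s * (S + D (-1))"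
        using D(2)[of 1] Apos[OF s(1)] by (intro mult_left_mono) auto
      moreover have "A s * (S + D (-1)) > A (-1) * (S + D (-1))"
        using Aless Spos D(1) by (intro mult_strict_right_mono) auto
      ultimately have "G (s, 0) < G (s, 1)" using cD by (simp add: R_def algebra_simps)
      moreover have "G (s, 1) \<le> G (s, 0)" using xmin[of "(s, 0)"] st t3 s by simp
      ultimately show False by simp
    qed
    have s2: "s < 1"
    proof (rule ccontr)
      assume "\<not> s < 1"
      hence s3: "s = 1" using s by simp
      \<comment> \<open>Small enough that \<open>1 + e * p\<close> stays below
        \<open>B t / B (-1)\<close>; the factor 2 in the denominator provides strictness.\<close>
      define e where "e = min 1 ((B t - B (-1)) / (2 * p * B (-1)))"
      have e: "0 < e" "e \<le> 1" using Bless ppos Bpos[of "-1"] by (auto simp: e_def)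
      have "e * (2 * p * B (-1)) \<le> B t - B (-1)"
      proof -
        have "e \<le> (B t - B (-1)) / (2 * p * B (-1))" by (simp add: e_def)
        thus ?thesis using ppos Bpos[of "-1"] by (simp add: pos_le_divide_eq)
      qed
      moreover have "e * (p * B (-1)) < e * (2 * p * B (-1))" using e ppos Bpos[of "-1"] by simp
      ultimately have key: "B (-1) * (1 + e * p) < B t" by (simp add: algebra_simps)
      have "A (1 + (-e)) \<le> A 1 * exp ((-e) * (\<Sum>n<N. r n / (1 + r n * 1)))"
        unfolding A_def using e by (intro lin_prod_le_exp r) auto
      also have "\<dots> = A 1 / exp (e * p)" by (simp add: p_def exp_minus field_simps)
      also have "\<dots> \<le> A 1 / (1 + e * p)"
        using Apos[of 1] e ppos exp_ge_add_one_self[of "e * p"]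
        by (intro divide_left_mono mult_pos_pos) (auto intro: add_pos_pos)
      finally have A1: "A (1 - e) \<le> A 1 / (1 + e * p)" by simp
      have q: "0 < 1 + e * p" using e ppos by (simp add: add_pos_pos)
      have "A (1 - e) * B t \<le> A 1 / (1 + e * p) * B t"
        using A1 Bpos[OF t(1)] by (intro mult_right_mono) auto
      moreover have "A 1 * B t - A 1 / (1 + e * p) * B t = A 1 * e * p * (B t / (1 + e * p))"
        using q by (simp add: field_simps)
      moreover have "A 1 * e * p * (B t / (1 + e * p)) > A 1 * e * p * B (-1)"
        using key q e ppos Apos[of 1] by (intro mult_strict_left_mono) (auto simp: field_simps)
      moreover have "G (1, t) - G (1 - e, t) = A 1 * B t - A (1 - e) * B t - A 1 * e * p * B (-1)"
        by (simp add: G_def \<sigma>_def algebra_simps)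
      ultimately have "G (1 - e, t) < G (1, t)" by simp
      moreover have "G (1, t) \<le> G (1 - e, t)" using xmin[of "(1 - e, t)"] st s3 t e by simp
      ultimately show False by simp
    qed
    define l where "l = (\<Sum>n<N. r n / (1 + r n * s))"
    define m where "m = (\<Sum>n<N. \<rho> n / (1 + \<rho> n * t))"
    have l: "0 < l" unfolding l_def using N
      by (intro sum_pos divide_pos_pos lin_factor_pos r s) auto
    have m: "0 < m" unfolding m_def using N
      by (intro sum_pos divide_pos_pos lin_factor_pos \<rho> t) auto
    \<comment> \<open>The common step keeps both displaced points \<open>(s + e/l, t - e/m)\<close>
      and \<open>(s - e/l, t + e/m)\<close> in the square.\<close>
    define e where "e = min (min (l * (1 - s)) (l * (1 + s))) (min (m * (1 - t)) (m * (1 + t)))"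
    have e: "0 < e" "e \<le> l * (1 - s)" "e \<le> l * (1 + s)" "e \<le> m * (1 - t)" "e \<le> m * (1 + t)"
      using l m s1 s2 t1 t2 by (auto simp: e_def)
    have es: "e / l \<le> 1 - s" "e / l \<le> 1 + s" "e / m \<le> 1 - t" "e / m \<le> 1 + t"
      using e l m by (simp_all add: pos_divide_le_eq mult.commute)
    have el: "0 < e / l" "0 < e / m" using e l m by auto
    have F: "A (s + \<tau> / l) * B (t - \<tau> / m) < A s * B t"
      if \<tau>: "\<tau> = e \<or> \<tau> = - e" for \<tau>
    proof -
      have "A (s + \<tau> / l) < A s * exp ((\<tau> / l) * (\<Sum>n<N. r n / (1 + r n * s)))"
        unfolding A_def by (rule lin_prod_less_exp) (use r s N \<tau> es el in auto)
      hence 1: "A (s + \<tau> / l) < A s * exp \<tau>" using l by (simp flip: l_def)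
      have "B (t + (- \<tau> / m)) < B t * exp ((- \<tau> / m) * (\<Sum>n<N. \<rho> n / (1 + \<rho> n * t)))"
        unfolding B_def by (rule lin_prod_less_exp) (use \<rho> t N \<tau> es el in auto)
      hence 2: "B (t - \<tau> / m) < B t * exp (- \<tau>)" using m by (simp flip: m_def)
      have "A (s + \<tau> / l) * B (t - \<tau> / m) < (A s * exp \<tau>) * (B t * exp (- \<tau>))"
        using 1 2 Apos[of "s + \<tau> / l"] Bpos[of "t - \<tau> / m"] \<tau> es el
        by (intro mult_strict_mono') (auto intro!: less_imp_le)
      also have "\<dots> = A s * B t" by (simp add: exp_minus)
      finally show ?thesis .
    qed
    have "G (s, t) \<le> G (s + e / l, t - e / m)" "G (s, t) \<le> G (s - e / l, t + e / m)"
      using xmin[of "(s + e / l, t - e / m)"] xmin[of "(s - e / l, t + e / m)"] es el s t st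
      by (auto simp: divide_nonneg_nonneg intro: add_increasing2 order_trans[of _ 0])
    hence "2 * G (s, t) \<le> G (s + e / l, t - e / m) + G (s - e / l, t + e / m)" by simp
    \<comment> \<open>The affine part of the minorant cancels in this symmetric second difference;
      only the square in \<open>t\<close> leaves a term.\<close>
    hence "2 * (A s * B t) + 4 * c * (e / m)\<^sup>2
       \<le> A (s + e / l) * B (t - e / m) + A (s - e / l) * B (t + e / m)"
      by (simp add: G_def algebra_simps power2_eq_square)
    moreover have "0 \<le> 4 * c * (e / m)\<^sup>2" using c0 by simp
    ultimately show False using F[of e] F[of "-e"] by simp
  qed
  hence G0: "0 \<le> G y" if "y \<in> {-1..1} \<times> {-1..1}" for y using xmin[OF that] st by simp
  show ?thesis
  proof (rule exI[of _ "A (-1) + c + \<sigma>"], rule exI[of _ \<sigma>], rule exI[of _ R], rule exI[of _ c],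
      intro conjI ballI)
    show "0 \<le> \<sigma>" "0 \<le> R" "0 \<le> c" by fact+
    fix s t :: real assume "s \<in> {-1..1}" "t \<in> {-1..1}"
    thus "A (-1) + c + \<sigma> + \<sigma> * s + R * t + c * (2 * t\<^sup>2 - 1) \<le> lin_prod r N s * lin_prod \<rho> N t"
      using G0[of "(s, t)"] by (simp add: G_def A_def B_def algebra_simps)
  next
    show "A (-1) + c + \<sigma> + \<sigma> - R + c = lin_prod r N 1 * lin_prod \<rho> N (-1)"
      by (simp add: c_def R_def \<sigma>_def flip: A_def B_def) (simp add: field_simps)
    show "A (-1) + c + \<sigma> - \<sigma> - c = lin_prod r N (-1)" by (simp add: A_def)
  qed
qed

section \<open>Monotonicity of the critical inequality\<close>

text \<open>The quotient \<open>(1 - sum v) / prod (1 - v)\<close> decreases in each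
  \<open>v n\<close>. In the induction, 1 - S - v is written as (1 - v)(1 - S) - v S: the first
  parts are compared by the hypothesis, the second by \<open>P \<le> Q\<close>,
  \<open>W \<le> S\<close> and \<open>w N \<le> v N\<close>.\<close>

lemma prod_sum_compare:
  fixes w v :: "nat \<Rightarrow> real"
  assumes "\<And>n. 0 \<le> w n" "\<And>n. w n \<le> v n" "\<And>n. v n < 1"
  shows "(\<Prod>n<N. 1 - w n) * (1 - (\<Sum>n<N. v n)) \<le> (\<Prod>n<N. 1 - v n) * (1 - (\<Sum>n<N. w n))"
proof (induction N)
  case (Suc N)
  define P Q S W where "P = (\<Prod>n<N. 1 - v n)" and "Q = (\<Prod>n<N. 1 - w n)"
    and "S = (\<Sum>n<N. v n)" and "W = (\<Sum>n<N. w n)"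
  have IH: "Q * (1 - S) \<le> P * (1 - W)" using Suc by (simp add: P_def Q_def S_def W_def)
  have v: "0 \<le> v n" for n using assms(1,2)[of n] by linarith
  have w: "w n < 1" for n using assms(2,3)[of n] by linarith
  have P0: "0 \<le> P" unfolding P_def using assms(3) by (intro prod_nonneg) (simp add: less_imp_le)
  have PQ: "P \<le> Q" unfolding P_def Q_def using assms by (intro prod_mono) (auto intro: less_imp_le)
  have W0: "0 \<le> W" unfolding W_def using assms by (intro sum_nonneg) auto
  have WS: "W \<le> S" unfolding S_def W_def using assms by (intro sum_mono) auto
  have "P * (1 - v N) * (w N * W) \<le> Q * (1 - w N) * (v N * S)"
    using P0 PQ W0 WS assms(1,2,3)[of N] v[of N] w[of N] by (intro mult_mono) auto
  moreover have "(1 - w N) * (1 - v N) * (Q * (1 - S)) \<le> (1 - w N) * (1 - v N) * (P * (1 - W))"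
    using IH w[of N] assms(3)[of N] by (intro mult_left_mono) auto
  ultimately have "Q * (1 - w N) * (1 - (S + v N)) \<le> P * (1 - v N) * (1 - (W + w N))"
    by (simp add: algebra_simps)
  thus ?case by (simp add: P_def Q_def S_def W_def)
qed simp

text \<open>Transitivity of the comparison of the quotients \<open>(1 - sum) / prod\<close>; it
  carries the inequality from the critical parameter 4a/3 to every larger \<open>b\<close>.\<close>

lemma prod_sum_compare_trans:
  fixes w v v' :: "nat \<Rightarrow> real"
  assumes "\<And>n. 0 \<le> v n" "\<And>n. v n \<le> v' n" "\<And>n. v' n < 1" "\<And>n. w n < 1"
  assumes "(\<Prod>n<N. 1 - w n) * (1 - (\<Sum>n<N. v n)) \<le> (\<Prod>n<N. 1 - v n) * (1 - (\<Sum>n<N. w n))"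
  shows "(\<Prod>n<N. 1 - w n) * (1 - (\<Sum>n<N. v' n)) \<le> (\<Prod>n<N. 1 - v' n) * (1 - (\<Sum>n<N. w n))"
proof -
  define P P' Q S S' W where "P = (\<Prod>n<N. 1 - v n)" and "P' = (\<Prod>n<N. 1 - v' n)"
    and "Q = (\<Prod>n<N. 1 - w n)" and "S = (\<Sum>n<N. v n)" and "S' = (\<Sum>n<N. v' n)"
    and "W = (\<Sum>n<N. w n)"
  have P: "0 < P" unfolding P_def using assms(2,3)
    by (intro prod_pos) (metis diff_gt_0_iff_gt order.strict_trans1)
  have P': "0 < P'" unfolding P'_def using assms(3) by (intro prod_pos) auto
  have Q: "0 < Q" unfolding Q_def using assms(4) by (intro prod_pos) auto
  have "P * (1 - S') \<le> P' * (1 - S)"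
    using prod_sum_compare[of v v' N, OF assms(1,2,3)] by (simp add: P_def P'_def S_def S'_def)
  hence "Q * (P * (1 - S')) \<le> Q * (P' * (1 - S))" using Q by (intro mult_left_mono) auto
  moreover have "P' * (Q * (1 - S)) \<le> P' * (P * (1 - W))"
    using assms(5) P' by (intro mult_left_mono) (auto simp: P_def Q_def S_def W_def)
  ultimately have "P * (Q * (1 - S')) \<le> P * (P' * (1 - W))" by (simp add: mult_ac)
  hence "Q * (1 - S') \<le> P' * (1 - W)" using P by simp
  thus ?thesis by (simp add: P'_def Q_def S'_def W_def)
qed

subsection \<open>Periodized Gaussians\<close>

text \<open>Pairing \<open>n\<close> with \<open>- n - 1\<close> meets every integer exactly once,
  without a separate term at 0, and matches the reflection of \<open>u\<close> to
  \<open>1 - u\<close>.\<close>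

lemma has_sum_int_imp_sums:
  fixes g :: "int \<Rightarrow> real"
  assumes "(g has_sum S) UNIV"
  shows "(\<lambda>n. g (int n) + g (- int n - 1)) sums S"
proof -
  have sm: "g summable_on A" for A
    using assms summable_on_subset_banach has_sum_imp_summable by (metis subset_UNIV)
  have i1: "inj (\<lambda>n::nat. int n)" by simp
  have i2: "inj (\<lambda>n::nat. - int n - 1)" by (simp add: inj_def)
  have U: "(UNIV :: int set) = range int \<union> range (\<lambda>n. - int n - 1)"
  proof (intro set_eqI iffI UNIV_I)
    fix k :: int
    show "k \<in> range int \<union> range (\<lambda>n. - int n - 1)"
    proof (cases "0 \<le> k")
      case True thus ?thesis by (metis UnI1 nat_0_le rangeI)
    next
      case False
      hence "k = - int (nat (- k - 1)) - 1" by simp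
      thus ?thesis by blast
    qed
  qed
  obtain S1 where S1: "(g has_sum S1) (range int)" using sm by (meson summable_on_def)
  obtain S2 where S2: "(g has_sum S2) (range (\<lambda>n. - int n - 1))" using sm by (meson summable_on_def)
  have "((g \<circ> int) has_sum S1) UNIV" using S1 by (simp add: has_sum_reindex i1)
  hence 1: "(\<lambda>n. g (int n)) sums S1" using has_sum_imp_sums by (fastforce simp: o_def)
  have "((g \<circ> (\<lambda>n. - int n - 1)) has_sum S2) UNIV" using S2 by (simp add: has_sum_reindex i2)
  hence 2: "(\<lambda>n. g (- int n - 1)) sums S2" using has_sum_imp_sums by (fastforce simp: o_def)
  have "range int \<inter> range (\<lambda>n. - int n - 1) = {}" by force
  hence "(g has_sum (S1 + S2)) UNIV" unfolding U by (intro has_sum_Un_disjoint S1 S2)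
  hence "S = S1 + S2" using assms has_sum_unique by blast
  thus ?thesis using sums_add[OF 1 2] by simp
qed

lemma summable_on_int_exp_neg_abs: "(\<lambda>k::int. exp (- \<bar>of_int k\<bar> :: real)) summable_on UNIV"
proof -
  have S: "(\<lambda>n::nat. exp (- real n)) summable_on UNIV"
  proof -
    have "summable (\<lambda>n. exp (-1 :: real) ^ n)" by (intro summable_geometric) simp
    hence "summable (\<lambda>n. norm (exp (- real n)))" by (simp flip: exp_of_nat_mult)
    thus ?thesis by (rule norm_summable_imp_summable_on)
  qed
  have a: "(\<lambda>k::int. exp (- \<bar>of_int k\<bar> :: real)) summable_on (range int)"
    by (subst summable_on_reindex) (use S in \<open>auto simp: o_def\<close>)
  have b: "(\<lambda>k::int. exp (- \<bar>of_int k\<bar> :: real)) summable_on (range (\<lambda>n. - int n))"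
    by (subst summable_on_reindex) (use S in \<open>auto simp: o_def inj_def\<close>)
  have "(UNIV :: int set) = range int \<union> range (\<lambda>n. - int n)"
    by (metis (no_types, lifting) UNIV_eq_I UnCI int_cases2 rangeI)
  thus ?thesis using summable_on_union[OF a b] by simp
qed

definition theta :: "real \<Rightarrow> real \<Rightarrow> real"
  where "theta a u = (\<Sum>\<^sub>\<infinity>k\<in>UNIV. exp (- a * (u + of_int k)\<^sup>2))"

lemma gaussian_le_exp_neg_abs:
  fixes a u k :: real assumes "0 < a"
  shows "exp (- a * (u + k)\<^sup>2) \<le> exp (1 / (4 * a) + \<bar>u\<bar>) * exp (- \<bar>k\<bar>)"
proof -
  \<comment> \<open>Completing the square makes the quadratic exponent dominate a linear one, which
    gives a geometric majorant.\<close>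
  have "0 \<le> (2 * a * \<bar>u + k\<bar> - 1)\<^sup>2 / (4 * a)" using assms by simp
  also have "\<dots> = a * (u + k)\<^sup>2 - \<bar>u + k\<bar> + 1 / (4 * a)"
    using assms by (simp add: power2_diff power_mult_distrib field_simps power2_eq_square)
  finally have "- a * (u + k)\<^sup>2 \<le> 1 / (4 * a) + \<bar>u\<bar> - \<bar>k\<bar>" by linarith
  thus ?thesis by (simp flip: exp_add)
qed

lemma theta_has_sum:
  assumes "0 < a"
  shows "((\<lambda>k::int. exp (- a * (u + of_int k)\<^sup>2)) has_sum theta a u) UNIV"
proof -
  have "(\<lambda>k::int. exp (1 / (4 * a) + \<bar>u\<bar>) * exp (- \<bar>of_int k\<bar> :: real)) summable_on UNIV"
    by (intro summable_on_cmult_right summable_on_int_exp_neg_abs)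
  hence "(\<lambda>k::int. exp (- a * (u + of_int k)\<^sup>2)) summable_on UNIV"
    by (rule summable_on_comparison_test) (use gaussian_le_exp_neg_abs[OF assms] in auto)
  thus ?thesis unfolding theta_def by (rule has_sum_infsum)
qed

lemma theta_sums:
  assumes "0 < a"
  shows "(\<lambda>n. exp (- a * (real n + u)\<^sup>2) + exp (- a * (real n + 1 - u)\<^sup>2)) sums theta a u"
proof -
  have "(u + real_of_int (- int n - 1))\<^sup>2 = (real n + 1 - u)\<^sup>2" for n
    by (simp add: power2_eq_square algebra_simps)
  thus ?thesis using has_sum_int_imp_sums[OF theta_has_sum[OF assms, of u]]
    by (simp add: add.commute)
qed

lemma theta_minus: "theta a (- u) = theta a u"
proof -
  have "theta a (- u) = (\<Sum>\<^sub>\<infinity>k\<in>UNIV. exp (- a * (- u + of_int (- k))\<^sup>2))" unfolding theta_def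
    by (rule infsum_reindex_bij_witness[of _ uminus uminus]) auto
  also have "\<dots> = theta a u" unfolding theta_def by (intro infsum_cong) (simp add: power2_eq_square algebra_simps)
  finally show ?thesis .
qed

lemma theta_add_int: "theta a (u + of_int k) = theta a u"
  unfolding theta_def
  by (rule infsum_reindex_bij_witness[of _ "\<lambda>j. j - k" "\<lambda>j. j + k"]) (auto simp: algebra_simps)

lemma theta_pos:
  assumes "0 < a" shows "0 < theta a u"
proof -
  have "0 < (\<Sum>n. exp (- a * (real n + u)\<^sup>2) + exp (- a * (real n + 1 - u)\<^sup>2))"
    using theta_sums[OF assms, of u] by (intro suminf_pos) (auto simp: sums_iff add_pos_pos)
  thus ?thesis using theta_sums[OF assms, of u] by (simp add: sums_iff)
qed

lemma periodic_gaussian_rect_lattice: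
  fixes x :: "real ^ 2"
  assumes "0 < a" "0 < \<beta>"
  shows "periodic_gaussian a (rect_lattice \<beta>) x =
    theta a (x $ 1) * theta (4 * a * \<beta>\<^sup>2) (x $ 2 / (2 * \<beta>))"
    and "(\<lambda>v. exp (- a * (norm (x + v))\<^sup>2)) summable_on rect_lattice \<beta>"
proof -
  define h :: "int \<times> int \<Rightarrow> real ^ 2" where "h = (\<lambda>(j, k). vector [of_int j, 2 * \<beta> * of_int k])"
  \<comment> \<open>Rescaling the second period \<open>2 * \<beta>\<close> to 1 multiplies the
    exponent by its square.\<close>
  define b where "b = 4 * a * \<beta>\<^sup>2"
  have b: "0 < b" using assms by (simp add: b_def)
  have R: "rect_lattice \<beta> = range h" by (auto simp: rect_lattice_def h_def)
  have inj: "inj h"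
  proof (rule injI)
    fix p q assume "h p = h q"
    hence "h p $ 1 = h q $ 1" "h p $ 2 = h q $ 2" by simp_all
    thus "p = q" using assms by (cases p; cases q) (simp add: h_def)
  qed
  define f where "f j = exp (- a * (x $ 1 + of_int j)\<^sup>2)" for j :: int
  define g where "g k = exp (- b * (x $ 2 / (2 * \<beta>) + of_int k)\<^sup>2)" for k :: int
  have tm: "exp (- a * (norm (x + h (j, k)))\<^sup>2) = f j * g k" for j k
  proof -
    have "(norm (x + h (j, k)))\<^sup>2 = (x $ 1 + of_int j)\<^sup>2 + (x $ 2 + 2 * \<beta> * of_int k)\<^sup>2"
      by (simp add: norm_vec_def L2_set_def sum_2 h_def)
    moreover have "a * (x $ 2 + 2 * \<beta> * of_int k)\<^sup>2 = b * (x $ 2 / (2 * \<beta>) + of_int k)\<^sup>2"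
      using assms by (simp add: b_def power2_eq_square field_simps)
    ultimately show ?thesis by (simp add: f_def g_def distrib_left exp_add[symmetric])
  qed
  have f: "(f has_sum theta a (x $ 1)) UNIV" unfolding f_def by (rule theta_has_sum[OF assms(1)])
  have g: "(g has_sum theta b (x $ 2 / (2 * \<beta>))) UNIV" unfolding g_def by (rule theta_has_sum[OF b])
  have sm: "(\<lambda>(j, k). f j * g k) summable_on UNIV \<times> UNIV"
  proof (rule summable_on_SigmaI)
    show "((\<lambda>k. case (j, k) of (j, k) \<Rightarrow> f j * g k) has_sum f j * theta b (x $ 2 / (2 * \<beta>))) UNIV" for j
      using has_sum_cmult_right[OF g] by simp
    show "(\<lambda>j. f j * theta b (x $ 2 / (2 * \<beta>))) summable_on UNIV"
      using f by (intro summable_on_cmult_left) (simp add: has_sum_imp_summable)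
  qed (simp add: f_def g_def)
  have eq: "(\<lambda>v. exp (- a * (norm (x + v))\<^sup>2)) \<circ> h = (\<lambda>(j, k). f j * g k)"
    using tm by (auto simp: o_def fun_eq_iff)
  show "(\<lambda>v. exp (- a * (norm (x + v))\<^sup>2)) summable_on rect_lattice \<beta>"
    unfolding R by (subst summable_on_reindex[OF inj], subst eq) (use sm in simp)
  have "periodic_gaussian a (rect_lattice \<beta>) x = infsum (\<lambda>(j, k). f j * g k) (UNIV \<times> UNIV)"
    unfolding periodic_gaussian_def R by (subst infsum_reindex[OF inj], subst eq) simp
  also have "\<dots> = (\<Sum>\<^sub>\<infinity>j. \<Sum>\<^sub>\<infinity>k. f j * g k)"
    using infsum_Sigma'_banach[OF sm] by simp
  also have "\<dots> = (\<Sum>\<^sub>\<infinity>j. f j * theta b (x $ 2 / (2 * \<beta>)))"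
    using g by (intro infsum_cong) (simp add: infsum_cmult_right' infsumI)
  also have "\<dots> = theta a (x $ 1) * theta b (x $ 2 / (2 * \<beta>))"
    using f by (simp add: infsum_cmult_left' infsumI)
  finally show "periodic_gaussian a (rect_lattice \<beta>) x =
    theta a (x $ 1) * theta (4 * a * \<beta>\<^sup>2) (x $ 2 / (2 * \<beta>))" by (simp add: b_def)
qed

subsection \<open>Poisson summation\<close>

text \<open>Real part of the characteristic function of the standard normal distribution, rescaled
  by \<open>sqrt (2 * a)\<close>.\<close>

lemma gaussian_cos_integral:
  fixes a w :: real
  assumes a: "0 < a"
  shows "has_bochner_integral lborel (\<lambda>x. exp (- a * x\<^sup>2) * cos (w * x))
    (sqrt (pi / a) * exp (- w\<^sup>2 / (4 * a)))"
proof -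
  define c where "c = sqrt (2 * a)"
  define t where "t = w / c"
  have c: "0 < c" "c\<^sup>2 = 2 * a" using a by (auto simp: c_def)
  interpret N: real_distribution std_normal_distribution by (rule real_dist_normal_dist)
  have "integrable std_normal_distribution (\<lambda>x. iexp (t * x))"
    using N.integrable_iexp[of "\<lambda>x. complex_of_real (t * x)"] by simp
  hence "has_bochner_integral std_normal_distribution (\<lambda>x. iexp (t * x)) (exp (- (t\<^sup>2) / 2))"
    using char_std_normal_distribution by (auto simp: has_bochner_integral_iff char_def fun_eq_iff)
  hence "has_bochner_integral std_normal_distribution (\<lambda>x. Re (iexp (t * x))) (Re (complex_of_real (exp (- (t\<^sup>2) / 2))))"
    by (rule has_bochner_integral_Re)
  hence "has_bochner_integral std_normal_distribution (\<lambda>x. cos (t * x)) (exp (- (t\<^sup>2) / 2))"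
    by (simp add: Re_exp)
  hence "has_bochner_integral lborel (\<lambda>x. std_normal_density x *\<^sub>R cos (t * x)) (exp (- (t\<^sup>2) / 2))"
    by (auto simp: has_bochner_integral_iff integrable_density integral_density)
  hence "has_bochner_integral lborel (\<lambda>x. std_normal_density (0 + c * x) *\<^sub>R cos (t * (0 + c * x))) (exp (- (t\<^sup>2) / 2) /\<^sub>R \<bar>c\<bar>)"
    using c by (subst (asm) lborel_has_bochner_integral_real_affine_iff[where c = c and t = 0]) auto
  hence "has_bochner_integral lborel (\<lambda>x. sqrt (2 * pi) * (std_normal_density (0 + c * x) *\<^sub>R cos (t * (0 + c * x))))
      (sqrt (2 * pi) * (exp (- (t\<^sup>2) / 2) /\<^sub>R \<bar>c\<bar>))"
    by (intro has_bochner_integral_mult_right)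
  moreover have "sqrt (2 * pi) * (std_normal_density (0 + c * x) *\<^sub>R cos (t * (0 + c * x))) = exp (- a * x\<^sup>2) * cos (w * x)" for x
    using c by (simp add: std_normal_density_def power_mult_distrib t_def)
  moreover have "sqrt (2 * pi) * (exp (- (t\<^sup>2) / 2) /\<^sub>R \<bar>c\<bar>) = sqrt (pi / a) * exp (- w\<^sup>2 / (4 * a))"
  proof -
    have "t\<^sup>2 / 2 = w\<^sup>2 / (4 * a)" using c by (simp add: t_def power_divide)
    moreover have "sqrt (2 * pi) / c = sqrt (pi / a)" by (simp add: c_def real_sqrt_divide[symmetric])
    ultimately show ?thesis using c by (simp add: field_simps)
  qed
  ultimately show ?thesis by simp
qed

section \<open>Uniqueness of cosine coefficients\<close>

lemma cos_integral_0_1: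
  "((\<lambda>u. cos (2 * pi * of_int k * u)) has_integral (if k = 0 then 1 else 0)) {0..1}"
proof (cases "k = 0")
  case True
  thus ?thesis using has_integral_const_real[of "1::real" 0 1] by simp
next
  case False
  have "((\<lambda>u. cos (2 * pi * of_int k * u)) has_integral
     (sin (2 * pi * of_int k * 1) / (2 * pi * of_int k) - sin (2 * pi * of_int k * 0) / (2 * pi * of_int k))) {0..1}"
  proof (rule fundamental_theorem_of_calculus)
    fix u :: real
    show "((\<lambda>u. sin (2 * pi * of_int k * u) / (2 * pi * of_int k)) has_vector_derivative cos (2 * pi * of_int k * u)) (at u within {0..1})"
      unfolding has_real_derivative_iff_has_vector_derivative[symmetric]
      using False by (auto intro!: derivative_eq_intros)
  qed simp
  thus ?thesis using False sin_int_2pin[of k] by (simp add: mult_ac)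
qed

lemma cos_cos_integral_0_1:
  "((\<lambda>u. cos (2 * pi * real m * u) * cos (2 * pi * real n * u)) has_integral
     (if m = n then if n = 0 then 1 else 1 / 2 else 0)) {0..1}"
proof -
  have eq: "cos (2 * pi * real m * u) * cos (2 * pi * real n * u) =
    (cos (2 * pi * of_int (int m - int n) * u) + cos (2 * pi * of_int (int m + int n) * u)) / 2" for u
    by (simp add: cos_times_cos algebra_simps)
  have "((\<lambda>u. (cos (2 * pi * of_int (int m - int n) * u) + cos (2 * pi * of_int (int m + int n) * u)) / 2)
    has_integral ((if int m - int n = 0 then 1 else 0) + (if int m + int n = 0 then 1 else 0)) / 2) {0..1}"
    by (intro has_integral_divide has_integral_add cos_integral_0_1)
  moreover have "((if int m - int n = 0 then 1 else 0) + (if int m + int n = 0 then 1 else 0)) / 2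
    = (if m = n then if n = 0 then 1 else 1 / 2 else (0::real))" by auto
  ultimately show ?thesis unfolding eq by simp
qed

text \<open>The symmetry makes \<open>h\<close> a continuous function of
  \<open>cos (2 * pi * u)\<close>. Vanishing coefficients make it orthogonal to all polynomials in
  this cosine, hence, by Stone-Weierstrass, to itself.\<close>

lemma even_periodic_eq_0:
  fixes h :: "real \<Rightarrow> real"
  assumes cont: "continuous_on {0..1} h"
    and sym: "\<And>u. u \<in> {0..1} \<Longrightarrow> h (1 - u) = h u"
    and coeff: "\<And>j::nat. ((\<lambda>u. h u * cos (2 * pi * real j * u)) has_integral 0) {0..1}"
    and u: "u \<in> {0..1}"
  shows "h u = 0"
proof -
  define C where "C u = cos (2 * pi * u)" for u :: real
  \<comment> \<open>The free index \<open>j\<close> carries the induction: one more cosine factor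
    splits mode \<open>j\<close> into \<open>j + 1\<close> and \<open>j - 1\<close>. For
    \<open>j = 0\<close> the factor itself is mode 1.\<close>
  have pw: "((\<lambda>u. h u * C u ^ k * cos (2 * pi * real j * u)) has_integral 0) {0..1}" for j k :: nat
  proof (induction k arbitrary: j)
    case 0 show ?case using coeff by simp
  next
    case (Suc k)
    show ?case
    proof (cases j)
      case 0
      thus ?thesis using Suc[of 1] by (simp add: C_def mult_ac)
    next
      case (Suc i)
      have "((\<lambda>u. (h u * C u ^ k * cos (2 * pi * real (j + 1) * u) + h u * C u ^ k * cos (2 * pi * real i * u)) / 2)
        has_integral (0 + 0) / 2) {0..1}"
        by (intro has_integral_divide has_integral_add Suc.IH)
      moreover have "(h u * C u ^ k * cos (2 * pi * real (j + 1) * u) + h u * C u ^ k * cos (2 * pi * real i * u)) / 2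
        = h u * C u ^ Suc k * cos (2 * pi * real j * u)" for u
      proof -
        define x y where "x = 2 * pi * real j * u" and "y = 2 * pi * u"
        have "cos (x + y) + cos (x - y) = 2 * (cos y * cos x)" by (simp add: cos_add cos_diff)
        moreover have "x + y = 2 * pi * real (j + 1) * u" "x - y = 2 * pi * real i * u"
          by (simp_all add: x_def y_def Suc algebra_simps)
        ultimately have e: "cos (2 * pi * real (j + 1) * u) + cos (2 * pi * real i * u) = 2 * (C u * cos x)"
          by (simp add: C_def y_def)
        have "(h u * C u ^ k * cos (2 * pi * real (j + 1) * u) + h u * C u ^ k * cos (2 * pi * real i * u)) / 2
          = h u * C u ^ k * (cos (2 * pi * real (j + 1) * u) + cos (2 * pi * real i * u)) / 2"
          by (simp only: distrib_left)
        thus ?thesis unfolding e by (simp add: x_def)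
      qed
      ultimately show ?thesis by simp
    qed
  qed
  have poly: "((\<lambda>u. h u * p (C u)) has_integral 0) {0..1}" if p: "real_polynomial_function p" for p
  proof -
    obtain c n where c: "p = (\<lambda>x. \<Sum>i\<le>n. c i * x ^ i)"
      using p unfolding real_polynomial_function_iff_sum by blast
    have "((\<lambda>u. \<Sum>i\<le>n. c i * (h u * C u ^ i * cos (2 * pi * real 0 * u))) has_integral (\<Sum>i\<le>n. c i * 0)) {0..1}"
      by (intro has_integral_sum has_integral_mult_right pw) auto
    thus ?thesis by (simp add: c sum_distrib_left mult_ac)
  qed
  \<comment> \<open>The arccosine recovers \<open>u\<close> only on the left half of the interval;
    \<open>sym\<close> covers the right half.\<close>
  define H where "H c = h (arccos c / (2 * pi))" for c
  have Hcont: "continuous_on {-1..1} H" unfolding H_def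
    by (rule continuous_on_compose2[OF cont])
       (auto intro!: continuous_intros simp: divide_simps arccos_lbound, smt (verit) arccos_ubound pi_gt_zero)
  have HC: "H (C u) = h u" if "u \<in> {0..1}" for u
  proof (cases "u \<le> 1 / 2")
    case True
    hence "arccos (C u) = 2 * pi * u" using that unfolding C_def by (intro arccos_cos) auto
    thus ?thesis by (simp add: H_def)
  next
    case False
    have "C u = cos (2 * pi * (1 - u))" by (simp add: C_def algebra_simps cos_diff)
    also have "arccos \<dots> = 2 * pi * (1 - u)" using that False by (intro arccos_cos) auto
    finally have "arccos (C u) = 2 * pi * (1 - u)" .
    thus ?thesis using sym[OF that] by (simp add: H_def)
  qed
  obtain M where M: "\<And>u. u \<in> {0..1} \<Longrightarrow> \<bar>h u\<bar> \<le> M"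
    using compact_continuous_image[OF cont compact_Icc] compact_imp_bounded
    by (metis bounded_iff image_eqI real_norm_def)
  have M0: "0 \<le> M" using M[OF u] by linarith
  have int2: "(\<lambda>u. (h u)\<^sup>2) integrable_on {0..1}"
    by (intro integrable_continuous_interval continuous_intros cont)
  have "integral {0..1} (\<lambda>u. (h u)\<^sup>2) \<le> e" if e: "0 < e" for e
  proof -
    have "0 < e / (M + 1)" using e M0 by simp
    then obtain p where p: "real_polynomial_function p" "\<And>x. x \<in> {-1..1} \<Longrightarrow> \<bar>H x - p x\<bar> < e / (M + 1)"
      using Stone_Weierstrass_real_polynomial_function[OF compact_Icc Hcont] by metis
    \<comment> \<open>Subtracting \<open>h u * p (C u)\<close> leaves the integral unchanged by
      orthogonality and makes the integrand small.\<close>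
    have i1: "((\<lambda>u. (h u)\<^sup>2 - h u * p (C u)) has_integral (integral {0..1} (\<lambda>u. (h u)\<^sup>2) - 0)) {0..1}"
      by (intro has_integral_diff poly p integrable_integral int2)
    have i2: "((\<lambda>u. e) has_integral e) {0..1::real}" using has_integral_const_real[of e 0 1] by simp
    have "integral {0..1} (\<lambda>u. (h u)\<^sup>2) - 0 \<le> e"
    proof (rule has_integral_le[OF i1 i2])
      fix u :: real assume u: "u \<in> {0..1}"
      have "(h u)\<^sup>2 - h u * p (C u) = h u * (H (C u) - p (C u))"
        using HC[OF u] by (simp add: power2_eq_square algebra_simps)
      also have "\<dots> \<le> \<bar>h u\<bar> * \<bar>H (C u) - p (C u)\<bar>" by (metis abs_ge_self abs_mult)
      also have "\<dots> \<le> M * (e / (M + 1))"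
        using M[OF u] p(2)[of "C u"] by (intro mult_mono) (auto simp: C_def less_imp_le M0)
      also have "\<dots> \<le> e" using M0 e by (simp add: field_simps)
      finally show "(h u)\<^sup>2 - h u * p (C u) \<le> e" .
    qed
    thus ?thesis by simp
  qed
  hence "integral {0..1} (\<lambda>u. (h u)\<^sup>2) \<le> 0" by (meson dense not_le)
  moreover have "0 \<le> integral {0..1} (\<lambda>u. (h u)\<^sup>2)" using int2 by (rule integral_nonneg) auto
  ultimately have "((\<lambda>u. (h u)\<^sup>2) has_integral 0) (cbox 0 1)"
    using integrable_integral[OF int2] by simp
  hence "(h u)\<^sup>2 = 0"
    by (rule has_integral_0_cbox_imp_0[rotated 2]) (use cont u in \<open>auto intro!: continuous_intros\<close>)
  thus ?thesis by simp
qed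

section \<open>Fourier expansion of the periodized Gaussian\<close>

text \<open>Jacobi's theta series, the sum of \<open>q ^ k\<^sup>2 * cos (2 * pi * k * u)\<close>
  over all integers, in the pairing of \<open>n\<close> with \<open>- n - 1\<close>. The constant
  term thus occurs once and every other mode twice.\<close>

definition cos_series :: "real \<Rightarrow> real \<Rightarrow> real" where
  "cos_series q u = (\<Sum>n. q ^ (n\<^sup>2) * cos (2 * pi * real n * u) +
                         q ^ ((Suc n)\<^sup>2) * cos (2 * pi * real (Suc n) * u))"

lemma cos_series_term_le:
  assumes "0 < q" "q < 1"
  shows "norm (q ^ (n\<^sup>2) * cos x + q ^ ((Suc n)\<^sup>2) * cos y) \<le> 2 * q ^ n"
proof -
  have "norm (q ^ (n\<^sup>2) * cos x) \<le> q ^ n * 1" unfolding norm_mult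
    using assms power_decreasing[of n "n\<^sup>2" q] by (intro mult_mono) (auto simp: power2_eq_square)
  moreover have "norm (q ^ ((Suc n)\<^sup>2) * cos y) \<le> q ^ n * 1" unfolding norm_mult
    using assms power_decreasing[of n "(Suc n)\<^sup>2" q] by (intro mult_mono) (auto simp: power2_eq_square)
  ultimately show ?thesis
    by (smt (verit, best) norm_triangle_ineq)
qed

lemma cos_series_uniform_limit:
  assumes "0 < q" "q < 1"
  shows "uniform_limit S (\<lambda>N u. \<Sum>n<N. q ^ (n\<^sup>2) * cos (2 * pi * real n * u) +
                         q ^ ((Suc n)\<^sup>2) * cos (2 * pi * real (Suc n) * u)) (cos_series q) sequentially"
  unfolding cos_series_def
  by (rule Weierstrass_m_test[where M = "\<lambda>n. 2 * q ^ n"])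
     (use assms cos_series_term_le in \<open>auto intro!: summable_mult summable_geometric\<close>)

lemma theta_uniform_limit:
  assumes "0 < a"
  shows "uniform_limit {0..1} (\<lambda>N u. \<Sum>n<N. exp (- a * (real n + u)\<^sup>2) + exp (- a * (real n + 1 - u)\<^sup>2))
    (theta a) sequentially"
proof -
  have "uniform_limit {0..1} (\<lambda>N u. \<Sum>n<N. exp (- a * (real n + u)\<^sup>2) + exp (- a * (real n + 1 - u)\<^sup>2))
    (\<lambda>u. \<Sum>n. exp (- a * (real n + u)\<^sup>2) + exp (- a * (real n + 1 - u)\<^sup>2)) sequentially"
  proof (rule Weierstrass_m_test[where M = "\<lambda>n. 2 * exp (1 / (4 * a) + 1) * exp (-1) ^ n"])
    fix n :: nat and u :: real assume u: "u \<in> {0..1}"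
    have E: "exp (1 / (4 * a) + \<bar>v\<bar>) * exp (- \<bar>real n\<bar>) \<le> exp (1 / (4 * a) + 1) * exp (-1) ^ n" if "v \<in> {0..1}" for v
      using that by (intro mult_mono) (auto simp flip: exp_of_nat_mult)
    have "exp (- a * (real n + u)\<^sup>2) \<le> exp (1 / (4 * a) + 1) * exp (-1) ^ n"
      using gaussian_le_exp_neg_abs[OF assms, of u "real n"] E[OF u] by (simp add: add.commute)
    moreover have "exp (- a * (real n + 1 - u)\<^sup>2) \<le> exp (1 / (4 * a) + 1) * exp (-1) ^ n"
      using gaussian_le_exp_neg_abs[OF assms, of "1 - u" "real n"] E[of "1 - u"] u by (simp add: algebra_simps)
    ultimately show "norm (exp (- a * (real n + u)\<^sup>2) + exp (- a * (real n + 1 - u)\<^sup>2)) \<le> 2 * exp (1 / (4 * a) + 1) * exp (-1) ^ n"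
      by simp
  next
    show "summable (\<lambda>n. 2 * exp (1 / (4 * a) + 1) * exp (-1 :: real) ^ n)"
      by (intro summable_mult summable_geometric) simp
  qed
  moreover have "(\<lambda>u. \<Sum>n. exp (- a * (real n + u)\<^sup>2) + exp (- a * (real n + 1 - u)\<^sup>2)) = theta a"
    using sums_unique[OF theta_sums[OF assms]] by (intro ext) simp
  ultimately show ?thesis by simp
qed

text \<open>Unfolding: since the cosine has period 1, the first \<open>N\<close> pairs integrate
  over the unit interval to the integral of one Gaussian times the cosine over
  \<open>{- real N..real N}\<close>. The limit is the Fourier integral over the line.\<close>

lemma theta_fourier_coeff:
  fixes j :: nat
  assumes a: "0 < a"
  shows "((\<lambda>u. theta a u * cos (2 * pi * real j * u)) has_integral
           sqrt (pi / a) * exp (- pi\<^sup>2 / a) ^ (j\<^sup>2)) {0..1}"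
proof -
  define \<phi> where "\<phi> x = exp (- a * x\<^sup>2) * cos (2 * pi * real j * x)" for x
  define g where "g n u = exp (- a * (real n + u)\<^sup>2) + exp (- a * (real n + 1 - u)\<^sup>2)" for n :: nat and u
  have \<phi>cont: "continuous_on S \<phi>" for S unfolding \<phi>_def by (intro continuous_intros)
  have shift: "g n u * cos (2 * pi * real j * u) = \<phi> (real n + u) + \<phi> (- real n - 1 + u)" for n u
  proof -
    have "cos (2 * pi * real j * (of_int k + u)) = cos (2 * pi * real j * u)" for k :: int
    proof -
      have "2 * pi * real j * (of_int k + u) = 2 * pi * real j * u + 2 * pi * of_int (int j * k)"
        by (simp add: algebra_simps)
      thus ?thesis by (simp only: cos_add sin_int_2pin cos_int_2pin)
    qed
    from this[of "int n"] this[of "- int n - 1"] 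
    have "cos (2 * pi * real j * (real n + u)) = cos (2 * pi * real j * u)"
      "cos (2 * pi * real j * (- real n - 1 + u)) = cos (2 * pi * real j * u)" by simp_all
    moreover have "(- real n - 1 + u)\<^sup>2 = (real n + 1 - u)\<^sup>2" by (simp add: power2_eq_square algebra_simps)
    ultimately show ?thesis by (simp add: \<phi>_def g_def algebra_simps)
  qed
  have part: "((\<lambda>u. (\<Sum>n<N. g n u) * cos (2 * pi * real j * u)) has_integral integral {- real N..real N} \<phi>) {0..1}" for N
  proof (induction N)
    case 0
    show ?case by simp
  next
    case (Suc N)
    have I: "(\<phi> has_integral integral {c..d} \<phi>) {c..d}" for c d
      by (intro integrable_integral integrable_continuous_interval \<phi>cont)
    have 1: "((\<lambda>u. \<phi> (real N + u)) has_integral integral {real N..real (Suc N)} \<phi>) {0..1}"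
      using has_integral_shift_Icc_real[of \<phi> "real N" _ 0 1] I by (simp add: o_def add.commute)
    have 2: "((\<lambda>u. \<phi> (- real N - 1 + u)) has_integral integral {- real (Suc N)..- real N} \<phi>) {0..1}"
      using has_integral_shift_Icc_real[of \<phi> "- real N - 1" "integral {- real (Suc N)..- real N} \<phi>" 0 1]
        I[of "- real (Suc N)" "- real N"] by (simp add: o_def minus_diff_commute[of _ "real N"] diff_diff_eq add.commute[of 1])
    have "(\<phi> has_integral integral {- real (Suc N)..- real N} \<phi> + integral {- real N..real N} \<phi>) {- real (Suc N)..real N}"
      by (rule has_integral_combine[OF _ _ I I]) auto
    hence "(\<phi> has_integral (integral {- real (Suc N)..- real N} \<phi> + integral {- real N..real N} \<phi>)
        + integral {real N..real (Suc N)} \<phi>) {- real (Suc N)..real (Suc N)}"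
      by (rule has_integral_combine[OF _ _ _ I, rotated 2]) auto
    hence "integral {- real (Suc N)..real (Suc N)} \<phi> = integral {- real N..real N} \<phi> +
        (integral {real N..real (Suc N)} \<phi> + integral {- real (Suc N)..- real N} \<phi>)"
      by (simp add: integral_unique)
    moreover have "((\<lambda>u. (\<Sum>n<N. g n u) * cos (2 * pi * real j * u) + (\<phi> (real N + u) + \<phi> (- real N - 1 + u)))
       has_integral integral {- real N..real N} \<phi> +
        (integral {real N..real (Suc N)} \<phi> + integral {- real (Suc N)..- real N} \<phi>)) {0..1}"
      by (intro has_integral_add Suc 1 2)
    ultimately show ?case by (simp add: distrib_right shift)
  qed
  define I where "I = sqrt (pi / a) * exp (- pi\<^sup>2 / a) ^ (j\<^sup>2)"
  have Ival: "has_bochner_integral lborel \<phi> I"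
  proof -
    have "- (2 * pi * real j)\<^sup>2 / (4 * a) = real (j\<^sup>2) * (- pi\<^sup>2 / a)"
      by (simp add: power_mult_distrib)
    hence "exp (- (2 * pi * real j)\<^sup>2 / (4 * a)) = exp (- pi\<^sup>2 / a) ^ (j\<^sup>2)" by (simp only: exp_of_nat_mult)
    thus ?thesis using gaussian_cos_integral[OF a, of "2 * pi * real j"] by (simp add: \<phi>_def[abs_def] I_def)
  qed
  have lim1: "(\<lambda>N. integral {- real N..real N} \<phi>) \<longlonglongrightarrow> I"
  proof -
    have "(\<lambda>N. LINT x|lborel. indicator {- real N..real N} x *\<^sub>R \<phi> x) \<longlonglongrightarrow> (LINT x|lborel. \<phi> x)"
    proof (rule integral_dominated_convergence[where w = "\<lambda>x. norm (\<phi> x)"])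
      show "AE x in lborel. (\<lambda>N. indicator {- real N..real N} x *\<^sub>R \<phi> x) \<longlonglongrightarrow> \<phi> x"
      proof (intro AE_I2 tendsto_eventually)
        fix x :: real
        have "\<forall>\<^sub>F N in sequentially. \<bar>x\<bar> \<le> real N" by real_asymp
        thus "\<forall>\<^sub>F N in sequentially. indicator {- real N..real N} x *\<^sub>R \<phi> x = \<phi> x"
          by eventually_elim (auto simp: indicator_def)
      qed
    qed (use Ival in \<open>auto simp: has_bochner_integral_iff indicator_def\<close>)
    moreover have "(LINT x|lborel. indicator {- real N..real N} x *\<^sub>R \<phi> x) = integral {- real N..real N} \<phi>" for N
    proof -
      have "set_integrable lborel {- real N..real N} \<phi>"
        by (intro borel_integrable_atLeastAtMost' \<phi>cont)
      from set_borel_integral_eq_integral(2)[OF this] show ?thesis by (simp add: set_lebesgue_integral_def)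
    qed
    ultimately show ?thesis using Ival by (simp add: has_bochner_integral_iff)
  qed
  have "uniform_limit {0..1} (\<lambda>N u. (\<Sum>n<N. g n u)) (theta a) sequentially"
    using theta_uniform_limit[OF a] by (simp add: g_def)
  moreover have "continuous_on {0..1} (\<lambda>u. \<Sum>n<N. g n u)" for N
    unfolding g_def by (intro continuous_intros)
  \<comment> \<open>Boundedness of the limit is what allows the uniform limit to be multiplied by
    the cosine.\<close>
  ultimately have bt: "bounded (theta a ` {0..1})"
    by (intro compact_imp_bounded compact_continuous_image uniform_limit_theorem[of _ "\<lambda>N u. (\<Sum>n<N. g n u)"]) auto
  have ul: "uniform_limit {0..1} (\<lambda>N u. (\<Sum>n<N. g n u) * cos (2 * pi * real j * u))
      (\<lambda>u. theta a u * cos (2 * pi * real j * u)) sequentially"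
    by (intro uniform_limit_intros bt \<open>uniform_limit {0..1} (\<lambda>N u. (\<Sum>n<N. g n u)) (theta a) sequentially\<close>)
       (auto intro!: boundedI[of _ 1])
  obtain I' J where IJ: "\<And>N. ((\<lambda>u. (\<Sum>n<N. g n u) * cos (2 * pi * real j * u)) has_integral I' N) {0..1}"
    "((\<lambda>u. theta a u * cos (2 * pi * real j * u)) has_integral J) {0..1}" "I' \<longlonglongrightarrow> J"
    by (rule uniform_limit_integral[OF ul]) (auto intro!: continuous_intros simp: g_def)
  have "I' N = integral {- real N..real N} \<phi>" for N using has_integral_unique[OF IJ(1) part] .
  hence "I' = (\<lambda>N. integral {- real N..real N} \<phi>)" by auto
  hence "J = I" using LIMSEQ_unique[OF IJ(3)] lim1 by simp
  thus ?thesis using IJ(2) by (simp add: I_def)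
qed

lemma cos_series_fourier_coeff:
  fixes j :: nat
  assumes q: "0 < q" "q < 1"
  shows "((\<lambda>u. cos_series q u * cos (2 * pi * real j * u)) has_integral q ^ (j\<^sup>2)) {0..1}"
proof -
  define g where "g n u = q ^ (n\<^sup>2) * cos (2 * pi * real n * u) +
     q ^ ((Suc n)\<^sup>2) * cos (2 * pi * real (Suc n) * u)" for n :: nat and u
  have part: "((\<lambda>u. (\<Sum>n<N. g n u) * cos (2 * pi * real j * u)) has_integral q ^ (j\<^sup>2)) {0..1}" if N: "j < N" for N
  proof -
    define e :: "nat \<Rightarrow> real" where "e m = (if m = j then if j = 0 then 1 else 1 / 2 else 0)" for m
    have "((\<lambda>u. \<Sum>n<N. q ^ (n\<^sup>2) * (cos (2 * pi * real n * u) * cos (2 * pi * real j * u)) +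
      q ^ ((Suc n)\<^sup>2) * (cos (2 * pi * real (Suc n) * u) * cos (2 * pi * real j * u))) has_integral
      (\<Sum>n<N. q ^ (n\<^sup>2) * e n + q ^ ((Suc n)\<^sup>2) * e (Suc n))) {0..1}"
      unfolding e_def by (intro has_integral_sum has_integral_add has_integral_mult_right cos_cos_integral_0_1) auto
    \<comment> \<open>For positive \<open>j\<close> the mode occurs in the pairs \<open>j\<close>
      and \<open>j - 1\<close>, each with weight one half; the mode 0 occurs once, with weight
      one.\<close>
    moreover have "(\<Sum>n<N. q ^ (n\<^sup>2) * e n + q ^ ((Suc n)\<^sup>2) * e (Suc n)) = q ^ (j\<^sup>2)"
    proof -
      have "(\<Sum>n<N. q ^ (n\<^sup>2) * e n) = (\<Sum>n\<in>{j}. q ^ (n\<^sup>2) * e n)"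
        using N by (intro sum.mono_neutral_right) (auto simp: e_def)
      moreover have "(\<Sum>n<N. q ^ ((Suc n)\<^sup>2) * e (Suc n)) = (\<Sum>n\<in>(if j = 0 then {} else {j - 1}). q ^ ((Suc n)\<^sup>2) * e (Suc n))"
        using N by (intro sum.mono_neutral_right) (auto simp: e_def split: if_splits)
      ultimately show ?thesis by (simp add: sum.distrib e_def)
    qed
    ultimately show ?thesis by (simp add: g_def sum_distrib_left algebra_simps)
  qed
  have u0: "uniform_limit {0..1} (\<lambda>N u. (\<Sum>n<N. g n u)) (cos_series q) sequentially"
    using cos_series_uniform_limit[OF q] by (simp add: g_def)
  moreover have "continuous_on {0..1} (\<lambda>u. \<Sum>n<N. g n u)" for N
    unfolding g_def by (intro continuous_intros)
  ultimately have bt: "bounded (cos_series q ` {0..1})"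
    by (intro compact_imp_bounded compact_continuous_image uniform_limit_theorem[of _ "\<lambda>N u. (\<Sum>n<N. g n u)"]) auto
  have ul: "uniform_limit {0..1} (\<lambda>N u. (\<Sum>n<N. g n u) * cos (2 * pi * real j * u))
      (\<lambda>u. cos_series q u * cos (2 * pi * real j * u)) sequentially"
    by (intro uniform_limit_intros bt u0) (auto intro!: boundedI[of _ 1])
  obtain I' J where IJ: "\<And>N. ((\<lambda>u. (\<Sum>n<N. g n u) * cos (2 * pi * real j * u)) has_integral I' N) {0..1}"
    "((\<lambda>u. cos_series q u * cos (2 * pi * real j * u)) has_integral J) {0..1}" "I' \<longlonglongrightarrow> J"
    by (rule uniform_limit_integral[OF ul]) (auto intro!: continuous_intros simp: g_def)
  have "I' N = q ^ (j\<^sup>2)" if "j < N" for N using has_integral_unique[OF IJ(1) part[OF that]] .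
  hence "\<forall>\<^sub>F N in sequentially. I' N = q ^ (j\<^sup>2)"
    by (intro eventually_mono[OF eventually_gt_at_top[of j]])
  hence "I' \<longlonglongrightarrow> q ^ (j\<^sup>2)" by (rule tendsto_eventually)
  hence "J = q ^ (j\<^sup>2)" using IJ(3) LIMSEQ_unique by blast
  thus ?thesis using IJ(2) by simp
qed

text \<open>Poisson summation, obtained by comparing cosine coefficients of two continuous functions
  symmetric about \<open>1 / 2\<close>.\<close>

lemma theta_eq_cos_series:
  assumes a: "0 < a" and u: "u \<in> {0..1}"
  shows "theta a u = sqrt (pi / a) * cos_series (exp (- pi\<^sup>2 / a)) u"
proof -
  define q where "q = exp (- pi\<^sup>2 / a)"
  have q: "0 < q" "q < 1" using a by (auto simp: q_def)
  define h where "h u = theta a u - sqrt (pi / a) * cos_series q u" for u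
  have "h u = 0"
  proof (rule even_periodic_eq_0[of h u])
    have "continuous_on {0..1} (theta a)"
      by (rule uniform_limit_theorem[OF always_eventually theta_uniform_limit[OF a] trivial_limit_sequentially]) (intro allI continuous_intros)
    moreover have "continuous_on {0..1} (cos_series q)"
      by (rule uniform_limit_theorem[OF always_eventually cos_series_uniform_limit[OF q] trivial_limit_sequentially]) (intro allI continuous_intros)
    ultimately show "continuous_on {0..1} h" unfolding h_def by (intro continuous_intros)
    have c: "cos (2 * pi * real n * (1 - u)) = cos (2 * pi * real n * u)" for n u
    proof -
      have "2 * pi * real n * (1 - u) = 2 * pi * of_int (int n) - 2 * pi * real n * u" by (simp add: algebra_simps)
      thus ?thesis by (simp only: cos_diff sin_int_2pin cos_int_2pin)
    qed
    show "h (1 - u) = h u" for u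
      using theta_add_int[of a "-u" 1] by (simp add: h_def theta_minus cos_series_def c del: of_nat_Suc)
    show "((\<lambda>u. h u * cos (2 * pi * real j * u)) has_integral 0) {0..1}" for j
      using has_integral_diff[OF theta_fourier_coeff[OF a]
          has_integral_mult_right[OF cos_series_fourier_coeff[OF q], of "sqrt (pi / a)"], of j j]
      by (simp add: h_def q_def algebra_simps)
  qed (fact u)
  thus ?thesis by (simp add: h_def q_def)
qed

subsection \<open>The triple product\<close>

text \<open>The q-Pochhammer symbol (Q; Q)_m.\<close>

definition qpoch :: "real \<Rightarrow> nat \<Rightarrow> real"
  where "qpoch Q m = (\<Prod>i<m. 1 - Q ^ Suc i)"

text \<open>With the value 0 at negative indices the recurrence in \<open>inv_qpoch_pred\<close>
  holds for all integers: at \<open>m = 0\<close> its factor vanishes. Finite sums then extend over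
  all integers without boundary cases.\<close>

definition inv_qpoch :: "real \<Rightarrow> int \<Rightarrow> real"
  where "inv_qpoch Q m = (if m < 0 then 0 else 1 / qpoch Q (nat m))"

lemma qpoch_pos:
  assumes "0 < Q" "Q < 1" shows "0 < qpoch Q m"
  unfolding qpoch_def using assms by (intro prod_pos) (simp add: power_less_one_iff del: power_Suc)

lemma inv_qpoch_pred:
  assumes "0 < Q" "Q < 1"
  shows "inv_qpoch Q (m - 1) = (1 - Q powi m) * inv_qpoch Q m"
proof (cases "m \<le> 0")
  case True
  thus ?thesis by (cases "m = 0") (auto simp: inv_qpoch_def)
next
  case False
  then obtain n where n: "m = int (Suc n)" by (metis not_le zero_less_imp_eq_int gr0_implies_Suc of_nat_0_less_iff)
  have "Q ^ Suc n < 1" using assms by (simp add: power_less_one_iff del: power_Suc)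
  moreover have "nat m = Suc n" "m - 1 = int n" by (simp_all add: n)
  moreover have "Q powi m = Q ^ Suc n" unfolding n by (rule power_int_of_nat)
  ultimately show ?thesis by (simp add: inv_qpoch_def n qpoch_def)
qed

text \<open>The Euler product converges absolutely and has no zero factor, so its reciprocal is a
  positive limit.\<close>

lemma inv_qpoch_limit:
  assumes "0 < Q" "Q < 1"
  obtains L K where "0 < L" "(\<lambda>n. inv_qpoch Q (int n)) \<longlonglongrightarrow> L" "\<And>m. 0 \<le> inv_qpoch Q m" "\<And>m. inv_qpoch Q m \<le> K"
proof -
  define f where "f i = 1 - Q ^ Suc i" for i
  have "summable (\<lambda>i. Q * Q ^ i)" using assms by (intro summable_mult summable_geometric) auto
  hence "summable (\<lambda>i. norm (f i - 1))" using assms by (simp add: f_def)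
  hence c: "convergent_prod f"
    using abs_convergent_prod_conv_summable abs_convergent_prod_imp_convergent_prod by blast
  have nz: "f i \<noteq> 0" for i using assms power_less_one_iff[of Q "Suc i"] by (simp add: f_def)
  have "(\<lambda>n. \<Prod>i\<le>n. f i) \<longlonglongrightarrow> prodinf f" using c by (rule convergent_prod_LIMSEQ)
  hence "(\<lambda>n. qpoch Q (Suc n)) \<longlonglongrightarrow> prodinf f"
    unfolding qpoch_def f_def lessThan_Suc_atMost .
  hence lim: "qpoch Q \<longlonglongrightarrow> prodinf f" by (rule LIMSEQ_imp_Suc)
  have ge: "0 \<le> prodinf f"
    by (rule LIMSEQ_le_const[OF lim]) (use qpoch_pos[OF assms] in \<open>auto intro: less_imp_le\<close>)
  have pos: "0 < prodinf f" using ge prodinf_nonzero[OF c nz] by simp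
  have lim2: "(\<lambda>n. inv_qpoch Q (int n)) \<longlonglongrightarrow> 1 / prodinf f"
    unfolding inv_qpoch_def using pos by (auto intro!: tendsto_divide lim)
  hence "Bseq (\<lambda>n. inv_qpoch Q (int n))" by (intro convergent_imp_Bseq convergentI)
  then obtain K where K: "0 < K" "\<And>n. norm (inv_qpoch Q (int n)) \<le> K" by (auto simp: Bseq_def)
  have "inv_qpoch Q m \<le> K" for m
  proof (cases "m < 0")
    case True thus ?thesis using K by (simp add: inv_qpoch_def)
  next
    case False thus ?thesis using K(2)[of "nat m"] by simp
  qed
  moreover have "0 \<le> inv_qpoch Q m" for m
    using qpoch_pos[OF assms, of "nat m"] by (simp add: inv_qpoch_def)
  ultimately show ?thesis using pos lim2 that[of "1 / prodinf f" K] by simp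
qed

text \<open>This is \<open>q powi k\<^sup>2\<close> times the Gaussian binomial coefficient of 2N
  over N + k in base \<open>q\<^sup>2\<close>, divided by \<open>qpoch (q\<^sup>2) (2 * N)\<close>.
  The division makes the coefficients converge as \<open>N\<close> grows.\<close>

definition triple_coeff :: "real \<Rightarrow> nat \<Rightarrow> int \<Rightarrow> real" where
  "triple_coeff q N k = q powi (k\<^sup>2) * inv_qpoch (q\<^sup>2) (int N - k) * inv_qpoch (q\<^sup>2) (int N + k)"

text \<open>Multiplication by the next factor of the product mixes \<open>k\<close> with its two
  neighbours. In terms of X = Q^(N-k) and Y = Q^(N+k) all terms share the factor
  \<open>w * I * J\<close>, and a polynomial identity in Q, X, Y remains.\<close>

lemma triple_coeff_rec:
  assumes q: "0 < q" "q < 1"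
  shows "(1 - q ^ (4 * N + 2)) * (1 - q ^ (4 * N + 4)) * triple_coeff q (Suc N) k =
    (1 + q ^ (4 * N + 2)) * triple_coeff q N k +
    q ^ (2 * N + 1) * (triple_coeff q N (k - 1) + triple_coeff q N (k + 1))"
proof -
  define Q X Y where "Q = q\<^sup>2" and "X = q powi (2 * (int N - k))" and "Y = q powi (2 * (int N + k))"
  define w I J where "w = q powi (k\<^sup>2)" and "I = inv_qpoch Q (int N + 1 - k)"
    and "J = inv_qpoch Q (int N + 1 + k)"
  have Q: "0 < Q" "Q < 1" using q by (auto simp: Q_def power_less_one_iff)
  have q0: "q \<noteq> 0" using q by simp
  have Qpow: "Q powi m = q powi (2 * m)" for m
    unfolding Q_def by (simp add: power_int_mult)
  have m: "q powi (i + j) = q powi i * q powi j" for i j using q0 by (intro power_int_add) simp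
  have Q2: "q powi 2 = Q" by (simp add: Q_def)
  have e1: "2 * (int N + 1 - k) = 2 + 2 * (int N - k)" "2 * (int N + 1 + k) = 2 + 2 * (int N + k)" by simp_all
  have A1: "Q powi (int N + 1 - k) = Q * X" "Q powi (int N + 1 + k) = Q * Y"
    "Q powi (int N - k) = X" "Q powi (int N + k) = Y"
    unfolding Qpow X_def Y_def e1 m Q2 by (rule refl)+
  have "X * Y = q powi int (4 * N)" unfolding X_def Y_def m[symmetric] by simp
  hence XY: "X * Y = q ^ (4 * N)" by (simp only: power_int_of_nat)
  have A2: "q ^ (4 * N + 2) = Q * X * Y" "q ^ (4 * N + 4) = Q\<^sup>2 * X * Y"
    unfolding mult.assoc XY power_add by (simp_all add: Q_def flip: power_mult)
  have e2: "int (2 * N + 1) + (k - 1)\<^sup>2 = k\<^sup>2 + 2 + 2 * (int N - k)"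
    "int (2 * N + 1) + (k + 1)\<^sup>2 = k\<^sup>2 + 2 + 2 * (int N + k)"
    by (simp_all add: power2_eq_square algebra_simps)
  have A3: "q ^ (2 * N + 1) * q powi ((k - 1)\<^sup>2) = w * Q * X" "q ^ (2 * N + 1) * q powi ((k + 1)\<^sup>2) = w * Q * Y"
    unfolding X_def Y_def w_def Q2[symmetric] power_int_of_nat[symmetric] m[symmetric] e2 by (rule refl)+
  note pred = inv_qpoch_pred[OF Q]
  have e3: "int N + 1 - k - 1 = int N - k" "int N + 1 + k - 1 = int N + k"
    "int (Suc N) - k = int N + 1 - k" "int (Suc N) + k = int N + 1 + k" by simp_all
  have B1: "inv_qpoch Q (int N - k) = (1 - Q * X) * I" "inv_qpoch Q (int N + k) = (1 - Q * Y) * J"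
    using pred[of "int N + 1 - k"] pred[of "int N + 1 + k"] unfolding e3 A1 I_def J_def by simp_all
  have B2: "inv_qpoch Q (int N - k - 1) = (1 - X) * (1 - Q * X) * I" "inv_qpoch Q (int N + k - 1) = (1 - Y) * (1 - Q * Y) * J"
    using pred[of "int N - k"] pred[of "int N + k"] unfolding A1 B1 by simp_all
  have C0: "triple_coeff q (Suc N) k = w * I * J"
    unfolding triple_coeff_def w_def I_def J_def Q_def e3 ..
  have C1: "triple_coeff q N k = w * ((1 - Q * X) * I) * ((1 - Q * Y) * J)"
    unfolding triple_coeff_def w_def[symmetric] Q_def[symmetric] B1 ..
  have e: "int N - (k - 1) = int N + 1 - k" "int N + (k - 1) = int N + k - 1"
    "int N - (k + 1) = int N - k - 1" "int N + (k + 1) = int N + 1 + k" by simp_all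
  have C2: "q ^ (2 * N + 1) * triple_coeff q N (k - 1) = w * Q * X * I * ((1 - Y) * (1 - Q * Y) * J)"
    unfolding triple_coeff_def Q_def[symmetric] e B2 I_def[symmetric] mult.assoc[symmetric] A3 ..
  have C3: "q ^ (2 * N + 1) * triple_coeff q N (k + 1) = w * Q * Y * ((1 - X) * (1 - Q * X) * I) * J"
    unfolding triple_coeff_def Q_def[symmetric] e B2 J_def[symmetric] mult.assoc[symmetric] A3 ..
  show ?thesis unfolding distrib_left[of "q ^ (2 * N + 1)"] C0 C1 C2 C3 A2
    by (simp add: algebra_simps power2_eq_square)
qed

lemma triple_coeff_eq_0: "\<bar>k\<bar> > int N \<Longrightarrow> triple_coeff q N k = 0"
  by (auto simp: triple_coeff_def inv_qpoch_def)

text \<open>Finite form of Jacobi's triple product on the unit circle: each factor is a conjugate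
  pair (1 + q^(2n+1) z)(1 + q^(2n+1) / z).\<close>

lemma finite_triple_product:
  assumes q: "0 < q" "q < 1"
  shows "((\<lambda>k. triple_coeff q N k * cos (of_int k * x)) has_sum
    (\<Prod>n<N. 1 + 2 * q ^ (2 * n + 1) * cos x + q ^ (4 * n + 2)) / qpoch (q\<^sup>2) (2 * N)) UNIV"
proof (induction N)
  case 0
  have "((\<lambda>k. triple_coeff q 0 k * cos (of_int k * x)) has_sum 1) UNIV"
    by (rule has_sum_finite_neutralI[of "{0}"])
       (auto simp: triple_coeff_eq_0, simp add: triple_coeff_def inv_qpoch_def qpoch_def)
  thus ?case by (simp add: qpoch_def)
next
  case (Suc N)
  define P where "P = (\<Prod>n<N. 1 + 2 * q ^ (2 * n + 1) * cos x + q ^ (4 * n + 2))"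
  define R where "R = qpoch (q\<^sup>2) (2 * N)"
  define c where "c = triple_coeff q N"
  have sm: "(\<lambda>k. c k * g k) summable_on UNIV" for g
    by (rule finite_nonzero_values_imp_summable_on, rule finite_subset[of _ "{- int N..int N}"])
       (use triple_coeff_eq_0[of N _ q] in \<open>force simp: c_def not_le\<close>, simp)
  obtain S1 where S1: "((\<lambda>k. c k * cos (of_int (k + 1) * x)) has_sum S1) UNIV"
    using sm[of "\<lambda>k. cos (of_int (k + 1) * x)"] by (auto simp: summable_on_def)
  obtain S2 where S2: "((\<lambda>k. c k * cos (of_int (k - 1) * x)) has_sum S2) UNIV"
    using sm[of "\<lambda>k. cos (of_int (k - 1) * x)"] by (auto simp: summable_on_def)
  have IH: "((\<lambda>k. c k * cos (of_int k * x)) has_sum P / R) UNIV" using Suc by (simp add: c_def P_def R_def)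
  have "((\<lambda>k. c k * cos (of_int (k + 1) * x) + c k * cos (of_int (k - 1) * x)) has_sum S1 + S2) UNIV"
    by (intro has_sum_add S1 S2)
  moreover have "c k * cos (of_int (k + 1) * x) + c k * cos (of_int (k - 1) * x) = 2 * cos x * (c k * cos (of_int k * x))" for k
    by (simp add: algebra_simps cos_add cos_diff)
  ultimately have "S1 + S2 = 2 * cos x * (P / R)"
    using has_sum_cmult_right[OF IH, of "2 * cos x"] has_sum_unique by simp
  have T1: "((\<lambda>k. c (k - 1) * cos (of_int k * x)) has_sum S1) UNIV"
    using S1 by (subst has_sum_reindex_bij_witness[of _ "\<lambda>k. k + 1" "\<lambda>k. k - 1" _ "\<lambda>k. c k * cos (of_int (k + 1) * x)"]) auto
  have T2: "((\<lambda>k. c (k + 1) * cos (of_int k * x)) has_sum S2) UNIV"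
    using S2 by (subst has_sum_reindex_bij_witness[of _ "\<lambda>k. k - 1" "\<lambda>k. k + 1" _ "\<lambda>k. c k * cos (of_int (k - 1) * x)"]) auto
  define z where "z = (1 - q ^ (4 * N + 2)) * (1 - q ^ (4 * N + 4))"
  have z: "z \<noteq> 0" using q power_less_one_iff[of q "4 * N + 2"] power_less_one_iff[of q "4 * N + 4"]
    by (simp add: z_def del: power_Suc)
  have "((\<lambda>k. (1 + q ^ (4 * N + 2)) * (c k * cos (of_int k * x)) + q ^ (2 * N + 1) *
     (c (k - 1) * cos (of_int k * x) + c (k + 1) * cos (of_int k * x)))
    has_sum (1 + q ^ (4 * N + 2)) * (P / R) + q ^ (2 * N + 1) * (S1 + S2)) UNIV"
    by (intro has_sum_add has_sum_cmult_right IH T1 T2)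
  moreover have "(1 + q ^ (4 * N + 2)) * (c k * cos (of_int k * x)) + q ^ (2 * N + 1) *
     (c (k - 1) * cos (of_int k * x) + c (k + 1) * cos (of_int k * x)) = z * (triple_coeff q (Suc N) k * cos (of_int k * x))" for k
  proof -
    have "(1 + q ^ (4 * N + 2)) * (c k * cos (of_int k * x)) + q ^ (2 * N + 1) *
     (c (k - 1) * cos (of_int k * x) + c (k + 1) * cos (of_int k * x)) =
     ((1 + q ^ (4 * N + 2)) * c k + q ^ (2 * N + 1) * (c (k - 1) + c (k + 1))) * cos (of_int k * x)"
      by (simp add: algebra_simps)
    thus ?thesis using triple_coeff_rec[OF q, of N k] by (simp add: z_def c_def)
  qed
  moreover have "(1 + q ^ (4 * N + 2)) * (P / R) + q ^ (2 * N + 1) * (S1 + S2) =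
    (1 + 2 * q ^ (2 * N + 1) * cos x + q ^ (4 * N + 2)) * P / R"
    unfolding \<open>S1 + S2 = 2 * cos x * (P / R)\<close> by (simp add: algebra_simps add_divide_distrib)
  ultimately have "((\<lambda>k. z * (triple_coeff q (Suc N) k * cos (of_int k * x))) has_sum
    (1 + 2 * q ^ (2 * N + 1) * cos x + q ^ (4 * N + 2)) * P / R) UNIV" by simp
  hence "((\<lambda>k. inverse z * (z * (triple_coeff q (Suc N) k * cos (of_int k * x)))) has_sum
    inverse z * ((1 + 2 * q ^ (2 * N + 1) * cos x + q ^ (4 * N + 2)) * P / R)) UNIV" by (rule has_sum_cmult_right)
  moreover have "(\<lambda>k. inverse z * (z * (triple_coeff q (Suc N) k * cos (of_int k * x)))) =
      (\<lambda>k. triple_coeff q (Suc N) k * cos (of_int k * x))" using z by (simp add: fun_eq_iff)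
  moreover have "inverse z * ((1 + 2 * q ^ (2 * N + 1) * cos x + q ^ (4 * N + 2)) * P / R) =
    (\<Prod>n<Suc N. 1 + 2 * q ^ (2 * n + 1) * cos x + q ^ (4 * n + 2)) / qpoch (q\<^sup>2) (2 * Suc N)"
  proof -
    have "(q\<^sup>2) ^ Suc (2 * N) = q ^ (4 * N + 2)" "(q\<^sup>2) ^ Suc (Suc (2 * N)) = q ^ (4 * N + 4)"
      by (simp_all only: power_mult[symmetric]) (rule arg_cong[of _ _ "power q"], simp)+
    hence Rz: "qpoch (q\<^sup>2) (2 * Suc N) = R * z" by (simp add: R_def z_def qpoch_def del: power_Suc)
    have "(\<Prod>n<Suc N. 1 + 2 * q ^ (2 * n + 1) * cos x + q ^ (4 * n + 2)) =
       (1 + 2 * q ^ (2 * N + 1) * cos x + q ^ (4 * N + 2)) * P"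
      unfolding P_def prod.lessThan_Suc by (rule mult.commute)
    thus ?thesis unfolding Rz by (simp only: divide_inverse inverse_mult_distrib mult_ac)
  qed
  ultimately show ?case by (simp only:)
qed

text \<open>Tannery's theorem: each coefficient converges, and
  \<open>K\<^sup>2 * q ^ n\<^sup>2\<close> majorizes it uniformly in \<open>N\<close>. The constant
  is left abstract because it cancels in the quotients taken later.\<close>

lemma triple_product_limit:
  assumes q: "0 < q" "q < 1"
  shows "\<exists>L>0. \<forall>u. (\<lambda>N. (\<Prod>n<N. 1 + 2 * q ^ (2 * n + 1) * cos (2 * pi * u) + q ^ (4 * n + 2)) / qpoch (q\<^sup>2) (2 * N))
      \<longlonglongrightarrow> L * cos_series q u"
proof -
  have q2: "0 < q\<^sup>2" "q\<^sup>2 < 1" using q by (auto simp: power_less_one_iff)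
  obtain L K where L: "0 < L" "(\<lambda>n. inv_qpoch (q\<^sup>2) (int n)) \<longlonglongrightarrow> L"
    "\<And>m. 0 \<le> inv_qpoch (q\<^sup>2) m" "\<And>m. inv_qpoch (q\<^sup>2) m \<le> K"
    using inv_qpoch_limit[OF q2] by metis
  have K: "0 \<le> K" using L(3,4)[of 0] by linarith
  have sym: "triple_coeff q N (- k) = triple_coeff q N k" for N k
    by (simp add: triple_coeff_def mult_ac)
  have nonneg: "0 \<le> triple_coeff q N k" for N k
    using q L(3) by (simp add: triple_coeff_def)
  have le: "triple_coeff q N (int n) \<le> K\<^sup>2 * q ^ (n\<^sup>2)" for N n
  proof -
    have "q powi ((int n)\<^sup>2) = q ^ (n\<^sup>2)" by (metis of_nat_power power_int_of_nat)
    moreover have "inv_qpoch (q\<^sup>2) (int N - int n) * inv_qpoch (q\<^sup>2) (int N + int n) \<le> K * K"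
      by (intro mult_mono L K)
    hence "q ^ (n\<^sup>2) * (inv_qpoch (q\<^sup>2) (int N - int n) * inv_qpoch (q\<^sup>2) (int N + int n)) \<le> q ^ (n\<^sup>2) * (K * K)"
      using q by (intro mult_left_mono) auto
    ultimately show ?thesis by (simp add: triple_coeff_def power2_eq_square mult_ac)
  qed
  have lim: "(\<lambda>N. triple_coeff q N (int n)) \<longlonglongrightarrow> L\<^sup>2 * q ^ (n\<^sup>2)" for n
  proof -
    have e: "q powi ((int n)\<^sup>2) = q ^ (n\<^sup>2)" by (metis of_nat_power power_int_of_nat)
    have "(\<lambda>N. inv_qpoch (q\<^sup>2) (int (N + n) - int n)) \<longlonglongrightarrow> L" using L(2) by simp
    hence 1: "(\<lambda>N. inv_qpoch (q\<^sup>2) (int N - int n)) \<longlonglongrightarrow> L" by (rule LIMSEQ_offset)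
    have 2: "(\<lambda>N. inv_qpoch (q\<^sup>2) (int N + int n)) \<longlonglongrightarrow> L"
      using LIMSEQ_ignore_initial_segment[OF L(2), of n] by simp
    have "(\<lambda>N. q ^ (n\<^sup>2) * inv_qpoch (q\<^sup>2) (int N - int n) * inv_qpoch (q\<^sup>2) (int N + int n)) \<longlonglongrightarrow> q ^ (n\<^sup>2) * L * L"
      by (intro tendsto_intros 1 2)
    thus ?thesis unfolding triple_coeff_def e by (simp add: power2_eq_square mult_ac)
  qed
  show ?thesis
  proof (intro exI[of _ "L\<^sup>2"] conjI allI)
    show "0 < L\<^sup>2" using L(1) by simp
    fix u
    define x where "x = 2 * pi * u"
    define g where "g n N = triple_coeff q N (int n) * cos (real n * x) + triple_coeff q N (int (Suc n)) * cos (real (Suc n) * x)" for n N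
    define b where "b n = L\<^sup>2 * q ^ (n\<^sup>2) * cos (real n * x) + L\<^sup>2 * q ^ ((Suc n)\<^sup>2) * cos (real (Suc n) * x)" for n
    have term_le: "norm (g n N) \<le> 2 * K\<^sup>2 * q ^ n" for n N
    proof -
      have A: "norm (triple_coeff q N (int m) * cos y) \<le> K\<^sup>2 * q ^ n" if "n \<le> m" for m y
      proof -
        have "norm (triple_coeff q N (int m) * cos y) \<le> K\<^sup>2 * q ^ (m\<^sup>2) * 1"
          unfolding norm_mult using nonneg le[of N m] q by (intro mult_mono) auto
        also have "\<dots> \<le> K\<^sup>2 * q ^ n * 1"
        proof (intro mult_right_mono mult_left_mono power_decreasing)
          have "n \<le> m * 1" using that by simp
          also have "m * 1 \<le> m * m" by (cases m) auto
          finally show "n \<le> m\<^sup>2" by (simp add: power2_eq_square)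
        qed (use q in auto)
        finally show ?thesis by simp
      qed
      have "norm (g n N) \<le> K\<^sup>2 * q ^ n + K\<^sup>2 * q ^ n"
        unfolding g_def by (rule order_trans[OF norm_triangle_ineq]) (intro add_mono A; simp)
      thus ?thesis by (simp add: mult_ac)
    qed
    have "(\<lambda>N. \<Sum>n. g n N) \<longlonglongrightarrow> (\<Sum>n. b n)"
    proof -
      have "(\<lambda>N. g n N) \<longlonglongrightarrow> b n" for n
        unfolding g_def b_def by (intro tendsto_add tendsto_mult_right lim)
      moreover have "\<forall>\<^sub>F (n, N) in sequentially \<times>\<^sub>F sequentially. norm (g n N) \<le> 2 * K\<^sup>2 * q ^ n"
        using term_le by (intro always_eventually) auto
      moreover have "summable (\<lambda>n. 2 * K\<^sup>2 * q ^ n)"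
        using q by (intro summable_mult summable_geometric) simp
      ultimately show ?thesis using tannerys_theorem[of g b sequentially "\<lambda>n. 2 * K\<^sup>2 * q ^ n"] by simp
    qed
    moreover have "(\<Sum>n. g n N) = (\<Prod>n<N. 1 + 2 * q ^ (2 * n + 1) * cos x + q ^ (4 * n + 2)) / qpoch (q\<^sup>2) (2 * N)" for N
    proof -
      have "- int n - 1 = - int (Suc n)" for n by simp
      hence "(\<lambda>n. g n N) sums ((\<Prod>n<N. 1 + 2 * q ^ (2 * n + 1) * cos x + q ^ (4 * n + 2)) / qpoch (q\<^sup>2) (2 * N))"
        using has_sum_int_imp_sums[OF finite_triple_product[OF q, of N x]]
        by (simp only: sym of_int_minus of_int_of_nat_eq mult_minus_left cos_minus g_def)
      thus ?thesis by (rule sums_unique[symmetric])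
    qed
    moreover have "(\<Sum>n. b n) = L\<^sup>2 * cos_series q u"
    proof -
      have "summable (\<lambda>n. q ^ (n\<^sup>2) * cos (2 * pi * real n * u) + q ^ ((Suc n)\<^sup>2) * cos (2 * pi * real (Suc n) * u))"
        by (rule summable_comparison_test'[of "\<lambda>n. 2 * q ^ n"])
           (use q cos_series_term_le in \<open>auto intro!: summable_mult summable_geometric\<close>)
      from suminf_mult[OF this, of "L\<^sup>2"] show ?thesis unfolding cos_series_def b_def x_def
        by (simp add: algebra_simps)
    qed
    ultimately show "(\<lambda>N. (\<Prod>n<N. 1 + 2 * q ^ (2 * n + 1) * cos (2 * pi * u) + q ^ (4 * n + 2)) / qpoch (q\<^sup>2) (2 * N))
      \<longlonglongrightarrow> L\<^sup>2 * cos_series q u" by (simp add: x_def)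
  qed
qed

section \<open>Product formula for the periodized Gaussian\<close>

text \<open>Coefficient of \<open>s\<close> in the triple product factor 1 + 2 q^(2n+1) s + q^(4n+2)
  divided by its value at \<open>s = 0\<close>, for q = exp(- pi^2 / a).\<close>

definition sech_coeff :: "real \<Rightarrow> nat \<Rightarrow> real"
  where "sech_coeff a n = 1 / cosh ((2 * real n + 1) * (pi\<^sup>2 / a))"

lemma sech_coeff_bounds:
  assumes "0 < a"
  shows "0 < sech_coeff a n" "sech_coeff a n < 1"
proof -
  have "(2 * real n + 1) * (pi\<^sup>2 / a) \<noteq> 0" using assms by (simp add: add_nonneg_eq_0_iff)
  hence "1 < cosh ((2 * real n + 1) * (pi\<^sup>2 / a))"
    by (metis cosh_real_ge_1 cosh_real_one_iff order_le_less)
  thus "0 < sech_coeff a n" "sech_coeff a n < 1" by (auto simp: sech_coeff_def)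
qed

text \<open>At \<open>u = 1 / 4\<close> the cosine vanishes. Normalizing there cancels the Poisson
  factor, the constant of the triple product and the q-Pochhammer symbols together.\<close>

lemma theta_product:
  assumes a: "0 < a"
  shows "(\<lambda>N. lin_prod (sech_coeff a) N (cos (2 * pi * u))) \<longlonglongrightarrow> theta a u / theta a (1 / 4)"
proof -
  define q where "q = exp (- pi\<^sup>2 / a)"
  have q: "0 < q" "q < 1" using a by (auto simp: q_def)
  define P where "P N u = (\<Prod>n<N. 1 + 2 * q ^ (2 * n + 1) * cos (2 * pi * u) + q ^ (4 * n + 2)) / qpoch (q\<^sup>2) (2 * N)" for N u
  obtain L where L: "0 < L" "\<And>u. (\<lambda>N. P N u) \<longlonglongrightarrow> L * cos_series q u"
    unfolding P_def using triple_product_limit[OF q] by blast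
  \<comment> \<open>Poisson summation was established on the unit interval, hence the reduction to
    the fractional part.\<close>
  define v where "v = frac u"
  have v: "v \<in> {0..1}" using frac_ge_0[of u] frac_lt_1[of u] by (auto simp: v_def)
  define k where "k = \<lfloor>u\<rfloor>"
  have uv: "u = v + of_int k" unfolding v_def frac_def k_def by simp
  have theta: "theta a v = sqrt (pi / a) * cos_series q v" if "v \<in> {0..1}" for v
    using theta_eq_cos_series[OF a that] by (simp add: q_def)
  have cu: "cos (2 * pi * u) = cos (2 * pi * v)"
  proof -
    have "2 * pi * u = 2 * pi * v + 2 * pi * of_int k" using uv by (simp add: distrib_left)
    thus ?thesis by (simp only: cos_add sin_int_2pin cos_int_2pin)
  qed
  have tu: "theta a u = theta a v" using theta_add_int[of a v k] uv by simp
  have nz: "L * cos_series q (1 / 4) \<noteq> 0"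
    using theta[of "1 / 4"] theta_pos[OF a, of "1 / 4"] L(1) by auto
  have "(\<lambda>N. P N v / P N (1 / 4)) \<longlonglongrightarrow> (L * cos_series q v) / (L * cos_series q (1 / 4))"
    by (intro tendsto_divide L nz)
  moreover have "(L * cos_series q v) / (L * cos_series q (1 / 4)) = theta a u / theta a (1 / 4)"
    unfolding tu using theta[OF v] theta[of "1 / 4"] L(1) a by simp
  moreover have "P N v / P N (1 / 4) = lin_prod (sech_coeff a) N (cos (2 * pi * u))" for N
  proof -
    have c4: "cos (2 * pi * (1 / 4)) = 0" using cos_pi_half by simp
    have "P N v / P N (1 / 4) = (\<Prod>n<N. (1 + 2 * q ^ (2 * n + 1) * cos (2 * pi * v) + q ^ (4 * n + 2)) / (1 + q ^ (4 * n + 2)))"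
      unfolding P_def c4 prod_dividef using qpoch_pos[of "q\<^sup>2" "2 * N"] q by (simp add: power_less_one_iff)
    also have "\<dots> = lin_prod (sech_coeff a) N (cos (2 * pi * u))" unfolding lin_prod_def
    proof (intro prod.cong refl)
      fix n
      define y where "y = (2 * real n + 1) * (pi\<^sup>2 / a)"
      have "q ^ (2 * n + 1) = exp (- y)"
        by (simp only: q_def y_def exp_of_nat_mult[symmetric]) (simp add: algebra_simps)
      moreover have "q ^ (4 * n + 2) = exp (- y) * exp (- y)"
        by (simp only: \<open>q ^ (2 * n + 1) = exp (- y)\<close>[symmetric] power_add[symmetric]) (simp add: algebra_simps)
      moreover have "sech_coeff a n = 2 * exp (- y) / (1 + exp (- y) * exp (- y))"
        unfolding sech_coeff_def y_def[symmetric] cosh_def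
        by (simp add: field_simps exp_minus add_pos_pos)
      moreover have "1 + exp (- y) * exp (- y) \<noteq> 0" by (smt (verit) zero_le_mult_iff exp_ge_zero)
      ultimately show "(1 + 2 * q ^ (2 * n + 1) * cos (2 * pi * v) + q ^ (4 * n + 2)) / (1 + q ^ (4 * n + 2))
        = 1 + sech_coeff a n * cos (2 * pi * u)" unfolding cu by (simp only:) (simp add: field_simps)
    qed
    finally show ?thesis .
  qed
  ultimately show ?thesis by (simp only:)
qed

subsection \<open>The critical inequality\<close>

lemma sin_taylor_7:
  fixes x :: real assumes "0 \<le> x"
  shows "sin x \<le> x - x ^ 3 / 6 + x ^ 5 / 120 - x ^ 7 / 5040 + x ^ 8 / 40320"
    and "x - x ^ 3 / 6 + x ^ 5 / 120 - x ^ 7 / 5040 - x ^ 8 / 40320 \<le> sin x"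
proof -
  have f: "fact 3 = (6::real)" "fact 5 = (120::real)" "fact 7 = (5040::real)" "fact 8 = (40320::real)"
    by (simp_all add: fact_numeral)
  have c: "sin_coeff 0 = 0" "sin_coeff 1 = 1" "sin_coeff 2 = 0" "sin_coeff 3 = - 1 / 6"
    "sin_coeff 4 = 0" "sin_coeff 5 = 1 / 120" "sin_coeff 6 = 0" "sin_coeff 7 = - 1 / 5040"
    by (simp_all add: sin_coeff_def f)
  have S: "(\<Sum>m<8. g m) = g 0 + g 1 + g 2 + g 3 + g 4 + g 5 + g 6 + g 7" for g :: "nat \<Rightarrow> real"
    by (simp add: eval_nat_numeral)
  have "(\<Sum>m<8. sin_coeff m * x ^ m) = x - x ^ 3 / 6 + x ^ 5 / 120 - x ^ 7 / 5040"
    unfolding S c by (simp only: mult_zero_left mult_1 power_one_right add_0_left add_0_right)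
  moreover have "inverse (fact 8) * \<bar>x\<bar> ^ 8 = x ^ 8 / 40320"
    unfolding f using assms by (simp only: abs_of_nonneg divide_inverse mult.commute)
  ultimately have "\<bar>sin x - (x - x ^ 3 / 6 + x ^ 5 / 120 - x ^ 7 / 5040)\<bar> \<le> x ^ 8 / 40320"
    using Maclaurin_sin_bound[of x 8] by (simp only:)
  thus "sin x \<le> x - x ^ 3 / 6 + x ^ 5 / 120 - x ^ 7 / 5040 + x ^ 8 / 40320"
    and "x - x ^ 3 / 6 + x ^ 5 / 120 - x ^ 7 / 5040 - x ^ 8 / 40320 \<le> sin x"
    by linarith+
qed

text \<open>The value of sine at \<open>pi / 6\<close> is \<open>1 / 2\<close>; the Taylor bounds
  are evaluated at 3.1415 / 6 = 6283 / 12000 and 3.1416 / 6 = 1309 / 2500.\<close>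

lemma pi_bounds: "3.1415 < pi" "pi < 3.1416"
proof -
  show "3.1415 < pi"
  proof (rule ccontr)
    assume "\<not> 3.1415 < pi"
    hence "pi / 6 \<le> 6283 / 12000" by simp
    hence "sin (pi / 6) \<le> sin (6283 / 12000)" using pi_gt3
      by (intro sin_monotone_2pi_le) auto
    also have "\<dots> \<le> 6283 / 12000 - (6283 / 12000) ^ 3 / 6 + (6283 / 12000) ^ 5 / 120 - (6283 / 12000) ^ 7 / 5040 + (6283 / 12000) ^ 8 / 40320"
      by (rule sin_taylor_7) simp
    also have "\<dots> < 1 / 2" by (simp add: power_divide)
    finally show False by (simp add: sin_30)
  qed
  show "pi < 3.1416"
  proof (rule ccontr)
    assume "\<not> pi < 3.1416"
    hence le: "1309 / 2500 \<le> pi / 6" by simp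
    have "1 / 2 < 1309 / 2500 - (1309 / 2500) ^ 3 / 6 + (1309 / 2500) ^ 5 / 120 - (1309 / 2500) ^ 7 / 5040 - (1309 / 2500 :: real) ^ 8 / 40320"
      by (simp add: power_divide)
    also have "\<dots> \<le> sin (1309 / 2500)" by (rule sin_taylor_7) simp
    also have "\<dots> \<le> sin (pi / 6)" using le pi_gt3 by (intro sin_monotone_2pi_le) auto
    finally show False by (simp add: sin_30)
  qed
qed

section \<open>Termwise comparison of coefficients for small a\<close>

lemma cosh_ge_quadratic:
  fixes z :: real assumes "0 \<le> z" shows "1 + z\<^sup>2 / 2 \<le> cosh z"
proof -
  have "z / 2 \<le> sinh (z / 2)"
    using real_le_x_sinh[of "z / 2"] assms by (simp add: sinh_def exp_minus)
  hence "(z / 2)\<^sup>2 \<le> (sinh (z / 2))\<^sup>2" using assms by (intro power_mono) auto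
  moreover have "cosh z = 1 + 2 * (sinh (z / 2))\<^sup>2"
    using cosh_double_cosh[of "z / 2"] by (simp add: cosh_square_eq)
  ultimately show ?thesis by (simp add: power_divide)
qed

text \<open>In c = cosh(x/4) the two hyperbolic cosines are Chebyshev polynomials, and the
  difference factors as 2 (c - 1)(4c^3 - 4c - 1), nonnegative from about c = 1.1072 on. The constant
  1.876 lies just below 4 pi^2 / 21.\<close>

lemma cosh_three_quarters_le:
  fixes x :: real assumes "1.876 \<le> x" shows "2 * cosh (3 * x / 4) \<le> 1 + cosh x"
proof -
  define z c where "z = x / 4" and "c = cosh z"
  have z: "0.469 \<le> z" using assms by (simp add: z_def)
  have "0.469\<^sup>2 \<le> z\<^sup>2" using z by (intro power_mono) auto
  hence c: "1.109 \<le> c" using cosh_ge_quadratic[of z] z by (simp add: c_def power2_eq_square)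
  have c2: "cosh (2 * z) = 2 * c\<^sup>2 - 1" unfolding c_def by (rule cosh_double_cosh)
  have c4: "cosh x = 8 * c ^ 4 - 8 * c\<^sup>2 + 1"
  proof -
    have "x = 2 * (2 * z)" by (simp add: z_def)
    hence "cosh x = 2 * (2 * c\<^sup>2 - 1)\<^sup>2 - 1" by (simp only: cosh_double_cosh c_def)
    thus ?thesis by (simp add: power2_eq_square algebra_simps power4_eq_xxxx)
  qed
  have "3 * x / 4 = 2 * z + z" by (simp add: z_def)
  hence "cosh (3 * x / 4) = cosh (2 * z) * cosh z + sinh (2 * z) * sinh z" by (simp only: cosh_add)
  also have "\<dots> = (2 * c\<^sup>2 - 1) * c + 2 * c * (sinh z)\<^sup>2" by (simp add: c2 sinh_double c_def power2_eq_square)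
  also have "(sinh z)\<^sup>2 = c\<^sup>2 - 1" by (simp add: c_def cosh_square_eq)
  finally have c3: "cosh (3 * x / 4) = 4 * c ^ 3 - 3 * c" by (simp add: algebra_simps power2_eq_square power3_eq_cube)
  have "1.109 * 1.109 \<le> c * c" using c by (intro mult_mono) auto
  hence "0 \<le> c * (4 * (c * c) - 4) - 1"
    using mult_mono[of "1.109" c "0.9195" "4 * (c * c) - 4"] c by simp
  hence "0 \<le> 2 * (c - 1) * (c * (4 * (c * c) - 4) - 1)" using c by (intro mult_nonneg_nonneg) auto
  also have "\<dots> = 1 + cosh x - 2 * cosh (3 * x / 4)" unfolding c3 c4
    by (simp add: algebra_simps power2_eq_square power3_eq_cube power4_eq_xxxx)
  finally show ?thesis by simp
qed

lemma sech_coeff_mono: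
  assumes "0 < a" "a \<le> b" shows "sech_coeff a n \<le> sech_coeff b n"
proof -
  have "pi\<^sup>2 / b \<le> pi\<^sup>2 / a" using assms by (intro divide_left_mono) auto
  hence "(2 * real n + 1) * (pi\<^sup>2 / b) \<le> (2 * real n + 1) * (pi\<^sup>2 / a)" by (intro mult_left_mono) auto
  hence "cosh ((2 * real n + 1) * (pi\<^sup>2 / b)) \<le> cosh ((2 * real n + 1) * (pi\<^sup>2 / a))"
    using assms by (subst cosh_real_nonneg_le_iff) auto
  thus ?thesis unfolding sech_coeff_def by (intro divide_left_mono) (auto simp: cosh_real_pos)
qed

text \<open>The two sides are 2 / (1 + cosh x) and 1 / cosh(3x/4). The smallest \<open>x\<close>
  belongs to \<open>n = 0\<close>, so that factor alone determines the admissible range of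
  \<open>a\<close>.\<close>

lemma half_sech_coeff_le:
  assumes "0 < a" "a \<le> 21 / 4"
  shows "2 * (sech_coeff a n / (1 + sech_coeff a n)) \<le> sech_coeff (4 * a / 3) n"
proof -
  define x where "x = (2 * real n + 1) * (pi\<^sup>2 / a)"
  have "3.1415\<^sup>2 \<le> pi\<^sup>2" using pi_bounds by (intro power_mono) auto
  hence "1.876 \<le> pi\<^sup>2 / a" using assms by (simp add: field_simps power2_eq_square)
  also have "\<dots> = 1 * (pi\<^sup>2 / a)" by simp
  also have "\<dots> \<le> x" unfolding x_def using assms by (intro mult_right_mono) auto
  finally have "2 * cosh (3 * x / 4) \<le> 1 + cosh x" by (rule cosh_three_quarters_le)
  moreover have "0 < cosh (3 * x / 4)" "0 < cosh x" by (auto simp: cosh_real_pos)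
  moreover have "(2 * real n + 1) * (pi\<^sup>2 / (4 * a / 3)) = 3 * x / 4" using assms by (simp add: x_def field_simps)
  hence "sech_coeff (4 * a / 3) n = 1 / cosh (3 * x / 4)" unfolding sech_coeff_def by (simp only:)
  moreover have "sech_coeff a n = 1 / cosh x" by (simp add: sech_coeff_def x_def)
  moreover have "2 * ((1 / C) / (1 + 1 / C)) \<le> 1 / D" if "2 * D \<le> 1 + C" "0 < D" "0 < C" for C D :: real
    using that by (simp add: field_simps)
  ultimately show ?thesis by (simp only:)
qed

section \<open>Large a: logarithmic derivatives and theta estimates\<close>

text \<open>The next two lemmas bound logarithmic derivatives of the product formula at \<open>u = 0\<close> and
  \<open>u = 1 / 4\<close> by the corresponding difference quotients of the Gaussian series.\<close>

lemma sech_coeff_quadratic_bound: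
  assumes a: "0 < a"
  shows "2 * (\<Sum>n<N. sech_coeff a n / (1 + sech_coeff a n)) * pi\<^sup>2 \<le> a - 4 * a\<^sup>2 * exp (- a) / theta a 0"
proof -
  note r = sech_coeff_bounds[OF a]
  define p where "p M = (\<Sum>n<M. sech_coeff a n / (1 + sech_coeff a n))" for M
  define k where "k = 4 * a\<^sup>2 * exp (- a) / theta a 0"
  have T0: "0 < theta a 0" by (rule theta_pos[OF a])
  have k0: "0 < k" using a T0 by (simp add: k_def)
  \<comment> \<open>Only the first \<open>N\<close> of the \<open>M\<close> factors are kept in the
    exponent, so \<open>N\<close> stays fixed while \<open>M\<close> tends to infinity.\<close>
  have up: "theta a u \<le> theta a 0 * exp (- (1 - cos (2 * pi * u)) * p N)" for u
  proof -
    define c where "c = cos (2 * pi * u)"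
    have c: "-1 \<le> c" "c \<le> 1" by (auto simp: c_def)
    have "theta a u / theta a (1 / 4) \<le> theta a 0 / theta a (1 / 4) * exp (- (1 - c) * p N)"
    proof (rule tendsto_le)
      show "(\<lambda>M. lin_prod (sech_coeff a) M c) \<longlonglongrightarrow> theta a u / theta a (1 / 4)"
        unfolding c_def by (rule theta_product[OF a])
      show "(\<lambda>M. lin_prod (sech_coeff a) M 1 * exp (- (1 - c) * p N)) \<longlonglongrightarrow> theta a 0 / theta a (1 / 4) * exp (- (1 - c) * p N)"
        using theta_product[OF a, of 0] by (intro tendsto_intros) simp
      show "\<forall>\<^sub>F M in sequentially. lin_prod (sech_coeff a) M c \<le> lin_prod (sech_coeff a) M 1 * exp (- (1 - c) * p N)"
        using eventually_ge_at_top[of N]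
      proof eventually_elim
        case (elim M)
        have "lin_prod (sech_coeff a) M (1 + - (1 - c)) \<le> lin_prod (sech_coeff a) M 1 *
            exp (- (1 - c) * (\<Sum>n<M. sech_coeff a n / (1 + sech_coeff a n * 1)))"
          using c by (intro lin_prod_le_exp r) auto
        also have "\<dots> = lin_prod (sech_coeff a) M 1 * exp (- (1 - c) * p M)" by (simp add: p_def)
        also have "\<dots> \<le> lin_prod (sech_coeff a) M 1 * exp (- (1 - c) * p N)"
        proof (intro mult_left_mono)
          have "p N \<le> p M" unfolding p_def using elim r
            by (intro sum_mono2) (auto intro!: less_imp_le divide_pos_pos add_pos_pos)
          hence "(1 - c) * p N \<le> (1 - c) * p M" using c by (intro mult_left_mono) auto
          thus "exp (- (1 - c) * p M) \<le> exp (- (1 - c) * p N)" by (simp only: exp_le_cancel_iff mult_minus_left neg_le_iff_le)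
          show "0 \<le> lin_prod (sech_coeff a) M 1" using lin_prod_pos[of "sech_coeff a" 1 M, OF r] by simp
        qed
        finally show ?case by simp
      qed
    qed simp
    thus ?thesis using theta_pos[OF a, of "1 / 4"] by (simp add: field_simps c_def)
  qed
  \<comment> \<open>Averaging over \<open>u\<close> and \<open>- u\<close> turns shifted Gaussians
    into \<open>E\<close> times hyperbolic cosines. The quadratic gain is kept only for the lattice
    points 1 and -1.\<close>
  have lo: "exp (- a * u\<^sup>2) * (theta a 0 + 4 * a\<^sup>2 * u\<^sup>2 * exp (- a)) \<le> theta a u" for u
  proof -
    define E where "E = exp (- a * u\<^sup>2)"
    define f where "f n = (exp (- a * (real n + u)\<^sup>2) + exp (- a * (real n + 1 - u)\<^sup>2)) +
       (exp (- a * (real n + - u)\<^sup>2) + exp (- a * (real n + 1 - - u)\<^sup>2))" for n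
    define g where "g n = 2 * E * (exp (- a * (real n + 0)\<^sup>2) + exp (- a * (real n + 1 - 0)\<^sup>2))" for n
    define d where "d = 2 * E * (2 * a\<^sup>2 * u\<^sup>2 * exp (- a))"
    have f: "f sums (theta a u + theta a u)"
      using sums_add[OF theta_sums[OF a, of u] theta_sums[OF a, of "- u"]] unfolding f_def theta_minus .
    have g: "g sums (2 * E * theta a 0)" unfolding g_def by (intro sums_mult theta_sums a)
    have ef: "exp (- a * (m + u)\<^sup>2) + exp (- a * (m - u)\<^sup>2) = 2 * E * exp (- a * m\<^sup>2) * cosh (2 * a * m * u)" for m
    proof -
      have "- a * (m + u)\<^sup>2 = - a * u\<^sup>2 + (- a * m\<^sup>2 + - (2 * a * m * u))"
        "- a * (m - u)\<^sup>2 = - a * u\<^sup>2 + (- a * m\<^sup>2 + 2 * a * m * u)"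
        by (simp_all add: power2_eq_square algebra_simps)
      thus ?thesis by (simp only: exp_add E_def cosh_def) (simp add: algebra_simps)
    qed
    have f2: "f n = 2 * E * exp (- a * (real n)\<^sup>2) * cosh (2 * a * real n * u) +
        2 * E * exp (- a * (real n + 1)\<^sup>2) * cosh (2 * a * (real n + 1) * u)" for n
      using ef[of "real n"] ef[of "real n + 1"] by (simp add: f_def)
    have ch: "1 + (2 * a\<^sup>2 * u\<^sup>2) \<le> cosh (2 * a * 1 * u)"
      using cosh_ge_quadratic[of "\<bar>2 * a * u\<bar>"] by (simp add: power_mult_distrib)
    \<comment> \<open>The Gaussian centred at distance 1 belongs to both pairs \<open>n = 0\<close>
      and \<open>n = 1\<close>, hence the gain \<open>d\<close> in both.\<close>
    have le: "g n + (if n \<in> {0, 1} then d else 0) \<le> f n" for n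
    proof -
      have E: "0 \<le> E" by (simp add: E_def)
      have D: "2 * E * exp (- a * m\<^sup>2) \<le> 2 * E * exp (- a * m\<^sup>2) * cosh y" for m y
        using mult_left_mono[of 1 "cosh y" "2 * E * exp (- a * m\<^sup>2)"] E cosh_real_ge_1[of y] by simp
      have D1: "2 * E * exp (- a * 1\<^sup>2) + d \<le> 2 * E * exp (- a * 1\<^sup>2) * cosh (2 * a * 1 * u)"
        using mult_left_mono[OF ch, of "2 * E * exp (- a * 1\<^sup>2)"] E by (simp add: d_def algebra_simps)
      show ?thesis
      proof (cases "n = 0 \<or> n = 1")
        case True
        thus ?thesis unfolding f2 g_def using D1 D[of 0 0] D[of 2 "2 * a * 2 * u"] by (auto simp: algebra_simps)
      next
        case False
        thus ?thesis unfolding f2 g_def using D[of "real n" "2 * a * real n * u"] D[of "real n + 1" "2 * a * (real n + 1) * u"]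
          by (auto simp: algebra_simps)
      qed
    qed
    have sg: "(\<lambda>n. g n + (if n \<in> {0, 1} then d else 0)) sums (2 * E * theta a 0 + 2 * d)"
      using sums_add[OF g sums_If_finite_set[of "{0, 1}" "\<lambda>_. d"]] by simp
    have "2 * E * theta a 0 + 2 * d \<le> theta a u + theta a u"
      by (rule sums_le[OF le sg f])
    thus ?thesis by (simp add: d_def E_def algebra_simps)
  qed
  have main: "- a + ln (1 + k * u\<^sup>2) / u\<^sup>2 \<le> - ((1 - cos (2 * pi * u)) / u\<^sup>2) * p N" if u: "0 < u" for u
  proof -
    have "exp (- a * u\<^sup>2) * (theta a 0 + 4 * a\<^sup>2 * u\<^sup>2 * exp (- a)) \<le> theta a 0 * exp (- (1 - cos (2 * pi * u)) * p N)"
      by (rule order_trans[OF lo up])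
    moreover have "theta a 0 + 4 * a\<^sup>2 * u\<^sup>2 * exp (- a) = theta a 0 * (1 + k * u\<^sup>2)"
      using T0 by (simp add: k_def field_simps)
    ultimately have "theta a 0 * (exp (- a * u\<^sup>2) * (1 + k * u\<^sup>2)) \<le> theta a 0 * exp (- (1 - cos (2 * pi * u)) * p N)"
      by (simp add: mult_ac)
    hence "exp (- a * u\<^sup>2) * (1 + k * u\<^sup>2) \<le> exp (- (1 - cos (2 * pi * u)) * p N)" using T0 by simp
    moreover have pos: "0 < 1 + k * u\<^sup>2" using k0 by (intro add_pos_nonneg) auto
    ultimately have "ln (exp (- a * u\<^sup>2) * (1 + k * u\<^sup>2)) \<le> ln (exp (- (1 - cos (2 * pi * u)) * p N))"
      by (subst ln_le_cancel_iff) auto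
    hence "- a * u\<^sup>2 + ln (1 + k * u\<^sup>2) \<le> - (1 - cos (2 * pi * u)) * p N"
      using pos by (simp add: ln_mult)
    hence "(- a * u\<^sup>2 + ln (1 + k * u\<^sup>2)) / u\<^sup>2 \<le> (- (1 - cos (2 * pi * u)) * p N) / u\<^sup>2"
      by (intro divide_right_mono) auto
    thus ?thesis using u by (simp add: field_simps)
  qed
  \<comment> \<open>Second-order coefficients at \<open>u = 0\<close> are compared by a limit,
    instead of differentiating either series.\<close>
  have "- a + k \<le> - (2 * pi\<^sup>2) * p N"
  proof (rule tendsto_le[of "at_right (0::real)"])
    have "((\<lambda>u. ln (1 + k * u\<^sup>2) / u\<^sup>2) \<longlongrightarrow> k) (at_right 0)" using k0 by real_asymp
    thus "((\<lambda>u. - a + ln (1 + k * u\<^sup>2) / u\<^sup>2) \<longlongrightarrow> - a + k) (at_right 0)" by (intro tendsto_intros)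
    have "((\<lambda>u::real. (1 - cos (2 * pi * u)) / u\<^sup>2) \<longlongrightarrow> 2 * pi\<^sup>2) (at_right 0)"
      by (real_asymp simp: power2_eq_square)
    thus "((\<lambda>u. - ((1 - cos (2 * pi * u)) / u\<^sup>2) * p N) \<longlongrightarrow> - (2 * pi\<^sup>2) * p N) (at_right 0)"
      by (intro tendsto_intros)
    show "\<forall>\<^sub>F u in at_right 0. - a + ln (1 + k * u\<^sup>2) / u\<^sup>2 \<le> - ((1 - cos (2 * pi * u)) / u\<^sup>2) * p N"
      using main by (auto simp: eventually_at_right_less intro: eventually_mono[OF eventually_at_right_less])
  qed simp
  thus ?thesis by (simp add: p_def k_def mult_ac)
qed

lemma sech_coeff_sum_gt:
  assumes b: "7 \<le> b" and s: "s < b / (4 * pi) * (exp (- b / 16) - 3 * exp (- 9 * b / 16)) / theta b (1 / 4)"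
  shows "\<forall>\<^sub>F N in sequentially. s < (\<Sum>n<N. sech_coeff b n)"
proof -
  have b0: "0 < b" using b by simp
  note r = sech_coeff_bounds[OF b0]
  define U where "U = theta b (1 / 4)"
  \<comment> \<open>The pair \<open>n = 0\<close> of the series for minus the derivative at
    \<open>1 / 4\<close>, up to the factor \<open>2 * b\<close>.\<close>
  define k where "k = 1 / 4 * exp (- b / 16) - 3 / 4 * exp (- 9 * b / 16)"
  have U: "0 < U" unfolding U_def by (rule theta_pos[OF b0])
  \<comment> \<open>A first-order lower bound for each Gaussian replaces termwise
    differentiation.\<close>
  have E: "exp (- b * m\<^sup>2) * (1 + 2 * b * m * h - b * h\<^sup>2) \<le> exp (- b * (m - h)\<^sup>2)" for m h
  proof -
    have "exp (- b * m\<^sup>2) * (1 + (2 * b * m * h - b * h\<^sup>2)) \<le> exp (- b * m\<^sup>2) * exp (2 * b * m * h - b * h\<^sup>2)"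
      by (intro mult_left_mono exp_ge_add_one_self) auto
    also have "\<dots> = exp (- b * (m - h)\<^sup>2)" unfolding exp_add[symmetric]
      by (rule arg_cong[of _ _ exp]) (simp add: power2_eq_square algebra_simps)
    finally show ?thesis by (simp add: algebra_simps)
  qed
  \<comment> \<open>All further pairs contribute nonnegatively: the ratio of the weights is at most
    3, attained at \<open>n = 0\<close>, and the Gaussians outweigh it.\<close>
  have pair: "(real n + 3 / 4) * exp (- b * (real n + 3 / 4)\<^sup>2) \<le> (real n + 1 / 4) * exp (- b * (real n + 1 / 4)\<^sup>2)" for n
  proof -
    have "3 \<le> 1 + b * (real n + 1 / 2)" using b mult_mono[of 7 b "1 / 2" "real n + 1 / 2"] by simp
    also have "\<dots> \<le> exp (b * (real n + 1 / 2))" by (rule exp_ge_add_one_self)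
    finally have "(real n + 1 / 4) * 3 \<le> (real n + 1 / 4) * exp (b * (real n + 1 / 2))"
      by (intro mult_left_mono) auto
    moreover have "real n + 3 / 4 \<le> (real n + 1 / 4) * 3" by simp
    ultimately have "real n + 3 / 4 \<le> (real n + 1 / 4) * exp (b * (real n + 1 / 2))" by (rule order_trans[rotated])
    hence "(real n + 3 / 4) * exp (- b * (real n + 3 / 4)\<^sup>2) \<le>
      (real n + 1 / 4) * exp (b * (real n + 1 / 2)) * exp (- b * (real n + 3 / 4)\<^sup>2)"
      by (intro mult_right_mono) auto
    also have "\<dots> = (real n + 1 / 4) * exp (- b * (real n + 1 / 4)\<^sup>2)"
      unfolding mult.assoc exp_add[symmetric] by (simp add: power2_eq_square algebra_simps)
    finally show ?thesis .
  qed
  have lo: "U * (1 - b * h\<^sup>2) + 2 * b * h * k \<le> theta b (1 / 4 - h)" if h: "0 \<le> h" for h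
  proof -
    define f where "f n = exp (- b * (real n + (1 / 4 - h))\<^sup>2) + exp (- b * (real n + 1 - (1 / 4 - h))\<^sup>2)" for n
    define g where "g n = (exp (- b * (real n + 1 / 4)\<^sup>2) + exp (- b * (real n + 1 - 1 / 4)\<^sup>2)) * (1 - b * h\<^sup>2)" for n
    have f: "f sums theta b (1 / 4 - h)" unfolding f_def by (rule theta_sums[OF b0])
    have g: "g sums (U * (1 - b * h\<^sup>2))" unfolding g_def U_def by (intro sums_mult2 theta_sums b0)
    define d where "d n = 2 * b * h * ((real n + 1 / 4) * exp (- b * (real n + 1 / 4)\<^sup>2) -
        (real n + 3 / 4) * exp (- b * (real n + 3 / 4)\<^sup>2))" for n
    have fg: "g n + d n \<le> f n" for n
    proof -
      have e: "real n + 1 - 1 / 4 = real n + 3 / 4" "real n + 1 - (1 / 4 - h) = real n + 3 / 4 - (- h)"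
        "real n + (1 / 4 - h) = real n + 1 / 4 - h" by simp_all
      show ?thesis unfolding f_def g_def d_def e
        using E[of "real n + 1 / 4" h] E[of "real n + 3 / 4" "- h"] by (simp add: algebra_simps)
    qed
    have d0: "d 0 = 2 * b * h * k" by (simp add: d_def k_def power2_eq_square)
    have dn: "0 \<le> d n" for n unfolding d_def using pair[of n] h b0 by (intro mult_nonneg_nonneg) auto
    have le: "g n + (if n \<in> {0} then 2 * b * h * k else 0) \<le> f n" for n
      using fg[of n] dn[of n] d0 by (cases "n = 0") auto
    have sg: "(\<lambda>n. g n + (if n \<in> {0} then 2 * b * h * k else 0)) sums (U * (1 - b * h\<^sup>2) + 2 * b * h * k)"
      using sums_add[OF g sums_If_finite_set[of "{0}" "\<lambda>_. 2 * b * h * k"]] by simp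
    show ?thesis by (rule sums_le[OF le sg f])
  qed
  \<comment> \<open>The limit is the quotient of the derivatives at \<open>h = 0\<close>. As
    \<open>s\<close> lies strictly below it, one small positive \<open>h\<close> suffices for the
    rest.\<close>
  have "((\<lambda>h. ln (1 - b * h\<^sup>2 + (2 * b * k / U) * h) / sin (2 * pi * h)) \<longlongrightarrow> b * (k * inverse pi) / U) (at_right 0)"
    by real_asymp
  moreover have "b * (k * inverse pi) / U = b / (4 * pi) * (exp (- b / 16) - 3 * exp (- 9 * b / 16)) / theta b (1 / 4)"
    using U by (simp add: k_def U_def field_simps)
  ultimately have "\<forall>\<^sub>F h in at_right 0. s < ln (1 - b * h\<^sup>2 + (2 * b * k / U) * h) / sin (2 * pi * h)"
    using s by (intro order_tendstoD) auto
  moreover have "((\<lambda>h. 1 - b * h\<^sup>2 + (2 * b * k / U) * h) \<longlongrightarrow> 1) (at_right 0)"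
    using U by (auto intro!: tendsto_eq_intros)
  hence "\<forall>\<^sub>F h in at_right 0. 0 < 1 - b * h\<^sup>2 + (2 * b * k / U) * h" by (rule order_tendstoD) simp
  moreover have "\<forall>\<^sub>F h in at_right (0::real). h \<in> {0<..<1 / 4}" by (rule eventually_at_right_real) simp
  ultimately have "\<forall>\<^sub>F h in at_right 0. s < ln (1 - b * h\<^sup>2 + (2 * b * k / U) * h) / sin (2 * pi * h) \<and>
     0 < 1 - b * h\<^sup>2 + (2 * b * k / U) * h \<and> h \<in> {0<..<1 / 4}" by eventually_elim auto
  then obtain h where h: "s < ln (1 - b * h\<^sup>2 + (2 * b * k / U) * h) / sin (2 * pi * h)"
    "0 < 1 - b * h\<^sup>2 + (2 * b * k / U) * h" "0 < h" "h < 1 / 4"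
    using eventually_happens'[OF trivial_limit_at_right_real] by fastforce
  have sp: "0 < sin (2 * pi * h)" using h by (intro sin_gt_zero) auto
  have "s * sin (2 * pi * h) < ln (1 - b * h\<^sup>2 + (2 * b * k / U) * h)"
    using h(1) sp by (simp add: pos_less_divide_eq)
  hence "exp (s * sin (2 * pi * h)) < 1 - b * h\<^sup>2 + (2 * b * k / U) * h"
    using h(2) by (metis exp_less_cancel_iff exp_ln)
  also have "\<dots> = (U * (1 - b * h\<^sup>2) + 2 * b * h * k) / U" using U by (simp add: field_simps)
  also have "\<dots> \<le> theta b (1 / 4 - h) / U" using lo[of h] h U by (intro divide_right_mono) auto
  finally have lt: "exp (s * sin (2 * pi * h)) < theta b (1 / 4 - h) / U" .
  have "cos (2 * pi * (1 / 4 - h)) = sin (2 * pi * h)"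
    unfolding sin_cos_eq by (rule arg_cong[of _ _ cos]) (simp add: algebra_simps)
  hence "(\<lambda>N. lin_prod (sech_coeff b) N (sin (2 * pi * h))) \<longlonglongrightarrow> theta b (1 / 4 - h) / U"
    using theta_product[OF b0, of "1 / 4 - h"] by (simp add: U_def)
  hence "\<forall>\<^sub>F N in sequentially. exp (s * sin (2 * pi * h)) < lin_prod (sech_coeff b) N (sin (2 * pi * h))"
    using lt by (rule order_tendstoD)
  thus ?thesis
  proof eventually_elim
    case (elim N)
    have "lin_prod (sech_coeff b) N (0 + sin (2 * pi * h)) \<le> lin_prod (sech_coeff b) N 0 *
       exp (sin (2 * pi * h) * (\<Sum>n<N. sech_coeff b n / (1 + sech_coeff b n * 0)))"
      using sp by (intro lin_prod_le_exp r) auto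
    also have "\<dots> = exp (sin (2 * pi * h) * (\<Sum>n<N. sech_coeff b n))" by (simp add: lin_prod_def)
    finally have "lin_prod (sech_coeff b) N (sin (2 * pi * h)) \<le> exp (sin (2 * pi * h) * (\<Sum>n<N. sech_coeff b n))"
      by simp
    with elim have "exp (s * sin (2 * pi * h)) < exp (sin (2 * pi * h) * (\<Sum>n<N. sech_coeff b n))"
      by (rule less_le_trans)
    hence "sin (2 * pi * h) * s < sin (2 * pi * h) * (\<Sum>n<N. sech_coeff b n)" by (simp add: mult.commute)
    thus ?case using sp by simp
  qed
qed

text \<open>After the first pair the terms decay at least geometrically with ratio exp(-3a), because
  (w + n)^2 is at least w^2 + 3n for w at least 1. The factor 1 + 2x bounds 1 / (1 - x) for x up to
  1/2.\<close>

lemma theta_upper: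
  assumes a: "1 \<le> a" and u: "0 \<le> u" "u \<le> 1"
  shows "theta a u \<le> exp (- a * u\<^sup>2) + exp (- a * (1 - u)\<^sup>2) +
    (1 + 2 * exp (- 3 * a)) * (exp (- a * (1 + u)\<^sup>2) + exp (- a * (2 - u)\<^sup>2))"
proof -
  define f where "f n = exp (- a * (real n + u)\<^sup>2) + exp (- a * (real n + 1 - u)\<^sup>2)" for n
  define x where "x = exp (- 3 * a)"
  define c where "c = exp (- a * (1 + u)\<^sup>2) + exp (- a * (2 - u)\<^sup>2)"
  have x: "0 < x" "x \<le> 1 / 2"
  proof -
    show "0 < x" by (simp add: x_def)
    have "2 \<le> exp (3 * a)" using exp_ge_add_one_self[of "3 * a"] a by linarith
    thus "x \<le> 1 / 2" by (simp add: x_def exp_minus field_simps)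
  qed
  have f: "f sums theta a u" unfolding f_def using a by (intro theta_sums) auto
  have f1: "(\<lambda>n. f (Suc n)) sums (theta a u - f 0)" using f by (simp add: sums_Suc_iff)
  have le: "f (Suc n) \<le> c * x ^ n" for n
  proof -
    have sq: "- a * (w + real n)\<^sup>2 \<le> - a * w\<^sup>2 + real n * (- 3 * a)" if w: "1 \<le> w" for w
    proof -
      have n2: "real n \<le> real n * real n" by (cases n) (auto simp: algebra_simps)
      have "real n * 1 \<le> real n * w" using w by (intro mult_left_mono) auto
      moreover have "(w + real n)\<^sup>2 = w\<^sup>2 + 2 * (real n * w) + real n * real n"
        by (simp add: power2_eq_square algebra_simps)
      ultimately have "w\<^sup>2 + 3 * real n \<le> (w + real n)\<^sup>2" using n2 by linarith
      hence "a * (w\<^sup>2 + 3 * real n) \<le> a * (w + real n)\<^sup>2" using a by (intro mult_left_mono) auto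
      thus ?thesis by (simp add: algebra_simps)
    qed
    have e: "real (Suc n) + u = (1 + u) + real n" "real (Suc n) + 1 - u = (2 - u) + real n" by simp_all
    have "exp (- a * ((1 + u) + real n)\<^sup>2) \<le> exp (- a * (1 + u)\<^sup>2) * x ^ n"
      unfolding x_def exp_of_nat_mult[symmetric] exp_add[symmetric] by (subst exp_le_cancel_iff, rule sq) (use u in simp)
    moreover have "exp (- a * ((2 - u) + real n)\<^sup>2) \<le> exp (- a * (2 - u)\<^sup>2) * x ^ n"
      unfolding x_def exp_of_nat_mult[symmetric] exp_add[symmetric] by (subst exp_le_cancel_iff, rule sq) (use u in simp)
    ultimately show ?thesis unfolding f_def e c_def distrib_right by (rule add_mono)
  qed
  have "(\<lambda>n. c * x ^ n) sums (c * (1 / (1 - x)))"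
    using x by (intro sums_mult geometric_sums) auto
  hence "theta a u - f 0 \<le> c * (1 / (1 - x))" by (rule sums_le[OF le f1])
  also have "\<dots> \<le> c * (1 + 2 * x)"
  proof (intro mult_left_mono)
    have "0 \<le> x * (1 - 2 * x)" using x by (intro mult_nonneg_nonneg) auto
    hence "1 \<le> (1 + 2 * x) * (1 - x)" by (simp add: algebra_simps)
    thus "1 / (1 - x) \<le> 1 + 2 * x" using x by (simp add: pos_divide_le_eq)
  qed (simp add: c_def)
  finally show ?thesis by (simp add: f_def x_def c_def mult.commute)
qed

lemma theta_lower:
  assumes "0 < a"
  shows "exp (- a * u\<^sup>2) + exp (- a * (1 - u)\<^sup>2) \<le> theta a u"
    and "1 + 2 * exp (- a) \<le> theta a 0"
proof -
  define f where "f u n = exp (- a * (real n + u)\<^sup>2) + exp (- a * (real n + 1 - u)\<^sup>2)" for u n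
  have f: "f u sums theta a u" for u unfolding f_def using assms by (rule theta_sums)
  have fn: "0 \<le> f u n" for u n by (simp add: f_def)
  have "sum (f u) {..<1} \<le> theta a u"
    using sum_le_suminf[OF sums_summable[OF f], of "{..<1}"] fn f by (simp add: sums_iff)
  thus "exp (- a * u\<^sup>2) + exp (- a * (1 - u)\<^sup>2) \<le> theta a u" by (simp add: f_def)
  \<comment> \<open>The two Gaussians at distance 1 from 0 lie in different pairs, so two pairs are
    needed.\<close>
  have "sum (f 0) {..<2} \<le> theta a 0"
    using sum_le_suminf[OF sums_summable[OF f], of "{..<2}"] fn f by (simp add: sums_iff)
  moreover have "sum (f 0) {..<2} = f 0 0 + f 0 1" by (simp add: numeral_2_eq_2)
  moreover have "f 0 0 = 1 + exp (- a)" "f 0 1 \<ge> exp (- a)" by (simp_all add: f_def)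
  ultimately show "1 + 2 * exp (- a) \<le> theta a 0" by linarith
qed

text \<open>Here \<open>E\<close> stands for exp(-a/3), \<open>k\<close> for 1/pi, and
  \<open>X\<close>, \<open>Y\<close>, \<open>Z\<close>, \<open>T\<close> for theta values divided by
  their leading Gaussians. The leading gap is \<open>a * \<kappa>\<close> with \<kappa> = k (1/3 -
  k), about 0.0048. It must absorb the loss \<open>E\<^sup>2 * (1 + a * k)\<close>, with help from
  the gain \<open>E ^ 3 * p\<close>; all else is pushed into one error of size
  \<open>E ^ 3 * (3 / 10)\<close>.\<close>

lemma theta_bounds_inequality:
  fixes a E k X Y Z T :: real
  assumes a: "21 / 4 \<le> a" and E: "0 < E" "E ^ 3 \<le> 1 / 100" "a * E ^ 3 \<le> 1"
    and k: "0.31830 \<le> k" "k \<le> 0.31832"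
    and X: "1 \<le> X" "X \<le> 1 + 2 * E ^ 8" and Y: "1 \<le> Y" "Y \<le> 1 + 2 * E ^ 6"
    and T: "1 + 2 * E ^ 3 \<le> T" "T \<le> 1 + 2 * E ^ 3 + 5 * E ^ 12"
    and Z: "Z \<le> 1 + E\<^sup>2 + 4 * E ^ 6"
  shows "Y * (Z - a * k / 3 * (1 - 3 * E\<^sup>2)) < X * (T * (1 - a * k\<^sup>2) + 4 * a\<^sup>2 * E ^ 3 * k\<^sup>2)"
proof -
  have a0: "0 < a" using a by simp
  have E1: "E \<le> 3 / 10"
  proof (rule ccontr)
    assume "\<not> E \<le> 3 / 10"
    hence "(3 / 10) ^ 3 \<le> E ^ 3" by (intro power_mono) auto
    thus False using E(2) by (simp add: power_divide)
  qed
  have E2: "E\<^sup>2 \<le> 1 / 10"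
    using power_mono[OF E1, of 2] E by (simp add: power_divide)
  have ks: "k\<^sup>2 \<le> 1 / 9" "0.1013148 \<le> k\<^sup>2" "k\<^sup>2 \<le> 0.1013277"
    using mult_mono[of k "0.31832" k "0.31832"] mult_mono[of "0.31830" k "0.31830" k] k by (auto simp: power2_eq_square)
  define l where "l = T * (1 - a * k\<^sup>2) + 4 * a\<^sup>2 * E ^ 3 * k\<^sup>2"
  define l0 where "l0 = (1 + 2 * E ^ 3) * (1 - a * k\<^sup>2) + 4 * a\<^sup>2 * E ^ 3 * k\<^sup>2 - E ^ 12 * a"
  define \<rho> where "\<rho> = Z - a * k / 3 * (1 - 3 * E\<^sup>2)"
  define \<rho>0 where "\<rho>0 = 1 + E\<^sup>2 + 4 * E ^ 6 - a * k / 3 * (1 - 3 * E\<^sup>2)"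
  have E6: "E ^ 6 = E ^ 3 * E ^ 3" "E ^ 8 = E ^ 3 * (E ^ 3 * E\<^sup>2)" "E ^ 12 = E ^ 3 * (E ^ 3 * E ^ 6)"
    by (simp_all flip: power_add)
  have E6s: "E ^ 6 \<le> 1 / 100" using mult_mono[OF E(2) E(2)] E unfolding E6 by simp
  have E12s: "E ^ 12 \<le> 1 / 100"
    using mult_mono[of "E ^ 6" "1 / 100" "E ^ 6" "1 / 100"] E6s E by (simp flip: power_add)
  have ll: "l0 \<le> l"
  proof -
    have d: "0 \<le> T - (1 + 2 * E ^ 3)" "T - (1 + 2 * E ^ 3) \<le> 5 * E ^ 12" using T by auto
    have "- (E ^ 12 * a) \<le> (T - (1 + 2 * E ^ 3)) * (1 - a * k\<^sup>2)"
    proof (cases "0 \<le> 1 - a * k\<^sup>2")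
      case True
      hence "0 \<le> (T - (1 + 2 * E ^ 3)) * (1 - a * k\<^sup>2)" using d by simp
      moreover have "0 \<le> E ^ 12 * a" using E a0 by simp
      ultimately show ?thesis by linarith
    next
      case False
      have "(T - (1 + 2 * E ^ 3)) * (a * k\<^sup>2 - 1) \<le> (5 * E ^ 12) * (a * k\<^sup>2 - 1)"
        using d False by (intro mult_right_mono) auto
      also have "\<dots> \<le> (5 * E ^ 12) * (a * (1 / 9))"
      proof (intro mult_left_mono)
        have "a * k\<^sup>2 \<le> a * (1 / 9)" using ks a0 by (intro mult_left_mono) auto
        thus "a * k\<^sup>2 - 1 \<le> a * (1 / 9)" by linarith
      qed (use E in auto)
      also have "\<dots> \<le> E ^ 12 * a" using E a0 by simp
      finally show ?thesis by (simp add: algebra_simps)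
    qed
    thus ?thesis by (simp add: l_def l0_def algebra_simps)
  qed
  \<comment> \<open>For large \<open>a\<close> the factor \<open>l\<close> is negative, and then
    \<open>X\<close> above 1 works in the wrong direction; the term \<open>a * E ^ 8\<close> pays
    for it.\<close>
  have Xl: "l - a * E ^ 8 \<le> X * l"
  proof (cases "0 \<le> l")
    case True
    hence "1 * l \<le> X * l" using X by (intro mult_right_mono) auto
    moreover have "0 \<le> a * E ^ 8" using E a0 by simp
    ultimately show ?thesis by linarith
  next
    case False
    have "0 \<le> E ^ 3" using E by simp
    hence T2: "0 \<le> T" "T \<le> 2" using T E(2) E12s by linarith+
    have "0 \<le> 4 * a\<^sup>2 * E ^ 3 * k\<^sup>2" using E by simp
    moreover have "T * (a * k\<^sup>2) \<le> 2 * (a * (1 / 9))"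
      using T2 ks a0 by (intro mult_mono mult_left_mono) auto
    moreover have "- (T * (a * k\<^sup>2)) \<le> T * (1 - a * k\<^sup>2)" using T2 by (simp add: algebra_simps)
    ultimately have "- (a / 2) \<le> l" unfolding l_def using a0 by linarith
    hence "2 * E ^ 8 * (- l) \<le> 2 * E ^ 8 * (a / 2)" using E by (intro mult_left_mono) auto
    moreover have "(X - 1) * (- l) \<le> 2 * E ^ 8 * (- l)" using X False by (intro mult_right_mono) auto
    ultimately show ?thesis by (simp add: algebra_simps)
  qed
  have Y\<rho>: "Y * \<rho> \<le> \<rho> + 4 * E ^ 6"
  proof (cases "0 \<le> \<rho>")
    case False
    hence "Y * \<rho> \<le> 1 * \<rho>" using Y by (intro mult_right_mono_neg) auto
    moreover have "0 \<le> E ^ 6" using E by simp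
    ultimately show ?thesis by linarith
  next
    case True
    have "0 \<le> a * k / 3 * (1 - 3 * E\<^sup>2)" using a0 k E2 by (intro mult_nonneg_nonneg) auto
    hence "\<rho> \<le> 2" unfolding \<rho>_def using Z E2 E6s by linarith
    have "(Y - 1) * \<rho> \<le> (2 * E ^ 6) * 2"
      using Y \<open>\<rho> \<le> 2\<close> True E by (intro mult_mono) auto
    thus ?thesis by (simp add: algebra_simps)
  qed
  have \<rho>0: "\<rho> \<le> \<rho>0" using Z by (simp add: \<rho>_def \<rho>0_def)
  define \<kappa> where "\<kappa> = k * (1 / 3 - k)"
  have \<kappa>: "0.004777 \<le> \<kappa>" "\<kappa> \<le> 0.004787"
  proof -
    have "0.3183 * 0.01501 \<le> \<kappa>" unfolding \<kappa>_def by (rule mult_mono) (use k in auto)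
    thus "0.004777 \<le> \<kappa>" by simp
    have "\<kappa> \<le> 0.31832 * 0.0150334" unfolding \<kappa>_def by (rule mult_mono) (use k in auto)
    thus "\<kappa> \<le> 0.004787" by simp
  qed
  have small: "8 * E ^ 6 + a * E ^ 8 + a * E ^ 12 \<le> E ^ 3 * (3 / 10)"
  proof -
    have "a * E ^ 3 * E\<^sup>2 \<le> 1 * (1 / 10)" using E(3) E2 E a0 by (intro mult_mono) auto
    moreover have "a * E ^ 3 * E ^ 6 \<le> 1 * (1 / 100)" using E(3) E6s E a0 by (intro mult_mono) auto
    ultimately have "8 * E ^ 3 + a * E ^ 3 * E\<^sup>2 + a * E ^ 3 * E ^ 6 \<le> 3 / 10" using E(2) by linarith
    hence "E ^ 3 * (8 * E ^ 3 + a * E ^ 3 * E\<^sup>2 + a * E ^ 3 * E ^ 6) \<le> E ^ 3 * (3 / 10)"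
      using E by (intro mult_left_mono) auto
    moreover have "8 * E ^ 6 + a * E ^ 8 + a * E ^ 12 = E ^ 3 * (8 * E ^ 3 + a * E ^ 3 * E\<^sup>2 + a * E ^ 3 * E ^ 6)"
      unfolding E6 by (simp add: algebra_simps)
    ultimately show ?thesis by simp
  qed
  \<comment> \<open>Tangent line to the cube of \<open>1 / E\<close> at \<open>6\<close>, multiplied by the cube of \<open>E\<close>.\<close>
  have "0 \<le> (1 - 6 * E)\<^sup>2 * (1 + 12 * E)" using E by simp
  hence "108 * E\<^sup>2 - 432 * E ^ 3 \<le> 1" by (simp add: power2_eq_square power3_eq_cube algebra_simps)
  hence tan: "a * \<kappa> * (108 * E\<^sup>2 - 432 * E ^ 3) \<le> a * \<kappa> * 1"
    using a0 \<kappa> by (intro mult_left_mono) auto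
  define p where "p = 2 - 2 * a * k\<^sup>2 + 4 * a\<^sup>2 * k\<^sup>2"
  \<comment> \<open>With these bounds for \<open>k\<close> this holds from about a = 5.07 on, which
    is one side of the choice of 21/4.\<close>
  have c1: "0 \<le> 108 * (a * \<kappa>) - (1 + a * k)"
  proof -
    have "a * (4777 / 1000000) \<le> a * \<kappa>" "a * k \<le> a * (31832 / 100000)" using \<kappa> k a0 by (auto intro!: mult_left_mono)
    thus ?thesis using a by linarith
  qed
  have c2: "0 < p - 432 * (a * \<kappa>) - 3 / 10"
  proof -
    \<comment> \<open>Tangent line to the square at 6, to make the estimate linear in
      \<open>a\<close>.\<close>
    have "0 \<le> (a - 6) * (a - 6)" by simp
    hence "12 * a - 36 \<le> a * a" by (simp add: algebra_simps)
    hence "4 * (12 * a - 36) * (1013148 / 10000000) \<le> 4 * (a * a) * k\<^sup>2"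
      using ks a by (intro mult_mono mult_left_mono) auto
    hence "48631104 / 10000000 * a - 145893312 / 10000000 \<le> 4 * (a * a) * k\<^sup>2"
      by (simp add: algebra_simps)
    moreover have "a * k\<^sup>2 \<le> a * (1013277 / 10000000)" using ks a0 by (intro mult_left_mono) auto
    moreover have "a * \<kappa> \<le> a * (4787 / 1000000)" using \<kappa> a0 by (intro mult_left_mono) auto
    ultimately show ?thesis using a unfolding p_def power2_eq_square[of a] mult.assoc by linarith
  qed
  have "0 \<le> E\<^sup>2 * (108 * (a * \<kappa>) - (1 + a * k))" using c1 by simp
  moreover have "0 < E ^ 3 * (p - 432 * (a * \<kappa>) - 3 / 10)" using c2 E by simp
  ultimately have "0 < a * \<kappa> + E ^ 3 * p - E\<^sup>2 * (1 + a * k) - E ^ 3 * (3 / 10)"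
    using tan by (simp add: algebra_simps)
  hence "0 < a * \<kappa> + E ^ 3 * p - E\<^sup>2 * (1 + a * k) - (8 * E ^ 6 + a * E ^ 8 + a * E ^ 12)"
    using small by linarith
  also have "\<dots> = l0 - a * E ^ 8 - (\<rho>0 + 4 * E ^ 6)"
    by (simp add: l0_def \<rho>0_def \<kappa>_def p_def algebra_simps power2_eq_square)
  finally have "Y * \<rho> < X * l" using ll Xl Y\<rho> \<rho>0 by linarith
  thus ?thesis by (simp add: l_def \<rho>_def)
qed

text \<open>The critical inequality in the limit, cleared of denominators, with both sums replaced
  by their estimates from the logarithmic derivatives: \<Sum> w from above, \<Sum> \<rho> from
  below.\<close>

lemma lin_prod_limit_inequality:
  assumes a: "21 / 4 \<le> a"
  defines "b \<equiv> 4 * a / 3"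
  shows "theta a (1 / 2) * (theta b (1 / 4) - b / (4 * pi) * (exp (- b / 16) - 3 * exp (- 9 * b / 16)))
    < theta b (1 / 2) * (theta a 0 * (1 - (a - 4 * a\<^sup>2 * exp (- a) / theta a 0) / pi\<^sup>2))"
proof -
  define E where "E = exp (- a / 3)"
  define D where "D = exp (- a / 12)"
  define C where "C = exp (- a / 4)"
  have pos: "0 < E" "0 < D" "0 < C" by (auto simp: E_def D_def C_def)
  have b7: "7 \<le> b" using a by (simp add: b_def)
  have Epow: "E ^ n = exp (- (real n * a / 3))" for n by (simp add: E_def flip: exp_of_nat_mult)
  have CD: "C * D = E" by (simp add: C_def D_def E_def flip: exp_add)
  have E3: "E ^ 3 = exp (- a)" by (simp add: Epow)
  have ea: "100 \<le> exp a" "a \<le> exp a"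
  proof -
    have "(5 / 2) ^ 5 \<le> exp (1 :: real) ^ 5"
      using exp_lower_Taylor_quadratic[of 1] by (intro power_mono) auto
    also have "exp (1::real) ^ 5 = exp 5" by (simp flip: exp_of_nat_mult)
    also have "1 \<le> exp (a - 5)" using exp_ge_add_one_self[of "a - 5"] a by linarith
    hence "exp 5 * 1 \<le> exp 5 * exp (a - 5)" by (intro mult_left_mono) auto
    hence "exp (5::real) \<le> exp a" by (simp flip: exp_add)
    finally have 1: "(5 / 2) ^ 5 \<le> exp a" .
    have 2: "1 + (a / 2) \<le> exp (a / 2)" by (rule exp_ge_add_one_self)
    show "a \<le> exp a" using exp_ge_add_one_self[of a] by linarith
    have "exp (1/4::real) \<ge> 1 + 1/4" by (rule exp_ge_add_one_self)
    have "(5 / 2) ^ 5 * (5 / 4) \<le> exp 5 * exp (1/4::real)"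
      using \<open>(5 / 2) ^ 5 \<le> exp (1 :: real) ^ 5\<close> \<open>exp (1 :: real) ^ 5 = exp 5\<close> \<open>exp (1/4::real) \<ge> 1 + 1/4\<close>
      by (intro mult_mono) auto
    also have "\<dots> = exp (21 / 4)" by (simp flip: exp_add)
    also have "\<dots> \<le> exp a" using a by simp
    finally show "100 \<le> exp a" by (simp add: power_divide)
  qed
  have k: "0.31830 \<le> 1 / pi" "1 / pi \<le> 0.31832" using pi_bounds by (auto simp: field_simps)
  \<comment> \<open>The leading Gaussians of the two sides are \<open>2 * C * D\<close> and
    \<open>2 * E\<close>; they coincide by \<open>CD\<close> and cancel.\<close>
  define X Y Z T where "X = theta b (1 / 2) / (2 * E)" and "Y = theta a (1 / 2) / (2 * C)"
    and "Z = theta b (1 / 4) / D" and "T = theta a 0"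
  have q: "exp (- b * (1 / 2)\<^sup>2) = E" "exp (- b * (1 - 1 / 2)\<^sup>2) = E"
    "exp (- a * (1 / 2)\<^sup>2) = C" "exp (- a * (1 - 1 / 2)\<^sup>2) = C"
    by (simp_all add: b_def E_def C_def power2_eq_square)
  have E9: "2 * exp (- 3 * a) \<le> 1" "2 * exp (- 3 * b) \<le> 1"
  proof -
    have "2 * exp (- 3 * x) \<le> 1" if "1 \<le> x" for x :: real
    proof -
      have "2 \<le> exp (3 * x)" using exp_ge_add_one_self[of "3 * x"] that by linarith
      thus ?thesis by (simp add: exp_minus field_simps)
    qed
    thus "2 * exp (- 3 * a) \<le> 1" "2 * exp (- 3 * b) \<le> 1" using a b7 by auto
  qed
  have main: "Y * (Z - a * (1 / pi) / 3 * (1 - 3 * E\<^sup>2)) < X * (T * (1 - a * (1 / pi)\<^sup>2) + 4 * a\<^sup>2 * E ^ 3 * (1 / pi)\<^sup>2)"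
  proof (rule theta_bounds_inequality[OF a])
    show "0 < E" "0.31830 \<le> 1 / pi" "1 / pi \<le> 0.31832" by fact+
    show "E ^ 3 \<le> 1 / 100" "a * E ^ 3 \<le> 1" using ea unfolding E3 by (auto simp: exp_minus field_simps)
    have "2 * E \<le> theta b (1 / 2)" using theta_lower(1)[of b "1 / 2"] b7 unfolding q by simp
    thus "1 \<le> X" using pos by (simp add: X_def)
    have "2 * C \<le> theta a (1 / 2)" using theta_lower(1)[of a "1 / 2"] a unfolding q by simp
    thus "1 \<le> Y" using pos by (simp add: Y_def)
    have e: "exp (- b * (1 + 1 / 2)\<^sup>2) = E * E ^ 8" "exp (- b * (2 - 1 / 2)\<^sup>2) = E * E ^ 8"
      unfolding Epow by (simp_all add: E_def b_def power2_eq_square flip: exp_add)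
    have "theta b (1 / 2) \<le> 2 * E + (1 + 2 * exp (- 3 * b)) * (2 * (E * E ^ 8))"
      using theta_upper[of b "1 / 2"] b7 unfolding q e by simp
    also have "\<dots> \<le> 2 * E + 2 * (2 * (E * E ^ 8))"
      using E9 pos by (intro add_left_mono mult_right_mono) auto
    finally show "X \<le> 1 + 2 * E ^ 8" using pos by (simp add: X_def pos_divide_le_eq algebra_simps)
    have e: "exp (- a * (1 + 1 / 2)\<^sup>2) = C * E ^ 6" "exp (- a * (2 - 1 / 2)\<^sup>2) = C * E ^ 6"
      unfolding Epow by (simp_all add: C_def power2_eq_square flip: exp_add)
    have "theta a (1 / 2) \<le> 2 * C + (1 + 2 * exp (- 3 * a)) * (2 * (C * E ^ 6))"
      using theta_upper[of a "1 / 2"] a unfolding q e by simp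
    also have "\<dots> \<le> 2 * C + 2 * (2 * (C * E ^ 6))"
      using E9 pos by (intro add_left_mono mult_right_mono) auto
    finally show "Y \<le> 1 + 2 * E ^ 6" using pos by (simp add: Y_def pos_divide_le_eq algebra_simps)
    show "1 + 2 * E ^ 3 \<le> T" using theta_lower(2)[of a] a unfolding T_def E3 by simp
    have e: "exp (- a * 0\<^sup>2) = 1" "exp (- a * (1 - 0)\<^sup>2) = E ^ 3" "exp (- a * (1 + 0)\<^sup>2) = E ^ 3"
      "exp (- a * (2 - 0)\<^sup>2) = E ^ 12" "exp (- 3 * a) = E ^ 9"
      unfolding Epow by simp_all
    have "T \<le> 1 + E ^ 3 + (1 + 2 * E ^ 9) * (E ^ 3 + E ^ 12)"
      using theta_upper[of a 0] a unfolding T_def e by simp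
    also have "\<dots> = 1 + 2 * E ^ 3 + 3 * E ^ 12 + 2 * E ^ 9 * E ^ 12" by (simp add: algebra_simps flip: power_add)
    also have "\<dots> \<le> 1 + 2 * E ^ 3 + 3 * E ^ 12 + 1 * E ^ 12"
      using E9 pos unfolding e by (intro add_left_mono mult_right_mono) auto
    also have "\<dots> \<le> 1 + 2 * E ^ 3 + 5 * E ^ 12" using pos by simp
    finally show "T \<le> 1 + 2 * E ^ 3 + 5 * E ^ 12" .
    have e: "exp (- b * (1 / 4)\<^sup>2) = D" "exp (- b * (1 - 1 / 4)\<^sup>2) = D * E\<^sup>2" "exp (- b * (1 + 1 / 4)\<^sup>2) = D * E ^ 6"
      "exp (- b * (2 - 1 / 4)\<^sup>2) = D * E ^ 12"
      unfolding Epow by (simp_all add: D_def b_def power2_eq_square flip: exp_add)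
    have "E \<le> 1" using a by (simp add: E_def)
    hence E12: "E ^ 12 \<le> E ^ 6" using pos by (intro power_decreasing) auto
    have "theta b (1 / 4) \<le> D + D * E\<^sup>2 + (1 + 2 * exp (- 3 * b)) * (D * E ^ 6 + D * E ^ 12)"
      using theta_upper[of b "1 / 4"] b7 unfolding e by simp
    also have "\<dots> \<le> D + D * E\<^sup>2 + 2 * (D * E ^ 6 + D * E ^ 12)"
      using E9 pos by (intro add_left_mono mult_right_mono) auto
    also have "\<dots> \<le> D + D * E\<^sup>2 + 2 * (D * E ^ 6 + D * E ^ 6)"
      using E12 pos by (intro add_left_mono mult_left_mono) auto
    finally show "Z \<le> 1 + E\<^sup>2 + 4 * E ^ 6" using pos by (simp add: Z_def pos_divide_le_eq algebra_simps)
  qed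
  have T0: "0 < T" unfolding T_def using a by (intro theta_pos) auto
  have e: "exp (- b / 16) = D" "exp (- 9 * b / 16) = D * E\<^sup>2"
    unfolding Epow by (simp_all add: D_def b_def flip: exp_add)
  have "theta a (1 / 2) * (theta b (1 / 4) - b / (4 * pi) * (exp (- b / 16) - 3 * exp (- 9 * b / 16)))
    = (2 * C * Y) * (D * Z - a * (1 / pi) / 3 * (D - 3 * (D * E\<^sup>2)))"
    unfolding e using pos by (simp add: Y_def Z_def b_def)
  also have "\<dots> = 2 * (C * D) * (Y * (Z - a * (1 / pi) / 3 * (1 - 3 * E\<^sup>2)))"
    by (simp add: algebra_simps)
  also have "\<dots> < 2 * E * (X * (T * (1 - a * (1 / pi)\<^sup>2) + 4 * a\<^sup>2 * E ^ 3 * (1 / pi)\<^sup>2))"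
    unfolding CD using main pos by (intro mult_strict_left_mono) auto
  also have "\<dots> = theta b (1 / 2) * (T * (1 - a * (1 / pi)\<^sup>2) + 4 * a\<^sup>2 * E ^ 3 * (1 / pi)\<^sup>2)"
    using pos by (simp add: X_def)
  also have "T * (1 - a * (1 / pi)\<^sup>2) + 4 * a\<^sup>2 * E ^ 3 * (1 / pi)\<^sup>2 = T * (1 - (a - 4 * a\<^sup>2 * E ^ 3 / T) / pi\<^sup>2)"
    using T0 by (simp add: field_simps)
  finally show ?thesis by (simp add: T_def E3)
qed

section \<open>The critical inequality for partial products\<close>

lemma lin_prod_condition:
  assumes a: "0 < a" and ab: "4 * a / 3 \<le> b"
  shows "\<forall>\<^sub>F N in sequentially. lin_prod (sech_coeff a) N (-1) * (1 - (\<Sum>n<N. sech_coeff b n))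
    \<le> lin_prod (sech_coeff b) N (-1) * (lin_prod (sech_coeff a) N 1 *
        (1 - 2 * (\<Sum>n<N. sech_coeff a n / (1 + sech_coeff a n))))"
proof -
  define c where "c = 4 * a / 3"
  have c: "0 < c" "c \<le> b" "0 < b" using a ab by (auto simp: c_def)
  define r v v' where "r = sech_coeff a" and "v = sech_coeff c" and "v' = sech_coeff b"
  \<comment> \<open>With this choice 1 - w_n = (1 - r_n) / (1 + r_n), so the product over
    \<open>1 - w n\<close> is the quotient of the values at -1 and 1.\<close>
  define w where "w n = 2 * (r n / (1 + r n))" for n
  have r: "0 < r n" "r n < 1" for n using sech_coeff_bounds[OF a] by (auto simp: r_def)
  have v: "0 < v n" "v n < 1" for n using sech_coeff_bounds[OF c(1)] by (auto simp: v_def)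
  have v': "0 < v' n" "v' n < 1" for n using sech_coeff_bounds[OF c(3)] by (auto simp: v'_def)
  have vv': "v n \<le> v' n" for n unfolding v_def v'_def by (rule sech_coeff_mono[OF c(1,2)])
  have w: "0 \<le> w n" "w n < 1" for n using r[of n] by (auto simp: w_def field_simps)
  have lw: "lin_prod r N (-1) = lin_prod r N 1 * (\<Prod>n<N. 1 - w n)" for N
    unfolding lin_prod_def prod.distrib[symmetric]
  proof (intro prod.cong refl)
    fix n show "1 + r n * - 1 = (1 + r n * 1) * (1 - w n)" using r[of n] by (simp add: w_def field_simps)
  qed
  have pos: "0 < lin_prod r N 1" for N by (intro lin_prod_pos r) simp
  have lv: "lin_prod \<rho> N (-1) = (\<Prod>n<N. 1 - \<rho> n)" for \<rho> N by (simp add: lin_prod_def)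
  have "\<forall>\<^sub>F N in sequentially. (\<Prod>n<N. 1 - w n) * (1 - (\<Sum>n<N. v' n)) \<le> (\<Prod>n<N. 1 - v' n) * (1 - (\<Sum>n<N. w n))"
  proof (cases "a \<le> 21 / 4")
    case True
    have "w n \<le> v' n" for n
      using half_sech_coeff_le[OF a True, of n] vv'[of n] by (simp add: w_def r_def v_def c_def)
    thus ?thesis by (intro always_eventually allI prod_sum_compare w v')
  next
    case False
    hence a5: "21 / 4 \<le> a" and c7: "7 \<le> c" by (auto simp: c_def)
    define T H U V where "T = theta a 0" and "H = theta a (1 / 2)" and "U = theta c (1 / 4)" and "V = theta c (1 / 2)"
    have th: "0 < T" "0 < H" "0 < U" "0 < V"
      using theta_pos[OF a] theta_pos[OF c(1)] by (auto simp: T_def H_def U_def V_def)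
    define W where "W = (a - 4 * a\<^sup>2 * exp (- a) / T) / pi\<^sup>2"
    define S where "S = c / (4 * pi) * (exp (- c / 16) - 3 * exp (- 9 * c / 16)) / U"
    have "H * (U - U * S) < V * (T * (1 - W))"
      using lin_prod_limit_inequality[OF a5, folded c_def] th by (simp add: H_def U_def V_def T_def S_def W_def)
    hence "H / T * (1 - S) < V / U * (1 - W)" using th by (simp add: field_simps)
    hence "1 - V / U * (1 - W) / (H / T) < S" using th by (simp add: field_simps)
    \<comment> \<open>An \<open>s\<close> strictly in between is exceeded by the partial sums
      eventually and still leaves a strict inequality between the limits of the products.\<close>
    then obtain s where s: "1 - V / U * (1 - W) / (H / T) < s" "s < S" using dense by blast
    have gap: "H / T * (1 - s) < V / U * (1 - W)" using s(1) th by (simp add: field_simps)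
    have PW: "(\<lambda>N. \<Prod>n<N. 1 - w n) \<longlonglongrightarrow> H / T"
    proof -
      have "(\<lambda>N. lin_prod r N (cos (2 * pi * (1 / 2))) / lin_prod r N (cos (2 * pi * 0))) \<longlonglongrightarrow> (H / theta a (1 / 4)) / (T / theta a (1 / 4))"
        unfolding r_def H_def T_def using th(1) theta_pos[OF a, of "1 / 4"]
        by (intro tendsto_divide theta_product a) (auto simp: T_def)
      moreover have "(H / theta a (1 / 4)) / (T / theta a (1 / 4)) = H / T"
        using theta_pos[OF a, of "1 / 4"] by simp
      moreover have "lin_prod r N (cos (2 * pi * (1 / 2))) / lin_prod r N (cos (2 * pi * 0)) = (\<Prod>n<N. 1 - w n)" for N
        using lw[of N] pos[of N] by simp
      ultimately show ?thesis by (simp only:)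
    qed
    have PV: "(\<lambda>N. \<Prod>n<N. 1 - v n) \<longlonglongrightarrow> V / U"
      using theta_product[OF c(1), of "1 / 2"] by (simp add: V_def U_def v_def lv)
    have "(\<lambda>N. (\<Prod>n<N. 1 - v n) * (1 - W) - (\<Prod>n<N. 1 - w n) * (1 - s)) \<longlonglongrightarrow> V / U * (1 - W) - H / T * (1 - s)"
      by (intro tendsto_intros PW PV)
    hence "\<forall>\<^sub>F N in sequentially. 0 < (\<Prod>n<N. 1 - v n) * (1 - W) - (\<Prod>n<N. 1 - w n) * (1 - s)"
      using gap by (intro order_tendstoD) auto
    moreover have "\<forall>\<^sub>F N in sequentially. s < (\<Sum>n<N. v n)"
      unfolding v_def using sech_coeff_sum_gt[OF c7] s(2) by (simp add: S_def U_def)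
    ultimately show ?thesis
    proof eventually_elim
      case (elim N)
      have "(\<Sum>n<N. w n) \<le> W"
      proof -
        have "(\<Sum>n<N. w n) = 2 * (\<Sum>n<N. r n / (1 + r n))" by (simp add: w_def sum_distrib_left)
        thus ?thesis using sech_coeff_quadratic_bound[OF a, of N] by (simp add: W_def r_def T_def pos_le_divide_eq)
      qed
      moreover have pw: "0 \<le> (\<Prod>n<N. 1 - w n)" using w by (intro prod_nonneg) (simp add: less_imp_le)
      moreover have pv: "0 \<le> (\<Prod>n<N. 1 - v n)" using v by (intro prod_nonneg) (simp add: less_imp_le)
      ultimately have "(\<Prod>n<N. 1 - v n) * (1 - W) \<le> (\<Prod>n<N. 1 - v n) * (1 - (\<Sum>n<N. w n))"
        "(\<Prod>n<N. 1 - w n) * (1 - (\<Sum>n<N. v n)) \<le> (\<Prod>n<N. 1 - w n) * (1 - s)"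
        using elim by (auto intro!: mult_left_mono)
      hence "(\<Prod>n<N. 1 - w n) * (1 - (\<Sum>n<N. v n)) \<le> (\<Prod>n<N. 1 - v n) * (1 - (\<Sum>n<N. w n))"
        using elim by linarith
      thus ?case using v vv' v' w by (intro prod_sum_compare_trans[of v v' w N]) (auto intro: less_imp_le)
    qed
  qed
  thus ?thesis
  proof eventually_elim
    case (elim N)
    have "lin_prod r N 1 * ((\<Prod>n<N. 1 - w n) * (1 - (\<Sum>n<N. v' n))) \<le> lin_prod r N 1 * ((\<Prod>n<N. 1 - v' n) * (1 - (\<Sum>n<N. w n)))"
      using elim pos[of N] by (intro mult_left_mono) auto
    moreover have "(\<Sum>n<N. w n) = 2 * (\<Sum>n<N. r n / (1 + r n))" by (simp add: w_def sum_distrib_left)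
    ultimately show ?case unfolding r_def[symmetric] v'_def[symmetric] lw lv[of v'] by (simp add: mult_ac)
  qed
qed

subsection \<open>Energy bounds\<close>

lemma energy_ereal:
  fixes F :: "real ^ 'd \<Rightarrow> real"
  shows "energy (\<lambda>x. ereal (F x)) \<omega> =
    ereal ((\<Sum>x\<in>#\<omega>. \<Sum>y\<in>#\<omega>. F (x - y)) - real (size \<omega>) * F 0)"
proof -
  have e: "(\<Sum>x\<in>#M. ereal (f x)) = ereal (\<Sum>x\<in>#M. f x)" for M :: "(real ^ 'd) multiset" and f
    by (induction M) auto
  have "(\<Sum>x\<in>#\<omega>. \<Sum>y\<in>#\<omega> - {#x#}. F (x - y)) = (\<Sum>x\<in>#\<omega>. (\<Sum>y\<in>#\<omega>. F (x - y)) - F 0)"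
  proof (intro arg_cong[of _ _ sum_mset] image_mset_cong)
    fix x assume "x \<in># \<omega>"
    then obtain A where A: "\<omega> = add_mset x A" by (meson multi_member_split)
    thus "(\<Sum>y\<in>#\<omega> - {#x#}. F (x - y)) = (\<Sum>y\<in>#\<omega>. F (x - y)) - F 0" by simp
  qed
  also have "\<dots> = (\<Sum>x\<in>#\<omega>. \<Sum>y\<in>#\<omega>. F (x - y)) - real (size \<omega>) * F 0"
  proof -
    have "(\<Sum>x\<in>#M. h x - c) = (\<Sum>x\<in>#M. h x) - real (size M) * c" for M :: "(real ^ 'd) multiset" and h and c :: real
      by (induction M) (auto simp: algebra_simps)
    thus ?thesis .
  qed
  finally show ?thesis unfolding energy_def e by simp
qed

text \<open>The double sum is the squared modulus of the sum of the unit vectors with angles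
  \<open>h x\<close>.\<close>

lemma sum_mset_cos_diff_nonneg:
  fixes h :: "'a \<Rightarrow> real"
  shows "0 \<le> (\<Sum>x\<in>#M. \<Sum>y\<in>#M. cos (h x - h y))"
proof -
  have "(\<Sum>y\<in>#M. cos (h x - h y)) = cos (h x) * (\<Sum>y\<in>#M. cos (h y)) + sin (h x) * (\<Sum>y\<in>#M. sin (h y))" for x
    by (induction M) (auto simp: cos_diff algebra_simps)
  moreover have "(\<Sum>x\<in>#M. cos (h x) * c + sin (h x) * d) = (\<Sum>y\<in>#M. cos (h y)) * c + (\<Sum>y\<in>#M. sin (h y)) * d" for c d
    by (induction M) (auto simp: algebra_simps)
  ultimately have "(\<Sum>x\<in>#M. \<Sum>y\<in>#M. cos (h x - h y)) = (\<Sum>y\<in>#M. cos (h y))\<^sup>2 + (\<Sum>y\<in>#M. sin (h y))\<^sup>2"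
    by (simp add: power2_eq_square)
  thus ?thesis by simp
qed

lemma tendsto_sum_mset:
  fixes f :: "'b \<Rightarrow> 'a \<Rightarrow> real"
  assumes "\<And>x. ((\<lambda>N. f N x) \<longlongrightarrow> g x) F"
  shows "((\<lambda>N. \<Sum>x\<in>#M. f N x) \<longlongrightarrow> (\<Sum>x\<in>#M. g x)) F"
  by (induction M) (auto intro!: tendsto_add assms)

text \<open>Over all pairs the nonconstant cosine terms are nonnegative, so at least
  \<open>16 * a0\<close> remains; removing the diagonal costs four times the coefficient sum. The
  left side is this number regrouped by the ordered pairs of the optimal configuration, four at
  \<open>(1, -1)\<close> and eight at \<open>(-1, 0)\<close>.\<close>

lemma sum_mset_minorant_bound:
  fixes u v :: "'a \<Rightarrow> real" and \<Phi> :: "real \<Rightarrow> real \<Rightarrow> real"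
  assumes coeffs: "0 \<le> a1" "0 \<le> b1" "0 \<le> b2"
    and minorant: "\<And>s t. s \<in> {-1..1} \<Longrightarrow> t \<in> {-1..1} \<Longrightarrow> a0 + a1 * s + b1 * t + b2 * (2 * t\<^sup>2 - 1) \<le> \<Phi> s t"
    and size: "size M = 4"
  shows "4 * (a0 + a1 - b1 + b2) + 8 * (a0 - a1 - b2) \<le>
    (\<Sum>x\<in>#M. \<Sum>y\<in>#M - {#x#}. \<Phi> (cos (2 * pi * (u x - u y))) (cos (2 * pi * (v x - v y))))"
proof -
  define g where "g x y = a0 + a1 * cos (2 * pi * u x - 2 * pi * u y) +
    b1 * cos (2 * pi * v x - 2 * pi * v y) + b2 * cos (4 * pi * v x - 4 * pi * v y)" for x y
  have gle: "g x y \<le> \<Phi> (cos (2 * pi * (u x - u y))) (cos (2 * pi * (v x - v y)))" for x y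
  proof -
    have "cos (4 * pi * v x - 4 * pi * v y) = 2 * (cos (2 * pi * (v x - v y)))\<^sup>2 - 1"
      using cos_double_cos[of "2 * pi * (v x - v y)"] by (simp add: algebra_simps)
    moreover have "cos (2 * pi * u x - 2 * pi * u y) = cos (2 * pi * (u x - u y))"
      "cos (2 * pi * v x - 2 * pi * v y) = cos (2 * pi * (v x - v y))" by (simp_all add: right_diff_distrib)
    ultimately show ?thesis
      using minorant[of "cos (2 * pi * (u x - u y))" "cos (2 * pi * (v x - v y))"] by (simp add: g_def)
  qed
  have add: "(\<Sum>x\<in>#A. h x + k x) = (\<Sum>x\<in>#A. h x) + (\<Sum>x\<in>#A. k x)" for A :: "'a multiset" and h k :: "'a \<Rightarrow> real"
    by (rule sum_mset.distrib)
  have const: "(\<Sum>x\<in>#A. c) = real (size A) * c" for A :: "'a multiset" and c :: real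
    by (induction A) (auto simp: algebra_simps)
  have mult: "(\<Sum>x\<in>#A. c * h x) = c * (\<Sum>x\<in>#A. h x)" for A :: "'a multiset" and h :: "'a \<Rightarrow> real" and c
    by (induction A) (auto simp: algebra_simps)
  define C1 C2 C3 where "C1 = (\<Sum>x\<in>#M. \<Sum>y\<in>#M. cos (2 * pi * u x - 2 * pi * u y))"
    and "C2 = (\<Sum>x\<in>#M. \<Sum>y\<in>#M. cos (2 * pi * v x - 2 * pi * v y))"
    and "C3 = (\<Sum>x\<in>#M. \<Sum>y\<in>#M. cos (4 * pi * v x - 4 * pi * v y))"
  have "(\<Sum>x\<in>#M. \<Sum>y\<in>#M. g x y) = 16 * a0 + a1 * C1 + b1 * C2 + b2 * C3"
    unfolding g_def add mult const size C1_def C2_def C3_def by simp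
  moreover have "0 \<le> a1 * C1" "0 \<le> b1 * C2" "0 \<le> b2 * C3"
    unfolding C1_def C2_def C3_def by (intro mult_nonneg_nonneg coeffs sum_mset_cos_diff_nonneg)+
  ultimately have ge: "16 * a0 \<le> (\<Sum>x\<in>#M. \<Sum>y\<in>#M. g x y)" by linarith
  have "(\<Sum>x\<in>#M. \<Sum>y\<in>#M - {#x#}. g x y) = (\<Sum>x\<in>#M. (\<Sum>y\<in>#M. g x y) + - (a0 + a1 + b1 + b2))"
  proof (intro arg_cong[of _ _ sum_mset] image_mset_cong)
    fix x assume "x \<in># M"
    then obtain A where A: "M = add_mset x A" by (meson multi_member_split)
    thus "(\<Sum>y\<in>#M - {#x#}. g x y) = (\<Sum>y\<in>#M. g x y) + - (a0 + a1 + b1 + b2)" by (simp add: g_def)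
  qed
  also have "\<dots> = (\<Sum>x\<in>#M. \<Sum>y\<in>#M. g x y) - 4 * (a0 + a1 + b1 + b2)" unfolding add const size by simp
  finally have "16 * a0 - 4 * (a0 + a1 + b1 + b2) \<le> (\<Sum>x\<in>#M. \<Sum>y\<in>#M - {#x#}. g x y)" using ge by linarith
  also have "\<dots> \<le> (\<Sum>x\<in>#M. \<Sum>y\<in>#M - {#x#}. \<Phi> (cos (2 * pi * (u x - u y))) (cos (2 * pi * (v x - v y))))"
    by (intro sum_mset_mono gle)
  finally show ?thesis by (simp add: algebra_simps)
qed

lemma theta_energy_bound:
  fixes u v :: "'a \<Rightarrow> real"
  assumes a: "0 < a" and ab: "4 * a / 3 \<le> b" and size: "size M = 4"
  shows "4 * (theta a 0 * theta b (1 / 2)) + 8 * (theta a (1 / 2) * theta b (1 / 4)) \<le>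
    (\<Sum>x\<in>#M. \<Sum>y\<in>#M - {#x#}. theta a (u x - u y) * theta b (v x - v y))"
proof -
  have b: "0 < b" using a ab by simp
  define A B where "A N = lin_prod (sech_coeff a) N" and "B N = lin_prod (sech_coeff b) N" for N
  define ka kb where "ka = theta a (1 / 4)" and "kb = theta b (1 / 4)"
  have k: "0 < ka" "0 < kb" using theta_pos a b by (auto simp: ka_def kb_def)
  have A: "(\<lambda>N. ka * A N (cos (2 * pi * w))) \<longlonglongrightarrow> theta a w" for w
    using tendsto_mult_left[OF theta_product[OF a, of w], of ka] k by (simp add: A_def ka_def)
  have B: "(\<lambda>N. kb * B N (cos (2 * pi * w))) \<longlonglongrightarrow> theta b w" for w
    using tendsto_mult_left[OF theta_product[OF b, of w], of kb] k by (simp add: B_def kb_def)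
  have B0: "B N 0 = 1" for N by (simp add: B_def lin_prod_def)
  have A1: "(\<lambda>N. ka * A N 1) \<longlonglongrightarrow> theta a 0" and Am: "(\<lambda>N. ka * A N (-1)) \<longlonglongrightarrow> theta a (1 / 2)"
    using A[of 0] A[of "1 / 2"] by simp_all
  have Bm: "(\<lambda>N. kb * B N (-1)) \<longlonglongrightarrow> theta b (1 / 2)" using B[of "1 / 2"] by simp
  show ?thesis
  proof (rule tendsto_le)
    show "(\<lambda>N. \<Sum>x\<in>#M. \<Sum>y\<in>#M - {#x#}. (ka * A N (cos (2 * pi * (u x - u y)))) * (kb * B N (cos (2 * pi * (v x - v y)))))
      \<longlonglongrightarrow> (\<Sum>x\<in>#M. \<Sum>y\<in>#M - {#x#}. theta a (u x - u y) * theta b (v x - v y))"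
      by (intro tendsto_sum_mset tendsto_mult A B)
    \<comment> \<open>In the second term \<open>kb\<close> stands alone because \<open>B N 0\<close>
      equals 1.\<close>
    show "(\<lambda>N. 4 * ((ka * A N 1) * (kb * B N (-1))) + 8 * ((ka * A N (-1)) * kb)) \<longlonglongrightarrow>
      4 * (theta a 0 * theta b (1 / 2)) + 8 * (theta a (1 / 2) * theta b (1 / 4))"
      unfolding kb_def[symmetric] by (intro tendsto_intros A1 Am Bm)
    have "\<forall>\<^sub>F N in sequentially. 0 < N" by (rule eventually_gt_at_top)
    with lin_prod_condition[OF a ab]
    show "\<forall>\<^sub>F N in sequentially. 4 * ((ka * A N 1) * (kb * B N (-1))) + 8 * ((ka * A N (-1)) * kb) \<le>
       (\<Sum>x\<in>#M. \<Sum>y\<in>#M - {#x#}. (ka * A N (cos (2 * pi * (u x - u y)))) * (kb * B N (cos (2 * pi * (v x - v y)))))"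
    proof eventually_elim
      case (elim N)
      obtain a0 a1 b1 b2 where m: "0 \<le> a1" "0 \<le> b1" "0 \<le> b2"
        "\<And>s t. s \<in> {-1..1} \<Longrightarrow> t \<in> {-1..1} \<Longrightarrow>
           a0 + a1 * s + b1 * t + b2 * (2 * t\<^sup>2 - 1) \<le> A N s * B N t"
        "a0 + a1 - b1 + b2 = A N 1 * B N (-1)" "a0 - a1 - b2 = A N (-1)"
        using lin_prod_minorant[OF sech_coeff_bounds[OF a] sech_coeff_bounds[OF b] elim(2,1)]
        unfolding A_def B_def by blast
      have "(ka * kb) * (4 * (a0 + a1 - b1 + b2) + 8 * (a0 - a1 - b2)) \<le> (ka * kb) *
        (\<Sum>x\<in>#M. \<Sum>y\<in>#M - {#x#}. A N (cos (2 * pi * (u x - u y))) * B N (cos (2 * pi * (v x - v y))))"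
        using sum_mset_minorant_bound[OF m(1-4) size, of u v] k by (intro mult_left_mono) auto
      also have "\<dots> = (\<Sum>x\<in>#M. \<Sum>y\<in>#M - {#x#}. (ka * A N (cos (2 * pi * (u x - u y)))) * (kb * B N (cos (2 * pi * (v x - v y)))))"
        by (simp add: sum_mset_distrib_left mult_ac)
      finally show ?case unfolding m(5,6) by (simp add: algebra_simps)
    qed
  qed simp
qed

lemma energy_four_points:
  assumes a: "0 < a" and \<beta>: "0 < \<beta>"
  defines "b \<equiv> 4 * a * \<beta>\<^sup>2"
  shows "energy (\<lambda>x. ereal (periodic_gaussian a (rect_lattice \<beta>) x)) (four_points \<beta>) =
    ereal (4 * (theta a 0 * theta b (1 / 2)) + 8 * (theta a (1 / 2) * theta b (1 / 4)))"
proof -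
  have F: "periodic_gaussian a (rect_lattice \<beta>) x = theta a (x $ 1) * theta b (x $ 2 / (2 * \<beta>))" for x :: "real ^ 2"
    using periodic_gaussian_rect_lattice(1)[OF a \<beta>] by (simp add: b_def)
  have m: "theta a (- w) = theta a w" "theta b (- w) = theta b w" for w by (rule theta_minus)+
  have t34: "theta b (3 / 4) = theta b (1 / 4)" using theta_add_int[of b "- 1 / 4" 1] theta_minus[of b "1 / 4"] by simp
  have t4: "theta b (1 / 2 / 2) = theta b (1 / 4)" by simp
  have q: "\<beta> / (2 * \<beta>) = 1 / 2" "(\<beta> / 2) / (2 * \<beta>) = 1 / 4" "(3 * \<beta> / 2) / (2 * \<beta>) = 3 / 4"
    "(\<beta> - \<beta> / 2) / (2 * \<beta>) = 1 / 4" "(\<beta> - 3 * \<beta> / 2) / (2 * \<beta>) = - (1 / 4)" "(\<beta> / 2 - \<beta>) / (2 * \<beta>) = - (1 / 4)"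
    "(3 * \<beta> / 2 - \<beta>) / (2 * \<beta>) = 1 / 4" "(\<beta> / 2 - 3 * \<beta> / 2) / (2 * \<beta>) = - (1 / 2)" "(3 * \<beta> / 2 - \<beta> / 2) / (2 * \<beta>) = 1 / 2"
    "- \<beta> / (2 * \<beta>) = - (1 / 2)" "- (\<beta> / 2) / (2 * \<beta>) = - (1 / 4)" "- (3 * \<beta> / 2) / (2 * \<beta>) = - (3 / 4)"
    "(0 - \<beta>) / (2 * \<beta>) = - (1 / 2)" "(0 - \<beta> / 2) / (2 * \<beta>) = - (1 / 4)" "(0 - 3 * \<beta> / 2) / (2 * \<beta>) = - (3 / 4)"
    using \<beta> by (simp_all add: field_simps)
  show ?thesis unfolding energy_ereal F four_points_def
    using \<beta> by (simp add: q m t34 t4 del: divide_divide_eq_left times_divide_eq_left times_divide_eq_right)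
qed

lemma optimal_four_points:
  assumes a: "0 < a" and \<beta>: "1 / sqrt 3 \<le> \<beta>"
  shows "optimal (\<lambda>x. ereal (periodic_gaussian a (rect_lattice \<beta>) x)) (four_points \<beta>)"
proof -
  have \<beta>0: "0 < \<beta>" by (rule less_le_trans[OF _ \<beta>]) simp
  define b where "b = 4 * a * \<beta>\<^sup>2"
  have "(1 / sqrt 3)\<^sup>2 \<le> \<beta>\<^sup>2" using \<beta> by (intro power_mono) auto
  hence "1 / 3 \<le> \<beta>\<^sup>2" by (simp add: power_divide)
  hence "4 * a * (1 / 3) \<le> b" unfolding b_def using a by (intro mult_left_mono) auto
  hence ab: "4 * a / 3 \<le> b" by simp
  let ?F = "\<lambda>x. ereal (periodic_gaussian a (rect_lattice \<beta>) x)"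
  have sz: "size (four_points \<beta>) = 4" by (simp add: four_points_def)
  have F: "periodic_gaussian a (rect_lattice \<beta>) x = theta a (x $ 1) * theta b (x $ 2 / (2 * \<beta>))" for x :: "real ^ 2"
    using periodic_gaussian_rect_lattice(1)[OF a \<beta>0] by (simp add: b_def)
  have "energy ?F (four_points \<beta>) \<le> energy ?F \<omega>" if "size \<omega> = 4" for \<omega>
  proof -
    have e: "(\<Sum>x\<in>#M. ereal (f x)) = ereal (\<Sum>x\<in>#M. f x)" for M :: "(real ^ 2) multiset" and f
      by (induction M) auto
    have "energy ?F \<omega> = ereal (\<Sum>x\<in>#\<omega>. \<Sum>y\<in>#\<omega> - {#x#}. theta a (x $ 1 - y $ 1) * theta b (x $ 2 / (2 * \<beta>) - y $ 2 / (2 * \<beta>)))"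
      unfolding energy_def e F by (simp add: diff_divide_distrib)
    thus ?thesis unfolding energy_four_points[OF a \<beta>0] b_def[symmetric]
      using theta_energy_bound[OF a ab that, of "\<lambda>x. x $ 1" "\<lambda>x. x $ 2 / (2 * \<beta>)"] by simp
  qed
  thus ?thesis unfolding optimal_def sz
    by (intro antisym INF_greatest INF_lower) (auto simp: sz)
qed

text \<open>One unit of the exponent is set aside to keep the sum convergent; the rest yields a
  uniform decay rate in \<open>a\<close>.\<close>

lemma periodic_gaussian_le:
  fixes x :: "real ^ 2"
  assumes a: "1 \<le> a" and \<beta>: "0 < \<beta>" and d: "\<And>v. v \<in> rect_lattice \<beta> \<Longrightarrow> d \<le> (norm (x + v))\<^sup>2"
  shows "periodic_gaussian a (rect_lattice \<beta>) x \<le> exp (- (a - 1) * d) * periodic_gaussian 1 (rect_lattice \<beta>) x"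
proof -
  have s: "(\<lambda>v. exp (- c * (norm (x + v))\<^sup>2)) summable_on rect_lattice \<beta>" if "0 < c" for c
    by (rule periodic_gaussian_rect_lattice(2)[OF that \<beta>])
  have "periodic_gaussian a (rect_lattice \<beta>) x \<le> (\<Sum>\<^sub>\<infinity>v\<in>rect_lattice \<beta>. exp (- (a - 1) * d) * exp (- 1 * (norm (x + v))\<^sup>2))"
    unfolding periodic_gaussian_def
  proof (intro infsum_mono s summable_on_cmult_right)
    fix v assume "v \<in> rect_lattice \<beta>"
    hence "(a - 1) * d \<le> (a - 1) * (norm (x + v))\<^sup>2" using d a by (intro mult_left_mono) auto
    hence "- a * (norm (x + v))\<^sup>2 \<le> - (a - 1) * d + - 1 * (norm (x + v))\<^sup>2" by (simp add: algebra_simps)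
    thus "exp (- a * (norm (x + v))\<^sup>2) \<le> exp (- (a - 1) * d) * exp (- 1 * (norm (x + v))\<^sup>2)"
      by (simp flip: exp_add)
  qed (use a in auto)
  also have "\<dots> = exp (- (a - 1) * d) * periodic_gaussian 1 (rect_lattice \<beta>) x"
    unfolding periodic_gaussian_def by (rule infsum_cmult_right) (use s[of 1] in simp)
  finally show ?thesis .
qed

lemma norm_add_rect_lattice_ge:
  fixes x :: "real ^ 2"
  assumes "v \<in> rect_lattice \<beta>"
    and "\<And>j k :: int. d \<le> (x $ 1 + of_int j)\<^sup>2 + (x $ 2 + 2 * \<beta> * of_int k)\<^sup>2"
  shows "d \<le> (norm (x + v))\<^sup>2"
proof -
  obtain j k :: int where v: "v = vector [of_int j, 2 * \<beta> * of_int k]"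
    using assms(1) by (auto simp: rect_lattice_def)
  have "(norm (x + v))\<^sup>2 = (x $ 1 + of_int j)\<^sup>2 + (x $ 2 + 2 * \<beta> * of_int k)\<^sup>2"
    by (simp add: norm_vec_def L2_set_def sum_2 v)
  thus ?thesis using assms(2) by simp
qed

subsection \<open>Small aspect ratios\<close>

text \<open>A point of \<open>{y..P - y}\<close> has distance at least \<open>y\<close> from every
  multiple of \<open>P\<close>, and so has its negative.\<close>

lemma shift_square_ge:
  fixes w y P :: real and j :: int
  assumes "0 \<le> y" "y \<le> w" "w \<le> P - y"
  shows "y\<^sup>2 \<le> (w + P * of_int j)\<^sup>2" and "y\<^sup>2 \<le> (- w + P * of_int j)\<^sup>2"
proof -
  have ge: "y\<^sup>2 \<le> (w + P * of_int j)\<^sup>2" for j :: int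
  proof (cases "0 \<le> j")
    case True
    hence "0 \<le> P * of_int j" using assms by (intro mult_nonneg_nonneg) auto
    thus ?thesis using assms by (intro power_mono) auto
  next
    case False
    hence "of_int j \<le> (-1 :: real)" by linarith
    hence "P * of_int j \<le> P * (-1)" using assms by (intro mult_left_mono) auto
    hence "y \<le> - (w + P * of_int j)" using assms by linarith
    hence "y\<^sup>2 \<le> (- (w + P * of_int j))\<^sup>2" using assms by (intro power_mono) auto
    thus ?thesis by (simp only: power2_minus)
  qed
  show "y\<^sup>2 \<le> (w + P * of_int j)\<^sup>2" by (rule ge)
  have "(- w + P * of_int j)\<^sup>2 = (w + P * of_int (- j))\<^sup>2" by (simp add: power2_eq_square algebra_simps)
  thus "y\<^sup>2 \<le> (- w + P * of_int j)\<^sup>2" using ge[of "- j"] by simp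
qed

lemma not_universally_optimal:
  fixes \<beta> :: real
  assumes \<beta>: "0 < \<beta>" "\<beta> < 1 / sqrt 3"
  shows "\<not> universally_optimal (rect_lattice \<beta>) (four_points \<beta>)"
proof
  assume opt: "universally_optimal (rect_lattice \<beta>) (four_points \<beta>)"
  \<comment> \<open>A vector of height \<open>\<beta> / 2\<close> has length \<open>\<beta>\<close>
    when its horizontal part is \<open>h\<close>. That \<open>h\<close> is below
    \<open>1 / 2\<close> means that diagonal neighbours are farther apart than vertical
    ones.\<close>
  define h where "h = sqrt 3 * \<beta> / 2"
  have h: "0 < h" "h < 1 / 2" using \<beta> by (auto simp: h_def field_simps)
  have h2: "h\<^sup>2 = 3 / 4 * \<beta>\<^sup>2" by (simp add: h_def power_divide power_mult_distrib)
  \<comment> \<open>Midpoint of the interval from 0 to \<open>1 / 2 - h\<close>; every shift inside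
    it makes both kinds of neighbour distances exceed \<open>\<beta>\<close>.\<close>
  define x where "x = (1 / 2 - h) / 2"
  have x: "0 < x" "x < 1 / 2" "h < 1 / 2 - x" using h by (auto simp: x_def field_simps)
  define d where "d = min (x\<^sup>2 + \<beta>\<^sup>2) ((1 / 2 - x)\<^sup>2 + (\<beta> / 2)\<^sup>2)"
  have "h\<^sup>2 < (1 / 2 - x)\<^sup>2" using h x by (intro power_strict_mono) auto
  hence "\<beta>\<^sup>2 < (1 / 2 - x)\<^sup>2 + (\<beta> / 2)\<^sup>2" using h2 by (simp add: power_divide)
  moreover have "\<beta>\<^sup>2 < x\<^sup>2 + \<beta>\<^sup>2" using x by simp
  ultimately have d\<beta>: "\<beta>\<^sup>2 < d" by (simp add: d_def)
  define p1 p2 p3 p4 :: "real ^ 2" where "p1 = vector [0, 0]" and "p2 = vector [x, \<beta>]"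
    and "p3 = vector [1 / 2, \<beta> / 2]" and "p4 = vector [1 / 2 + x, 3 * \<beta> / 2]"
  define \<omega> where "\<omega> = {# p1, p2, p3, p4 #}"
  define F where "F a = periodic_gaussian a (rect_lattice \<beta>)" for a
  define S where "S a = F a (p1 - p2) + F a (p1 - p3) + F a (p1 - p4) + F a (p2 - p1) + F a (p2 - p3) + F a (p2 - p4) +
    F a (p3 - p1) + F a (p3 - p2) + F a (p3 - p4) + F a (p4 - p1) + F a (p4 - p2) + F a (p4 - p3)" for a
  have energy: "energy (\<lambda>x. ereal (F a x)) \<omega> = ereal (S a)" for a
    unfolding energy_ereal \<omega>_def S_def by simp
  have le: "F a (p - q) \<le> exp (- (a - 1) * d) * F 1 (p - q)" "F a (q - p) \<le> exp (- (a - 1) * d) * F 1 (q - p)"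
    if a: "1 \<le> a" and pq: "0 \<le> y" "y \<le> w" "w \<le> 1 - y" "0 \<le> y'" "y' \<le> w'" "w' \<le> 2 * \<beta> - y'"
      "d \<le> y\<^sup>2 + y'\<^sup>2" "\<bar>(p - q) $ 1\<bar> = w" "\<bar>(p - q) $ 2\<bar> = w'" for a y w y' w' and p q :: "real ^ 2"
  proof -
    have g: "d \<le> (z $ 1 + of_int j)\<^sup>2 + (z $ 2 + 2 * \<beta> * of_int k)\<^sup>2"
      if z: "\<bar>z $ 1\<bar> = w" "\<bar>z $ 2\<bar> = w'" for z :: "real ^ 2" and j k :: int
    proof -
      have "z $ 1 = w \<or> z $ 1 = - w" "z $ 2 = w' \<or> z $ 2 = - w'" using z by linarith+
      hence "y\<^sup>2 \<le> (z $ 1 + 1 * of_int j)\<^sup>2" "y'\<^sup>2 \<le> (z $ 2 + 2 * \<beta> * of_int k)\<^sup>2"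
        using shift_square_ge[OF pq(1-3), of j] shift_square_ge[OF pq(4-6), of k] by metis+
      thus ?thesis using pq(7) by simp
    qed
    show "F a (p - q) \<le> exp (- (a - 1) * d) * F 1 (p - q)"
      unfolding F_def by (rule periodic_gaussian_le[OF a \<beta>(1) norm_add_rect_lattice_ge[OF _ g[OF pq(8,9)]]])
    have qp: "\<bar>(q - p) $ 1\<bar> = w" "\<bar>(q - p) $ 2\<bar> = w'" using pq(8,9) by (simp_all add: abs_minus_commute)
    show "F a (q - p) \<le> exp (- (a - 1) * d) * F 1 (q - p)"
      unfolding F_def by (rule periodic_gaussian_le[OF a \<beta>(1) norm_add_rect_lattice_ge[OF _ g[OF qp]]])
  qed
  have S: "S a \<le> exp (- (a - 1) * d) * S 1" if a: "1 \<le> a" for a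
  proof -
    have d1: "d \<le> x\<^sup>2 + \<beta>\<^sup>2" "d \<le> (1 / 2 - x)\<^sup>2 + (\<beta> / 2)\<^sup>2" by (simp_all add: d_def)
    note l21 = le[OF a, of x x \<beta> \<beta> p2 p1]
    note l31 = le[OF a, of "1 / 2 - x" "1 / 2" "\<beta> / 2" "\<beta> / 2" p3 p1]
    \<comment> \<open>Modulo the periods 1 and \<open>2 * \<beta>\<close> this difference is, up to
      sign, \<open>(1 / 2 - x, \<beta> / 2)\<close>.\<close>
    note l41 = le[OF a, of "1 / 2 - x" "1 / 2 + x" "\<beta> / 2" "3 * \<beta> / 2" p4 p1]
    note l32 = le[OF a, of "1 / 2 - x" "1 / 2 - x" "\<beta> / 2" "\<beta> / 2" p3 p2]
    note l42 = le[OF a, of "1 / 2 - x" "1 / 2" "\<beta> / 2" "\<beta> / 2" p4 p2]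
    note l43 = le[OF a, of x x \<beta> \<beta> p4 p3]
    show ?thesis unfolding S_def distrib_left
      by (intro add_mono l21 l31 l41 l32 l42 l43) (use x \<beta> d1 in \<open>simp_all add: p1_def p2_def p3_def p4_def\<close>)
  qed
  \<comment> \<open>By the assumed optimality the shifted configuration has at least the energy of
    the original one, which contains a vertical pair at distance \<open>\<beta>\<close>.\<close>
  have lower: "exp (- a * \<beta>\<^sup>2) \<le> S a" if a: "1 \<le> a" for a
  proof -
    define b where "b = 4 * a * \<beta>\<^sup>2"
    have ab: "0 < a" "0 < b" using a \<beta> by (auto simp: b_def)
    have sz: "size \<omega> = size (four_points \<beta>)" by (simp add: \<omega>_def four_points_def)
    have "exp (- a * \<beta>\<^sup>2) = 1 * exp (- b * (1 / 2)\<^sup>2)" by (simp add: b_def power2_eq_square)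
    also have "\<dots> \<le> theta a 0 * theta b (1 / 2)"
    proof (intro mult_mono)
      show "1 \<le> theta a 0" using theta_lower(2)[OF ab(1)] exp_gt_zero[of "- a"] by linarith
      show "exp (- b * (1 / 2)\<^sup>2) \<le> theta b (1 / 2)"
        using theta_lower(1)[OF ab(2), of "1 / 2"] exp_gt_zero[of "- b * (1 - 1 / 2)\<^sup>2"] by linarith
    qed (use theta_pos[OF ab(1), of 0] in auto)
    also have "\<dots> \<le> 4 * (theta a 0 * theta b (1 / 2)) + 8 * (theta a (1 / 2) * theta b (1 / 4))"
    proof -
      have "0 \<le> theta a 0 * theta b (1 / 2)" "0 \<le> theta a (1 / 2) * theta b (1 / 4)"
        using ab theta_pos by (auto intro!: mult_nonneg_nonneg less_imp_le)
      thus ?thesis by linarith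
    qed
    finally have "ereal (exp (- a * \<beta>\<^sup>2)) \<le> energy (\<lambda>x. ereal (F a x)) (four_points \<beta>)"
      unfolding F_def energy_four_points[OF ab(1) \<beta>(1)] b_def by simp
    also have "\<dots> \<le> energy (\<lambda>x. ereal (F a x)) \<omega>"
    proof -
      have "optimal (\<lambda>x. ereal (F a x)) (four_points \<beta>)"
        using opt ab(1) by (simp add: universally_optimal_def F_def)
      hence "energy (\<lambda>x. ereal (F a x)) (four_points \<beta>) =
        (INF \<omega>'\<in>{\<omega>'. size \<omega>' = size (four_points \<beta>)}. energy (\<lambda>x. ereal (F a x)) \<omega>')"
        by (simp only: optimal_def)
      also have "\<dots> \<le> energy (\<lambda>x. ereal (F a x)) \<omega>" using sz by (intro INF_lower) simp
      finally show ?thesis .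
    qed
    finally show ?thesis by (simp add: energy)
  qed
  define K where "K = exp d * S 1"
  \<comment> \<open>Since \<open>d\<close> exceeds \<open>\<beta>\<^sup>2\<close>, the two decay
    rates conflict for large \<open>a\<close>; this value suffices because every real number is
    below its exponential.\<close>
  define a where "a = max 1 (K / (d - \<beta>\<^sup>2))"
  have a: "1 \<le> a" by (simp add: a_def)
  have "K / (d - \<beta>\<^sup>2) \<le> a" by (simp add: a_def)
  hence "K \<le> a * (d - \<beta>\<^sup>2)" using d\<beta> by (simp add: pos_divide_le_eq)
  also have "\<dots> < exp (a * (d - \<beta>\<^sup>2))" using exp_ge_add_one_self[of "a * (d - \<beta>\<^sup>2)"] by linarith
  finally have "K < exp (a * (d - \<beta>\<^sup>2))" .
  hence "exp (- a * d) * K < exp (- a * d) * exp (a * (d - \<beta>\<^sup>2))" by (intro mult_strict_left_mono) auto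
  also have "\<dots> = exp (- a * \<beta>\<^sup>2)" by (simp add: algebra_simps flip: exp_add)
  also have "\<dots> \<le> exp (- (a - 1) * d) * S 1" using lower[OF a] S[OF a] by linarith
  also have "\<dots> = exp (- a * d) * K"
  proof -
    have "- (a - 1) * d = - a * d + d" by (simp add: algebra_simps)
    thus ?thesis unfolding K_def by (simp only: exp_add mult.assoc)
  qed
  finally show False by simp
qed

theorem theorem4:
  fixes \<beta> :: real
  assumes "\<beta> > 0"
  shows "universally_optimal (rect_lattice \<beta>) (four_points \<beta>) \<longleftrightarrow> \<beta> \<ge> 1 / sqrt 3"
proof
  assume "universally_optimal (rect_lattice \<beta>) (four_points \<beta>)"
  thus "\<beta> \<ge> 1 / sqrt 3" using not_universally_optimal[OF assms] by force
next
  assume "\<beta> \<ge> 1 / sqrt 3"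
  thus "universally_optimal (rect_lattice \<beta>) (four_points \<beta>)"
    using optimal_four_points by (simp add: universally_optimal_def)
qed

end
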